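(* Let $a\in C^1(\mathbb{R})$ be $1$-periodic and uniformly positive, let $0<\varepsilon\le\eta\le1$ and $\alpha=\varepsilon/\eta$, and let $W$, $W_0$, $\Omega$, $B$ be as defined in the context. For any fixed $\alpha_0\in(0,1]$, the function $W(\cdot,\alpha)$ belongs to $L^2(-\pi,\pi)\cap L^\infty(-\pi,\pi)$ with norms bounded independently of $\alpha\le\alpha_0$. Moreover, when $K\in\mathbb{K}^{r,q}$ and $W(\cdot,\alpha)\in C^r(-\pi,\pi)$, we have, for $r=0$ and $r=1$ respectively, $$W(0,\alpha)=0,\qquad \partial_kW(0,\alpha)=\frac i2\left.\frac{d^2}{dk^2}\big(\Omega(k)B(k)\big)\right|_{k=0}+\mathcal{O}(\alpha^q),$$ and for $r\ge2$, $$\partial_k^rW_0(0,\alpha)=\frac{i}{r+1}\left.\frac{d^{r+1}}{dk^{r+1}}\big(\Omega(k)B(k)\big)\right|_{k=0}+\mathcal{O}\big(\varepsilon^{-r+1}\alpha^q\big).$$ The constants in the $\mathcal{O}$-terms are independent of $\varepsilon$ and $\eta$ (hence of $\alpha$).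
   Context: Kernels: $\mathbb{K}^{p,q}$ is the set of real functions $K\in C^q_c(\mathbb{R})$ with $\operatorname{supp}K\subset[-1,1]$, $\int K(x)\,dx=1$ and $\int K(x)x^j\,dx=0$ for $1\le j\le p$. The kernel $K$ used below is in some $\mathbb{K}^{p,q}$ with $q\ge1$, and $K_\eta(x)=\eta^{-1}K(x/\eta)$. Bloch waves: for each $k\in[-\pi,\pi]$ let $\omega_m^2(k)$ ($\omega_m\ge0$, $0\le\omega_0^2\le\omega_1^2\le\cdots$) and $\psi_m(\cdot,k)$, $m=0,1,2,\dots$, be the eigenvalues and eigenfunctions, $1$-periodic in $y$, of $$-(\partial_y+ik)\,a(y)\,(\partial_y+ik)\psi=\omega^2(k)\psi,$$ with $\{\psi_m(\cdot,k)\}_{m\ge0}$ an orthonormal basis of $L^2(-1/2,1/2)$; $\psi_0(y,0)\equiv1$ and $\omega_0(0)=0$. Definitions (${}^*$ is complex conjugation): $$b_m(k)=\int_{-1/2}^{1/2}\psi_m^*(x,k)\,dx,\qquad s_m(k,\alpha)=\int K_\eta(t)\cos\!\big(\omega_m(k)t/\varepsilon\big)\,dt,$$ $$w_m(k,\alpha)=\varepsilon\int K_\eta(x)\,a(x/\varepsilon)\,\partial_x\!\big[\psi_m(x/\varepsilon,k)e^{ikx/\varepsilon}\big]\,dx,$$ $$W(k,\alpha)=\sum_{m=0}^\infty b_m(k)s_m(k,\alpha)w_m(k,\alpha),\qquad W_0(k,\alpha)=b_0(k)s_0(k,\alpha)w_0(k,\alpha),$$ $$\Omega(k)=\omega_0(k)^2,\qquad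 B(k)=|b_0(k)|^2 .$$ By a change of variables $s_m,w_m$, hence $W$ and $W_0$, depend on $\varepsilon,\eta$ only through $\alpha$. *)

theory Defs
  imports "HOL-Analysis.Analysis" "HOL-Probability.Essential_Supremum"
begin

definition nderiv :: "nat \<Rightarrow> (real \<Rightarrow> 'a::real_normed_vector) \<Rightarrow> real \<Rightarrow> 'a" where
  "nderiv n f = ((\<lambda>g x. vector_derivative g (at x)) ^^ n) f"

(* Existence of the n-th derivative at the single point x; nderiv alone is an unspecified
   value where the derivative does not exist. *)
primrec times_differentiable_at :: "nat \<Rightarrow> (real \<Rightarrow> 'a::real_normed_vector) \<Rightarrow> real \<Rightarrow> bool" where
  "times_differentiable_at 0 f x \<longleftrightarrow> True"
| "times_differentiable_at (Suc n) f x \<longleftrightarrow>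
     (\<forall>\<^sub>F y in nhds x. times_differentiable_at n f y) \<and> nderiv n f differentiable (at x)"

(* The class C^n on an open set S. *)
definition Cn_on :: "nat \<Rightarrow> (real \<Rightarrow> 'a::real_normed_vector) \<Rightarrow> real set \<Rightarrow> bool" where
  "Cn_on n f S \<longleftrightarrow>
     (\<forall>j<n. \<forall>x\<in>S. nderiv j f differentiable (at x)) \<and> continuous_on S (nderiv n f)"

definition in_L2 :: "real set \<Rightarrow> (real \<Rightarrow> complex) \<Rightarrow> bool" where
  "in_L2 S f \<longleftrightarrow> f \<in> borel_measurable (lebesgue_on S) \<and>
     integrable (lebesgue_on S) (\<lambda>x. (norm (f x))\<^sup>2)"

definition L2_norm_on :: "real set \<Rightarrow> (real \<Rightarrow> complex) \<Rightarrow> real" where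
  "L2_norm_on S f = sqrt (LINT x|lebesgue_on S. (norm (f x))\<^sup>2)"

definition L2_inner_on :: "real set \<Rightarrow> (real \<Rightarrow> complex) \<Rightarrow> (real \<Rightarrow> complex) \<Rightarrow> complex" where
  "L2_inner_on S f g = (LINT x|lebesgue_on S. f x * cnj (g x))"

definition Linf_norm_on :: "real set \<Rightarrow> (real \<Rightarrow> complex) \<Rightarrow> ereal" where
  "Linf_norm_on S f = esssup (lebesgue_on S) (\<lambda>x. ereal (norm (f x)))"

definition in_Linf :: "real set \<Rightarrow> (real \<Rightarrow> complex) \<Rightarrow> bool" where
  "in_Linf S f \<longleftrightarrow> f \<in> borel_measurable (lebesgue_on S) \<and> Linf_norm_on S f < \<infinity>"

definition orthonormal_basis_L2 :: "real set \<Rightarrow> (nat \<Rightarrow> real \<Rightarrow> complex) \<Rightarrow> bool" where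
  "orthonormal_basis_L2 S \<phi> \<longleftrightarrow>
     (\<forall>m. in_L2 S (\<phi> m)) \<and>
     (\<forall>m n. L2_inner_on S (\<phi> m) (\<phi> n) = (if m = n then 1 else 0)) \<and>
     (\<forall>f. in_L2 S f \<longrightarrow>
        (\<lambda>N. L2_norm_on S (\<lambda>x. f x - (\<Sum>m<N. L2_inner_on S f (\<phi> m) * \<phi> m x))) \<longlonglongrightarrow> 0)"

definition kernels :: "nat \<Rightarrow> nat \<Rightarrow> (real \<Rightarrow> real) set" where
  "kernels p q = {K. Cn_on q K UNIV \<and> closure {x. K x \<noteq> 0} \<subseteq> {-1..1} \<and>
     (LINT x|lebesgue. K x) = 1 \<and>
     (\<forall>j. 1 \<le> j \<and> j \<le> p \<longrightarrow> (LINT x|lebesgue. K x * x ^ j) = 0)}"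

definition scaled_kernel :: "(real \<Rightarrow> real) \<Rightarrow> real \<Rightarrow> real \<Rightarrow> real" where
  "scaled_kernel K \<eta> x = K (x / \<eta>) / \<eta>"

definition shifted_deriv :: "real \<Rightarrow> (real \<Rightarrow> complex) \<Rightarrow> real \<Rightarrow> complex" where
  "shifted_deriv k f y = vector_derivative f (at y) + \<i> * of_real k * f y"

(* Classical solutions: since a is C^1 and positive, differentiability of f and of the flux
   already forces f to be C^2. *)
definition bloch_eigenfunction ::
    "(real \<Rightarrow> real) \<Rightarrow> real \<Rightarrow> real \<Rightarrow> (real \<Rightarrow> complex) \<Rightarrow> bool" where
  "bloch_eigenfunction a k \<mu> f \<longleftrightarrow>
     (\<forall>y. f (y + 1) = f y) \<and>
     (\<forall>y. f differentiable (at y)) \<and>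
     (\<forall>y. (\<lambda>z. of_real (a z) * shifted_deriv k f z) differentiable (at y)) \<and>
     (\<forall>y. - shifted_deriv k (\<lambda>z. of_real (a z) * shifted_deriv k f z) y = of_real \<mu> * f y)"

definition bloch_waves ::
    "(real \<Rightarrow> real) \<Rightarrow> (nat \<Rightarrow> real \<Rightarrow> real) \<Rightarrow> (nat \<Rightarrow> real \<Rightarrow> real \<Rightarrow> complex) \<Rightarrow> bool" where
  "bloch_waves a \<omega> \<psi> \<longleftrightarrow>
     (\<forall>k\<in>{-pi..pi}.
        (\<forall>m. \<omega> m k \<ge> 0) \<and>
        (\<forall>m. (\<omega> m k)\<^sup>2 \<le> (\<omega> (Suc m) k)\<^sup>2) \<and>
        (\<forall>m. bloch_eigenfunction a k ((\<omega> m k)\<^sup>2) (\<lambda>y. \<psi> m y k)) \<and>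
        orthonormal_basis_L2 {-1/2<..<1/2} (\<lambda>m y. \<psi> m y k)) \<and>
     (\<forall>y. \<psi> 0 y 0 = 1) \<and> \<omega> 0 0 = 0"

definition b_coef :: "(nat \<Rightarrow> real \<Rightarrow> real \<Rightarrow> complex) \<Rightarrow> nat \<Rightarrow> real \<Rightarrow> complex" where
  "b_coef \<psi> m k = (LINT x|lebesgue_on {-1/2..1/2}. cnj (\<psi> m x k))"

definition s_coef ::
    "(real \<Rightarrow> real) \<Rightarrow> (nat \<Rightarrow> real \<Rightarrow> real) \<Rightarrow> real \<Rightarrow> real \<Rightarrow> nat \<Rightarrow> real \<Rightarrow> real" where
  "s_coef K \<omega> \<epsilon> \<eta> m k = (LINT t|lebesgue. scaled_kernel K \<eta> t * cos (\<omega> m k * t / \<epsilon>))"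

definition w_coef ::
    "(real \<Rightarrow> real) \<Rightarrow> (real \<Rightarrow> real) \<Rightarrow> (nat \<Rightarrow> real \<Rightarrow> real \<Rightarrow> complex) \<Rightarrow>
     real \<Rightarrow> real \<Rightarrow> nat \<Rightarrow> real \<Rightarrow> complex" where
  "w_coef a K \<psi> \<epsilon> \<eta> m k = of_real \<epsilon> *
     (LINT x|lebesgue. of_real (scaled_kernel K \<eta> x * a (x / \<epsilon>)) *
        vector_derivative (\<lambda>z. \<psi> m (z / \<epsilon>) k * exp (\<i> * of_real (k * z / \<epsilon>))) (at x))"

definition W_term ::
    "(real \<Rightarrow> real) \<Rightarrow> (real \<Rightarrow> real) \<Rightarrow> (nat \<Rightarrow> real \<Rightarrow> real) \<Rightarrow>
     (nat \<Rightarrow> real \<Rightarrow> real \<Rightarrow> complex) \<Rightarrow> real \<Rightarrow> real \<Rightarrow> nat \<Rightarrow> real \<Rightarrow> complex" where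
  "W_term a K \<omega> \<psi> \<epsilon> \<eta> m k =
     b_coef \<psi> m k * of_real (s_coef K \<omega> \<epsilon> \<eta> m k) * w_coef a K \<psi> \<epsilon> \<eta> m k"

(* W and W0 are written as functions of eps, eta and k; they depend on eps and eta only
   through alpha = eps / eta (substitute t = eta * u in s_coef and w_coef). *)
definition W ::
    "(real \<Rightarrow> real) \<Rightarrow> (real \<Rightarrow> real) \<Rightarrow> (nat \<Rightarrow> real \<Rightarrow> real) \<Rightarrow>
     (nat \<Rightarrow> real \<Rightarrow> real \<Rightarrow> complex) \<Rightarrow> real \<Rightarrow> real \<Rightarrow> real \<Rightarrow> complex" where
  "W a K \<omega> \<psi> \<epsilon> \<eta> k = (\<Sum>m. W_term a K \<omega> \<psi> \<epsilon> \<eta> m k)"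

definition W0 ::
    "(real \<Rightarrow> real) \<Rightarrow> (real \<Rightarrow> real) \<Rightarrow> (nat \<Rightarrow> real \<Rightarrow> real) \<Rightarrow>
     (nat \<Rightarrow> real \<Rightarrow> real \<Rightarrow> complex) \<Rightarrow> real \<Rightarrow> real \<Rightarrow> real \<Rightarrow> complex" where
  "W0 a K \<omega> \<psi> \<epsilon> \<eta> k = W_term a K \<omega> \<psi> \<epsilon> \<eta> 0 k"

definition Omega :: "(nat \<Rightarrow> real \<Rightarrow> real) \<Rightarrow> real \<Rightarrow> real" where
  "Omega \<omega> k = (\<omega> 0 k)\<^sup>2"

definition B :: "(nat \<Rightarrow> real \<Rightarrow> real \<Rightarrow> complex) \<Rightarrow> real \<Rightarrow> real" where
  "B \<psi> k = (norm (b_coef \<psi> 0 k))\<^sup>2"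

end

theory Submission
  imports Defs "HOL-Complex_Analysis.Complex_Analysis"
begin

text \<open>
  Write \<open>D = \<partial>\<^sub>y + i k\<close> and \<open>\<lambda>\<^sub>m = \<omega>\<^sub>m\<^sup>2\<close>. The weak form \<open>\<langle>a D \<psi>\<^sub>m, D v\<rangle> = \<lambda>\<^sub>m \<langle>\<psi>\<^sub>m, v\<rangle>\<close> makes the functions
  \<open>D \<psi>\<^sub>m / \<omega>\<^sub>m\<close> orthonormal in the weighted space, so Bessel's inequality bounds both \<open>\<Sum> \<lambda>\<^sub>m |b\<^sub>m|\<^sup>2\<close>
  (test with \<open>v = 1\<close>) by a multiple of \<open>k\<^sup>2\<close> and \<open>\<Sum> |w\<^sub>m|\<^sup>2 / \<lambda>\<^sub>m\<close> by a constant. By Cauchy-Schwarz the series for \<open>W\<close>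
  converges absolutely and is at most \<open>C |k| sup |s\<^sub>m|\<close>. Measurability comes from continuity in \<open>k\<close>:
  \<open>s\<^sub>m\<close> is a continuous function of \<open>1 / (1 + \<lambda>\<^sub>m)\<close> vanishing at \<open>0\<close>, a uniform limit of polynomials, and
  powers of the resolvent \<open>(1 + A\<^sub>k)\<^sup>-\<^sup>1\<close> are Lipschitz in \<open>k\<close>.

  Near \<open>k = 0\<close> the frequencies \<open>\<omega>\<^sub>m\<close>, \<open>m \<ge> 1\<close>, stay away from \<open>0\<close>, so \<open>s\<^sub>m = O(\<alpha>\<^sup>q)\<close> and
  \<open>W - W\<^sub>0 = O(\<alpha>\<^sup>q |k|)\<close>. The product of \<open>b\<^sub>0\<close> with the flux \<open>a D \<psi>\<^sub>0\<close> extends holomorphically to complex \<open>k\<close>, as a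
  function \<open>H\<close> built from the fundamental system of the ordinary differential equation. Its mean over a period is
  \<open>i \<Omega> B / k\<close>; the vanishing moments of \<open>K\<close> show that this mean produces the main term exactly. The mean-zero
  part vanishes at \<open>k = 0\<close>, and \<open>q\<close> integrations by parts bound its contribution by \<open>C \<alpha>\<^sup>q |k|\<close> for complex
  \<open>|k| \<le> c \<alpha>\<close>; Cauchy's inequality on that circle gives the error \<open>O(\<alpha>\<^sup>q\<^sup>+\<^sup>1\<^sup>-\<^sup>r)\<close>.
\<close>

section \<open>Holomorphic functions restricted to the real line\<close>

text \<open>The waves are chosen separately for each k, with arbitrary phases, so no single b_m, w_m
  or \<psi>_m need be even measurable in k. Regularity can be asserted only of quantities that do
  not see the choice: functions of the operator applied to the constant 1 and, near 0, the product
  of b_0 with the flux of \<psi>_0. Likewise \<omega>_0 is nonnegative and matches an analytic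
  branch only up to sign; s_0 is even in the frequency, which removes the ambiguity. The radius c
  \<alpha> is forced by the exponentials exp(i z t / \<alpha>), bounded uniformly in \<alpha> for
  complex z only there. Cauchy's inequality costs \<alpha>^(-r), and the linear vanishing of the
  mean-zero part at z = 0 gives back one power. As \<eta> \<le> 1 implies \<epsilon> \<le> \<alpha>,
  the outcome is within \<epsilon>^(1-r) \<alpha>^q. The bound on W - W_0 is linear in |k| and so
  controls one derivative at 0: hence W for r \<le> 1 and W_0 beyond.\<close>

lemma integral_param_holomorphic:
  fixes f :: "complex \<Rightarrow> real \<Rightarrow> complex"
  assumes cont: "continuous_on (S \<times> {a..b}) (\<lambda>(z, t). f z t)"
    and hol: "\<And>t. t \<in> {a..b} \<Longrightarrow> (\<lambda>z. f z t) holomorphic_on S"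
    and "open S"
  shows "(\<lambda>z. integral {a..b} (f z)) holomorphic_on S"
proof -
  let ?F = "\<lambda>z. integral {a..b} (f z)"
  have contF: "continuous_on S ?F"
    using integral_continuous_on_param[of S a b f] cont by (simp add: case_prod_unfold)
  \<comment> \<open>Morera: swapping the integrals turns the triangle integral of \<open>?F\<close>
    into the parameter integral of triangle integrals of \<open>f\<close>, and these vanish by
    Cauchy's theorem.\<close>
  have "?F analytic_on S"
  proof (rule Morera_triangle[OF contF \<open>open S\<close>], intro allI impI)
    fix p q r assume sub: "convex hull {p, q, r} \<subseteq> S"
    have edge: "contour_integral (linepath u v) ?F =
        integral {a..b} (\<lambda>t. contour_integral (linepath u v) (\<lambda>z. f z t))
        \<and> (\<lambda>t. contour_integral (linepath u v) (\<lambda>z. f z t)) integrable_on {a..b}"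
      if uv: "closed_segment u v \<subseteq> S" for u v
    proof -
      have lp: "linepath u v x \<in> S" if "x \<in> {0..1}" for x
        using uv linepath_in_path[OF that] by auto
      have c: "continuous_on ({0..1} \<times> {a..b}) (\<lambda>(x, t). f (linepath u v x) t * (v - u))"
        unfolding case_prod_unfold
        by (intro continuous_intros continuous_on_compose2[OF cont, of _ "\<lambda>p. (linepath u v (fst p), snd p)", simplified case_prod_unfold fst_conv snd_conv])
          (auto simp: linepath_def intro!: continuous_intros lp[unfolded linepath_def])
      have c': "continuous_on (cbox (0,a) (1,b)) (\<lambda>(x, t). f (linepath u v x) t * (v - u))"
        using c by (simp add: cbox_Pair_eq)
      have "contour_integral (linepath u v) ?F = integral {0..1} (\<lambda>x. ?F (linepath u v x) * (v - u))"
        by (simp add: contour_integral_integral)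
      also have "\<dots> = integral {0..1} (\<lambda>x. integral {a..b} (\<lambda>t. f (linepath u v x) t * (v - u)))"
        by (simp add: integral_mult_left)
      also have "\<dots> = integral {a..b} (\<lambda>t. integral {0..1} (\<lambda>x. f (linepath u v x) t * (v - u)))"
        using integral_swap_continuous[OF c'] by simp
      also have "\<dots> = integral {a..b} (\<lambda>t. contour_integral (linepath u v) (\<lambda>z. f z t))"
        by (simp add: contour_integral_integral)
      finally have 1: "contour_integral (linepath u v) ?F =
        integral {a..b} (\<lambda>t. contour_integral (linepath u v) (\<lambda>z. f z t))" .
      have "continuous_on ({a..b} \<times> {0..1}) (\<lambda>(t, x). f (linepath u v x) t * (v - u))"
        by (rule continuous_on_swap_args) (use c in simp)
      then have "continuous_on {a..b} (\<lambda>t. integral {0..1} (\<lambda>x. f (linepath u v x) t * (v - u)))"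
        using integral_continuous_on_param[of "{a..b}" 0 1 "\<lambda>t x. f (linepath u v x) t * (v - u)"] by simp
      then show ?thesis using 1
        by (auto simp: contour_integral_integral intro!: integrable_continuous_interval)
    qed
    have seg: "closed_segment p q \<subseteq> S" "closed_segment q r \<subseteq> S" "closed_segment r p \<subseteq> S"
      using sub by (auto simp: segment_convex_hull intro!: order_trans[OF hull_mono sub])
    have tri: "contour_integral (linepath p q) (\<lambda>z. f z t) + contour_integral (linepath q r) (\<lambda>z. f z t)
         + contour_integral (linepath r p) (\<lambda>z. f z t) = 0" if t: "t \<in> {a..b}" for t
    proof -
      have h: "(\<lambda>z. f z t) holomorphic_on convex hull {p, q, r}"
        using hol[OF t] sub holomorphic_on_subset by blast
      have ci: "(\<lambda>z. f z t) contour_integrable_on linepath u v" if "closed_segment u v \<subseteq> S" for u v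
        using that hol[OF t]
        by (intro contour_integrable_continuous_linepath holomorphic_on_imp_continuous_on
              holomorphic_on_subset[OF hol[OF t]])
      have "((\<lambda>z. f z t) has_contour_integral 0) (linepath p q +++ linepath q r +++ linepath r p)"
        by (rule Cauchy_theorem_triangle[OF h])
      then have "contour_integral (linepath p q +++ linepath q r +++ linepath r p) (\<lambda>z. f z t) = 0"
        by (rule contour_integral_unique)
      then show ?thesis
        by (simp add: ci seg add.assoc)
    qed
    have "contour_integral (linepath p q) ?F + contour_integral (linepath q r) ?F +
        contour_integral (linepath r p) ?F =
        integral {a..b} (\<lambda>t. contour_integral (linepath p q) (\<lambda>z. f z t) + contour_integral (linepath q r) (\<lambda>z. f z t)
         + contour_integral (linepath r p) (\<lambda>z. f z t))"
      using edge[OF seg(1)] edge[OF seg(2)] edge[OF seg(3)]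
      by (simp add: integral_add integrable_add)
    also have "\<dots> = 0"
      using integral_cong[of "{a..b}" _ "\<lambda>_. 0", OF tri] by simp
    finally show "contour_integral (linepath p q) ?F + contour_integral (linepath q r) ?F +
        contour_integral (linepath r p) ?F = 0" .
  qed
  then show ?thesis by (rule analytic_imp_holomorphic)
qed

lemma nderiv_Suc: "nderiv (Suc n) f = (\<lambda>x. vector_derivative (nderiv n f) (at x))"
  by (simp add: nderiv_def)

lemma nderiv_0: "nderiv 0 f = f"
  by (simp add: nderiv_def)

text \<open>Along the real axis the vector derivative of a restriction is the complex derivative.
  The value of \<open>nderiv n f\<close> on the whole interval is what makes it differentiable
  there, so the claims have to run through one induction.\<close>

lemma nderiv_of_holomorphic:
  fixes f :: "real \<Rightarrow> complex"
  assumes hol: "F holomorphic_on ball 0 \<rho>"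
    and eq: "\<And>x. \<bar>x\<bar> < \<rho> \<Longrightarrow> f x = F (of_real x)"
    and x: "\<bar>x\<bar> < \<rho>"
  shows "nderiv n f x = (deriv ^^ n) F (of_real x) \<and> times_differentiable_at n f x
    \<and> nderiv n f differentiable (at x)"
  using x
proof (induction n arbitrary: x)
  have step: "(g has_vector_derivative deriv G (of_real x)) (at x)"
    if "G holomorphic_on ball 0 \<rho>" "\<And>x. \<bar>x\<bar> < \<rho> \<Longrightarrow> g x = G (of_real x)" "\<bar>x\<bar> < \<rho>" for g G x
  proof -
    have "(G has_field_derivative deriv G (of_real x)) (at (of_real x))"
      using that(1,3) by (intro holomorphic_derivI[of _ "ball 0 \<rho>"]) auto
    then have "((\<lambda>x. G (of_real x)) has_vector_derivative deriv G (of_real x)) (at x)"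
      by (rule has_vector_derivative_real_field)
    then show ?thesis
    proof (rule has_vector_derivative_transform_within_open)
      show "open {-\<rho><..<\<rho>}" "x \<in> {-\<rho><..<\<rho>}" using that by auto
    qed (use that in auto)
  qed
  {
    case 0
    have "f differentiable (at x)"
      using step[OF hol eq 0] by (auto simp: differentiableI_vector)
    then show ?case using eq[OF 0] by (simp add: nderiv_0)
  next
    case (Suc n)
    have hn: "(deriv ^^ k) F holomorphic_on ball 0 \<rho>" for k
      by (rule holomorphic_higher_deriv[OF hol]) simp
    have d: "(nderiv n f has_vector_derivative deriv ((deriv ^^ n) F) (of_real y)) (at y)" if "\<bar>y\<bar> < \<rho>" for y
      using step[OF hn, of "nderiv n f" n y] Suc.IH that by blast
    then have e: "nderiv (Suc n) f y = (deriv ^^ Suc n) F (of_real y)" if "\<bar>y\<bar> < \<rho>" for y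
      using that by (auto simp: nderiv_Suc intro!: vector_derivative_at)
    have ev: "\<forall>\<^sub>F y in nhds x. times_differentiable_at n f y"
      unfolding eventually_nhds
      by (rule exI[of _ "{-\<rho><..<\<rho>}"]) (use Suc in auto)
    have "nderiv (Suc n) f differentiable (at x)"
      using step[OF hn e Suc.prems] by (auto simp: differentiableI_vector)
    then show ?case using ev e[OF Suc.prems] Suc by simp
  }
qed

lemma real_nderiv_of_holomorphic:
  fixes f :: "real \<Rightarrow> real"
  assumes hol: "F holomorphic_on ball 0 \<rho>"
    and eq: "\<And>x. \<bar>x\<bar> < \<rho> \<Longrightarrow> of_real (f x) = F (of_real x)"
    and x: "\<bar>x\<bar> < \<rho>"
  shows "of_real (nderiv n f x) = (deriv ^^ n) F (of_real x) \<and> times_differentiable_at n f x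
    \<and> nderiv n f differentiable (at x)"
  using x
proof (induction n arbitrary: x)
  have step: "(g has_vector_derivative Re (deriv G (of_real x))) (at x) \<and> Im (deriv G (of_real x)) = 0"
    if "G holomorphic_on ball 0 \<rho>" "\<And>x. \<bar>x\<bar> < \<rho> \<Longrightarrow> of_real (g x) = G (of_real x)" "\<bar>x\<bar> < \<rho>"
    for g :: "real \<Rightarrow> real" and G x
  proof -
    have "(G has_field_derivative deriv G (of_real x)) (at (of_real x))"
      using that(1,3) by (intro holomorphic_derivI[of _ "ball 0 \<rho>"]) auto
    then have "((\<lambda>x. G (of_real x)) has_vector_derivative deriv G (of_real x)) (at x)"
      by (rule has_vector_derivative_real_field)
    then have v: "((\<lambda>x. of_real (g x)) has_vector_derivative deriv G (of_real x)) (at x)"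
    proof (rule has_vector_derivative_transform_within_open)
      show "open {-\<rho><..<\<rho>}" "x \<in> {-\<rho><..<\<rho>}" using that by auto
    qed (use that in auto)
    have "((\<lambda>x. Re (of_real (g x))) has_vector_derivative Re (deriv G (of_real x))) (at x)"
      by (rule bounded_linear.has_vector_derivative[OF bounded_linear_Re v])
    moreover have "((\<lambda>x. Im (of_real (g x))) has_vector_derivative Im (deriv G (of_real x))) (at x)"
      by (rule bounded_linear.has_vector_derivative[OF bounded_linear_Im v])
    \<comment> \<open>The imaginary part is constantly 0 along the axis, so its derivative is 0 as
      well. The derivative is therefore again real and the induction can continue.\<close>
    then have "Im (deriv G (of_real x)) = 0"
      by (simp add: vector_derivative_unique_at[OF _ has_vector_derivative_const])
    ultimately show ?thesis by simp
  qed
  {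
    case 0
    have "f differentiable (at x)"
      using step[OF hol eq 0] by (auto simp: differentiableI_vector)
    then show ?case using eq[OF 0] by (simp add: nderiv_0)
  next
    case (Suc n)
    have hn: "(deriv ^^ k) F holomorphic_on ball 0 \<rho>" for k
      by (rule holomorphic_higher_deriv[OF hol]) simp
    have d: "(nderiv n f has_vector_derivative Re (deriv ((deriv ^^ n) F) (of_real y))) (at y)
        \<and> Im (deriv ((deriv ^^ n) F) (of_real y)) = 0" if "\<bar>y\<bar> < \<rho>" for y
      using step[OF hn, of "nderiv n f" n y] Suc.IH that by blast
    have e: "of_real (nderiv (Suc n) f y) = (deriv ^^ Suc n) F (of_real y)" if "\<bar>y\<bar> < \<rho>" for y
      using vector_derivative_at[OF conjunct1[OF d[OF that]]] d[OF that]
      by (auto simp: nderiv_Suc complex_eq_iff)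
    have ev: "\<forall>\<^sub>F y in nhds x. times_differentiable_at n f y"
      unfolding eventually_nhds
      by (rule exI[of _ "{-\<rho><..<\<rho>}"]) (use Suc in auto)
    have "nderiv (Suc n) f differentiable (at x)"
      using step[OF hn e Suc.prems] by (auto simp: differentiableI_vector)
    then show ?case using ev e[OF Suc.prems] Suc by simp
  }
qed

text \<open>Cauchy's inequality on a circle of radius s leaves a multiple of s, and s tends to 0.
  The size of \<open>C\<close> does not matter.\<close>

lemma higher_deriv_zero_of_bound:
  fixes f :: "complex \<Rightarrow> complex"
  assumes hol: "f holomorphic_on ball 0 \<rho>" and "0 < \<rho>" "0 < \<rho>'"
    and bnd: "\<And>z. norm z < \<rho>' \<Longrightarrow> norm (f z) \<le> C * norm z ^ (n + 1)"
  shows "(deriv ^^ n) f 0 = 0"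
proof -
  have C: "norm ((deriv ^^ n) f 0) \<le> fact n * C * s" if s: "0 < s" "s < min \<rho> \<rho>'" for s
  proof -
    have "norm ((deriv ^^ n) f 0) \<le> fact n * (C * s ^ (n + 1)) / s ^ n"
    proof (rule Cauchy_inequality)
      show "f holomorphic_on ball 0 s" "continuous_on (cball 0 s) f"
        using s by (auto intro!: holomorphic_on_subset[OF hol] holomorphic_on_imp_continuous_on)
      show "norm (f x) \<le> C * s ^ (n + 1)" if "norm (0 - x) = s" for x
        using bnd[of x] that s by simp
    qed (use s in auto)
    then show ?thesis using s by (simp add: field_simps)
  qed
  have "((\<lambda>s. fact n * C * s) \<longlongrightarrow> fact n * C * 0) (at_right 0)"
    by (intro tendsto_intros)
  moreover have "eventually (\<lambda>s. norm ((deriv ^^ n) f 0) \<le> fact n * C * s) (at_right 0)"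
    unfolding eventually_at_right_field
    by (rule exI[of _ "min \<rho> \<rho>'"]) (use C assms in auto)
  ultimately have "norm ((deriv ^^ n) f 0) \<le> fact n * C * 0"
    by (intro tendsto_lowerbound[where F = "at_right 0"]) auto
  then show ?thesis by simp
qed

text \<open>In the Leibniz rule only the first derivative of z survives at 0. This is the origin of
  the factor 1/(r+1) in the theorem.\<close>

lemma higher_deriv_ident_mult_0:
  fixes f :: "complex \<Rightarrow> complex"
  assumes hol: "f holomorphic_on ball 0 \<rho>" and "0 < \<rho>"
  shows "(deriv ^^ Suc n) (\<lambda>z. z * f z) 0 = of_nat (Suc n) * (deriv ^^ n) f 0"
proof -
  have "(deriv ^^ Suc n) (\<lambda>z. z * f z) 0 =
     (\<Sum>i = 0..Suc n. of_nat (Suc n choose i) * (deriv ^^ i) (\<lambda>z. z) 0 * (deriv ^^ (Suc n - i)) f 0)"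
    by (rule higher_deriv_mult[of _ "ball 0 \<rho>"]) (use assms in \<open>auto intro!: holomorphic_intros\<close>)
  also have "\<dots> = (\<Sum>i\<in>{1}. of_nat (Suc n choose i) * (deriv ^^ i) (\<lambda>z. z) 0 * (deriv ^^ (Suc n - i)) f 0)"
    by (rule sum.mono_neutral_right) (auto simp: higher_deriv_ident split: if_splits)
  finally show ?thesis by simp
qed

section \<open>Kernels and oscillatory integrals\<close>

text \<open>The derivatives are given as a sequence, so that dropping its head yields the same
  predicate for the derivative of the kernel: the form needed for repeated integration by parts.
  Vanishing at the endpoints themselves removes the boundary terms.\<close>

definition kernel_derivs :: "nat \<Rightarrow> (nat \<Rightarrow> real \<Rightarrow> real) \<Rightarrow> real \<Rightarrow> bool" where
  "kernel_derivs q Kd M \<longleftrightarrow>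
     (\<forall>j<q. \<forall>x. (Kd j has_real_derivative Kd (Suc j) x) (at x)) \<and>
     (\<forall>j\<le>q. continuous_on UNIV (Kd j) \<and> (\<forall>x. \<bar>Kd j x\<bar> \<le> M) \<and> (\<forall>x. 1 \<le> \<bar>x\<bar> \<longrightarrow> Kd j x = 0))"

text \<open>The zero set is closed, and -1 and 1 are limits of points where the support condition
  already applies.\<close>

lemma vanishes_at_boundary:
  fixes f :: "real \<Rightarrow> real"
  assumes "continuous_on UNIV f" and z: "\<And>x. 1 < \<bar>x\<bar> \<Longrightarrow> f x = 0" and "1 \<le> \<bar>x\<bar>"
  shows "f x = 0"
proof -
  have c: "closed {x. f x = 0}"
    using assms(1) by (intro closed_Collect_eq) auto
  have "closure {1<..} \<subseteq> {x. f x = 0}" "closure {..<-1} \<subseteq> {x. f x = 0}"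
    using z by (intro closure_minimal[OF _ c] subsetI; simp)+
  moreover have "x \<in> closure {1<..} \<or> x \<in> closure {..<-1}"
    using assms(3) by (simp; linarith)
  ultimately show ?thesis by blast
qed

lemma kernels_imp_kernel_derivs:
  assumes "K \<in> kernels p q"
  obtains M where "0 < M" "kernel_derivs q (\<lambda>j. nderiv j K) M"
proof -
  have d: "nderiv j K differentiable (at x)" if "j < q" for j x
    using assms that by (auto simp: kernels_def Cn_on_def)
  have dr: "(nderiv j K has_real_derivative nderiv (Suc j) K x) (at x)" if "j < q" for j x
    using d[OF that, of x] unfolding nderiv_Suc has_real_derivative_iff_has_vector_derivative
    by (simp add: vector_derivative_works)
  have c: "continuous_on UNIV (nderiv j K)" if "j \<le> q" for j
  proof (cases "j = q")
    case True then show ?thesis using assms by (auto simp: kernels_def Cn_on_def)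
  next
    case False
    then have "nderiv j K differentiable (at x)" for x using d that by simp
    then show ?thesis
      by (intro continuous_at_imp_continuous_on ballI differentiable_imp_continuous_within)
  qed
  have z: "nderiv j K x = 0" if "1 < \<bar>x\<bar>" for j x
    using that
  proof (induction j arbitrary: x)
    case 0
    have "closure {x. K x \<noteq> 0} \<subseteq> {-1..1}" using assms by (simp add: kernels_def)
    moreover have "x \<notin> {-1..1}" using 0 by auto
    ultimately have "x \<notin> closure {x. K x \<noteq> 0}" by blast
    then have "x \<notin> {x. K x \<noteq> 0}" using closure_subset[of "{x. K x \<noteq> 0}"] by blast
    then show ?case by (simp add: nderiv_0)
  next
    case (Suc j)
    have "(nderiv j K has_vector_derivative 0) (at x)"
    proof (rule has_vector_derivative_transform_within_open[where f = "\<lambda>_. 0"])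
      show "open {x::real. 1 < \<bar>x\<bar>}" by (intro open_Collect_less continuous_intros)
    qed (use Suc in auto)
    then show ?case unfolding nderiv_Suc by (rule vector_derivative_at)
  qed
  have z1: "nderiv j K x = 0" if "1 \<le> \<bar>x\<bar>" "j \<le> q" for j x
    by (rule vanishes_at_boundary[OF c[OF that(2)] z that(1)])
  have "\<exists>Bd. \<forall>x. \<bar>nderiv j K x\<bar> \<le> Bd" if "j \<le> q" for j
  proof -
    have "bounded (nderiv j K ` {-1..1})"
      using c[OF that] by (intro compact_imp_bounded compact_continuous_image) (rule continuous_on_subset, auto)
    then obtain Bd where "\<forall>y \<in> nderiv j K ` {-1..1}. norm y \<le> Bd"
      unfolding bounded_iff by blast
    then have Bd: "\<bar>nderiv j K x\<bar> \<le> Bd" if "x \<in> {-1..1}" for x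
      using that by simp
    have "\<bar>nderiv j K x\<bar> \<le> \<bar>Bd\<bar>" for x
    proof (cases "x \<in> {-1..1}")
      case True then show ?thesis using Bd[OF True] by linarith
    next
      case False
      then have "1 < \<bar>x\<bar>" by (simp; linarith)
      then show ?thesis using z[of x j] by simp
    qed
    then show ?thesis by blast
  qed
  then obtain Bd where Bd: "\<And>j x. j \<le> q \<Longrightarrow> \<bar>nderiv j K x\<bar> \<le> Bd j" by metis
  define M where "M = 1 + (\<Sum>j\<le>q. \<bar>Bd j\<bar>)"
  have "\<bar>nderiv j K x\<bar> \<le> M" if "j \<le> q" for j x
  proof -
    have "\<bar>Bd j\<bar> \<le> (\<Sum>j\<le>q. \<bar>Bd j\<bar>)" using that by (intro member_le_sum) auto
    then show ?thesis using Bd[OF that, of x] by (simp add: M_def)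
  qed
  then have "kernel_derivs q (\<lambda>j. nderiv j K) M"
    unfolding kernel_derivs_def using dr c z1 by (intro conjI allI impI) simp_all
  moreover have "0 \<le> (\<Sum>j\<le>q. \<bar>Bd j\<bar>)" by (rule sum_nonneg) simp
  then have "0 < M" unfolding M_def by linarith
  ultimately show ?thesis using that by blast
qed

lemma kernel_derivs_mono: "kernel_derivs (Suc q) Kd M \<Longrightarrow> kernel_derivs q Kd M"
  and kernel_derivs_shift: "kernel_derivs (Suc q) Kd M \<Longrightarrow> kernel_derivs q (\<lambda>j. Kd (Suc j)) M"
  by (auto simp: kernel_derivs_def)

section \<open>Functions of period one and their antiderivatives\<close>

lemma periodic_of_int:
  fixes f :: "real \<Rightarrow> 'a"
  assumes "\<And>y. f (y + 1) = f y"
  shows "f (y + of_int n) = f y"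
proof (induction n arbitrary: y rule: int_induct[where k = 0])
  case base then show ?case by simp
next
  case (step1 i)
  then show ?case using assms[of "y + of_int i"] by (simp add: add.assoc)
next
  case (step2 i)
  then show ?case using assms[of "y + of_int i - 1"] by (simp add: add.assoc algebra_simps)
qed

lemma periodic_reduce:
  fixes f :: "real \<Rightarrow> 'a"
  assumes "\<And>y. f (y + 1) = f y"
  obtains x where "x \<in> {-1/2..1/2}" "f y = f x"
proof -
  have "y - of_int \<lfloor>y + 1/2\<rfloor> \<in> {-1/2..1/2}" by (simp; linarith)
  moreover have "f y = f (y - of_int \<lfloor>y + 1/2\<rfloor>)"
    using periodic_of_int[of f "y - of_int \<lfloor>y + 1/2\<rfloor>" "\<lfloor>y + 1/2\<rfloor>"] assms by simp
  ultimately show ?thesis using that by blast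
qed

lemma integral_shift_of_int:
  fixes f :: "real \<Rightarrow> 'a::euclidean_space"
  assumes "\<And>y. f (y + 1) = f y"
  shows "integral {c + of_int n..d + of_int n} f = integral {c..d} f"
proof -
  have "f \<circ> (+) (of_int n) = f"
    using periodic_of_int[of f, OF assms] by (auto simp: fun_eq_iff add.commute)
  then show ?thesis using integral_shift_Icc_real[of c d f "of_int n"] by simp
qed

lemma integral_symmetric_periods:
  fixes f :: "real \<Rightarrow> real"
  assumes per: "\<And>y. f (y + 1) = f y" and c: "continuous_on UNIV f"
  shows "integral {- real J - 1/2..real J + 1/2} f = real (2 * J + 1) * integral {-1/2..1/2} f"
proof (induction J)
  case 0 then show ?case by simp
next
  case (Suc J)
  have i: "f integrable_on {x..y}" for x y
    by (rule integrable_continuous_interval) (use c continuous_on_subset in blast)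
  have r: "integral {real J + 1/2..real (Suc J) + 1/2} f = integral {-1/2..1/2} f"
    using integral_shift_of_int[of f "-1/2" "int (Suc J)" "1/2", OF per] by (simp add: algebra_simps)
  have l: "integral {- real (Suc J) - 1/2..- real J - 1/2} f = integral {-1/2..1/2} f"
  proof -
    have "-1/2 + of_int (- int (Suc J)) = - real (Suc J) - 1/2" "1/2 + of_int (- int (Suc J)) = - real J - 1/2"
      by simp_all
    then show ?thesis
      using integral_shift_of_int[of f "-1/2" "- int (Suc J)" "1/2", OF per] by (simp only:)
  qed
  have "integral {- real (Suc J) - 1/2..real (Suc J) + 1/2} f =
      integral {- real (Suc J) - 1/2..- real J - 1/2} f + (integral {- real J - 1/2..real J + 1/2} f
        + integral {real J + 1/2..real (Suc J) + 1/2} f)"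
    using Henstock_Kurzweil_Integration.integral_combine[OF _ _ i, of "- real J - 1/2" "real J + 1/2" "real (Suc J) + 1/2"]
      Henstock_Kurzweil_Integration.integral_combine[OF _ _ i, of "- real (Suc J) - 1/2" "- real J - 1/2" "real (Suc J) + 1/2"]
    by simp
  then show ?case unfolding r l Suc by (simp add: algebra_simps)
qed

lemma antiderivative_UNIV:
  fixes g :: "real \<Rightarrow> complex"
  assumes "continuous_on UNIV g"
  obtains G where "\<And>y. (G has_vector_derivative g y) (at y)"
proof
  fix y :: real
  define N where "N = \<bar>y\<bar> + 1"
  have c: "continuous_on S g" for S using assms continuous_on_subset by blast
  have i: "g integrable_on {x..y}" for x y
    by (rule integrable_continuous_interval[OF c])
  have "((\<lambda>u. integral {-N..u} g - integral {-N..0} g) has_vector_derivative g y - 0) (at y within {-N..N})"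
    by (intro derivative_intros integral_has_vector_derivative[OF c]) (auto simp: N_def)
  then have "((\<lambda>u. integral {-N..u} g - integral {-N..0} g) has_vector_derivative g y) (at y)"
    by (subst (asm) at_within_interior) (auto simp: N_def)
  \<comment> \<open>An integral over a reversed interval is 0, so exactly one of the two terms is
    active on each side of 0.\<close>
  then show "((\<lambda>y. integral {0..y} g - integral {y..0} g) has_vector_derivative g y) (at y)"
  proof (rule has_vector_derivative_transform_within_open[of _ _ _ "{-N<..<N}"])
    fix u assume u: "u \<in> {-N<..<N}"
    show "integral {-N..u} g - integral {-N..0} g = integral {0..u} g - integral {u..0} g"
    proof (cases "0 \<le> u")
      case True
      have "integral {-N..u} g = integral {-N..0} g + integral {0..u} g"
        using True by (subst Henstock_Kurzweil_Integration.integral_combine) (auto simp: i N_def)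
      moreover have "integral {u..0} g = 0" using True by (cases "u = 0") auto
      ultimately show ?thesis by simp
    next
      case False
      have "integral {-N..0} g = integral {-N..u} g + integral {u..0} g"
        using False u by (subst Henstock_Kurzweil_Integration.integral_combine) (auto simp: i N_def)
      then show ?thesis using False by simp
    qed
  qed (auto simp: N_def)
qed

text \<open>Mean zero makes an antiderivative periodic; subtracting its own mean lets the
  construction be iterated. Then G x is the average over u of F x - F u with |x - u| at most 1, so
  the same \<open>Bd\<close> serves again and repeated integration does not enlarge it.\<close>

lemma periodic_antiderivative:
  fixes g :: "real \<Rightarrow> complex"
  assumes c: "continuous_on UNIV g" and per: "\<And>y. g (y + 1) = g y"
    and mean: "integral {-1/2..1/2} g = 0" and bnd: "\<And>y. norm (g y) \<le> Bd"
  obtains G where "\<And>y. (G has_vector_derivative g y) (at y)" "\<And>y. G (y + 1) = G y"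
    "integral {-1/2..1/2} G = 0" "\<And>y. norm (G y) \<le> Bd"
proof -
  obtain F where F: "\<And>y. (F has_vector_derivative g y) (at y)"
    using antiderivative_UNIV[OF c] by blast
  have Fd: "(F has_vector_derivative g y) (at y within S)" for y S
    using F has_vector_derivative_at_within by blast
  have Fc: "continuous_on S F" for S
    using Fd by (meson continuous_on_vector_derivative)
  have Fper: "F (y + 1) = F y" for y
  proof -
    have "((\<lambda>y. F (y + 1) - F y) has_vector_derivative 0) (at y within UNIV)" for y
    proof -
      have "((F \<circ> (\<lambda>y. y + 1)) has_vector_derivative 1 *\<^sub>R g (y + 1)) (at y)"
        by (rule vector_diff_chain_at) (auto intro!: derivative_eq_intros F)
      then have "((\<lambda>y. F (y + 1) - F y) has_vector_derivative 1 *\<^sub>R g (y + 1) - g y) (at y)"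
        by (intro has_vector_derivative_diff F) (simp add: o_def)
      then show ?thesis by (simp add: per)
    qed
    then obtain c where cc: "\<And>y. F (y + 1) - F y = c"
      using has_vector_derivative_zero_constant[of UNIV "\<lambda>y. F (y + 1) - F y"] by auto
    have "(g has_integral (F (1/2) - F (-1/2))) {-1/2..1/2}"
      by (rule fundamental_theorem_of_calculus) (auto intro: Fd)
    then have "F (1/2) - F (-1/2) = 0" using mean by (simp add: has_integral_iff)
    then have "c = 0" using cc[of "-1/2"] by simp
    then show ?thesis using cc[of y] by simp
  qed
  define m where "m = integral {-1/2..1/2} F"
  define G where "G = (\<lambda>y. F y - m)"
  have Gd: "(G has_vector_derivative g y) (at y)" for y
    using has_vector_derivative_diff[OF F has_vector_derivative_const] by (simp add: G_def)
  have Gper: "G (y + 1) = G y" for y by (simp add: G_def Fper)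
  have lip: "norm (F x - F y) \<le> Bd * norm (x - y)" for x y
  proof (rule differentiable_bound[of UNIV F "\<lambda>x h. h *\<^sub>R g x"])
    have "0 \<le> Bd" using bnd[of 0] norm_ge_zero[of "g 0"] by linarith
    then show "onorm (\<lambda>h. h *\<^sub>R g x) \<le> Bd" for x
      using bnd[of x] by (intro onorm_bound) (auto simp: mult.commute[of Bd] intro!: mult_left_mono)
  qed (use F in \<open>auto simp: has_vector_derivative_def\<close>)
  have "norm (G y) \<le> Bd" for y
  proof -
    obtain x where x: "x \<in> {-1/2..1/2}" "G y = G x" using periodic_reduce[of G y] Gper by metis
    have "G x = integral {-1/2..1/2} (\<lambda>u. F x - F u)"
      by (subst integral_diff) (auto simp: G_def m_def intro!: integrable_continuous_interval Fc)
    also have "norm \<dots> \<le> Bd * (1/2 - (-1/2))"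
    proof (rule integral_bound)
      show "continuous_on {-1/2..1/2} (\<lambda>u. F x - F u)" by (intro continuous_intros Fc)
      fix u :: real assume u: "u \<in> {-1/2..1/2}"
      have "norm (F x - F u) \<le> Bd * norm (x - u)" by (rule lip)
      also have "\<dots> \<le> Bd * 1" using u x order_trans[OF norm_ge_zero bnd[of 0]] by (intro mult_left_mono) auto
      finally show "norm (F x - F u) \<le> Bd" by simp
    qed simp
    finally show ?thesis using x by simp
  qed
  moreover have "integral {-1/2..1/2} G = 0"
    unfolding G_def by (subst integral_diff) (auto simp: m_def intro!: integrable_continuous_interval Fc)
  ultimately show ?thesis using that[of G] Gd Gper by blast
qed

lemma norm_exp_bound: "norm (exp (\<i> * \<zeta> * of_real t)) \<le> exp R"
  if "norm \<zeta> \<le> R" "\<bar>t\<bar> \<le> 1" for t R :: real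
proof -
  have "norm (exp (\<i> * \<zeta> * of_real t)) \<le> exp (norm (\<i> * \<zeta> * of_real t))" by (rule norm_exp)
  also have "\<dots> \<le> exp (R * 1)"
    using that mult_mono[OF that, OF order_trans[OF norm_ge_zero that(1)]] by (simp add: norm_mult)
  finally show ?thesis by simp
qed

text \<open>Each integration by parts against a mean-zero periodic function gains a factor \<open>\<alpha>\<close>.\<close>

lemma oscillatory_bound:
  fixes g :: "real \<Rightarrow> complex"
  assumes "kernel_derivs q Kd M" and "continuous_on UNIV g" and "\<And>y. g (y + 1) = g y"
    and "integral {-1/2..1/2} g = 0" and "\<And>y. norm (g y) \<le> Bd" and \<alpha>: "0 < \<alpha>" and \<zeta>: "norm \<zeta> \<le> R"
  shows "norm (integral {-1..1} (\<lambda>t. of_real (Kd 0 t) * exp (\<i> * \<zeta> * of_real t) * g (t / \<alpha>)))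
     \<le> 2 * M * exp R * Bd * ((1 + R) * \<alpha>) ^ q"
  using assms(1-5)
proof (induction q arbitrary: Kd g)
  case 0
  have k0: "continuous_on UNIV (Kd 0)" using 0(1) by (simp add: kernel_derivs_def)
  have "norm (integral {-1..1} (\<lambda>t. of_real (Kd 0 t) * exp (\<i> * \<zeta> * of_real t) * g (t / \<alpha>)))
     \<le> (M * exp R * Bd) * (1 - (-1))"
  proof (rule integral_bound)
    show "continuous_on {-1..1} (\<lambda>t. of_real (Kd 0 t) * exp (\<i> * \<zeta> * of_real t) * g (t / \<alpha>))"
      using \<alpha> by (intro continuous_intros continuous_on_compose2[OF 0(2)] continuous_on_subset[OF k0]) auto
    fix t :: real assume t: "t \<in> {-1..1}"
    have "\<bar>Kd 0 t\<bar> \<le> M" using 0 by (auto simp: kernel_derivs_def)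
    then show "norm (of_real (Kd 0 t) * exp (\<i> * \<zeta> * of_real t) * g (t / \<alpha>)) \<le> M * exp R * Bd"
      using norm_exp_bound[OF \<zeta>, of t] t 0(5)[of "t / \<alpha>"] unfolding norm_mult
      by (intro mult_mono) auto
  qed simp
  then show ?case by (simp add: mult_ac)
next
  case (Suc q)
  obtain G where G: "\<And>y. (G has_vector_derivative g y) (at y)" "\<And>y. G (y + 1) = G y"
    "integral {-1/2..1/2} G = 0" "\<And>y. norm (G y) \<le> Bd"
    using periodic_antiderivative[OF Suc.prems(2-5)] by blast
  have Gc: "continuous_on UNIV G"
    by (rule continuous_on_vector_derivative) (use G(1) in auto)
  let ?I = "\<lambda>Kf g. integral {-1..1} (\<lambda>t. of_real (Kf t) * exp (\<i> * \<zeta> * of_real t) * g (t / \<alpha>) :: complex)"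
  have R: "0 \<le> R" using \<zeta> norm_ge_zero[of \<zeta>] by linarith
  have kc: "continuous_on S (Kd 0)" "continuous_on S (Kd (Suc 0))" "continuous_on S g" "continuous_on S G" for S
  proof -
    have "continuous_on UNIV (Kd 0)" "continuous_on UNIV (Kd (Suc 0))"
      using Suc.prems(1) by (simp_all add: kernel_derivs_def)
    then show "continuous_on S (Kd 0)" "continuous_on S (Kd (Suc 0))" "continuous_on S g" "continuous_on S G"
      using Suc.prems(2) Gc continuous_on_subset[OF _ subset_UNIV] by blast+
  qed
  have ii: "(\<lambda>t. of_real (Kf t) * exp (\<i> * \<zeta> * of_real t) * f (t / \<alpha>) :: complex) integrable_on {-1..1}"
    if "continuous_on UNIV Kf" "continuous_on UNIV f" for Kf f
    using \<alpha> by (intro integrable_continuous_interval continuous_intros continuous_on_compose2[OF that(2)]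
         continuous_on_subset[OF that(1)]) auto
  have eq: "of_real \<alpha> * ((1 / \<alpha>) *\<^sub>R z) = z" for z :: complex
    using less_imp_neq[OF \<alpha>, symmetric] by (simp add: scaleR_conv_of_real)
  have parts_algebra: "K0 * e * u + (K0 * (c * e) + K1 * e) * (b * v) = K0 * e * u + b * (K1 * e * v + c * (K0 * e * v))"
    for K0 K1 e u v b c :: complex by (simp add: algebra_simps)
  define \<Phi> where "\<Phi> = (\<lambda>t. of_real (Kd 0 t) * exp (\<i> * \<zeta> * of_real t) * (of_real \<alpha> * G (t / \<alpha>)))"
  have d: "(\<Phi> has_vector_derivative of_real (Kd 0 t) * exp (\<i> * \<zeta> * of_real t) * g (t / \<alpha>) +
      of_real \<alpha> * (of_real (Kd (Suc 0) t) * exp (\<i> * \<zeta> * of_real t) * G (t / \<alpha>)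
        + \<i> * \<zeta> * (of_real (Kd 0 t) * exp (\<i> * \<zeta> * of_real t) * G (t / \<alpha>)))) (at t within S)" for t S
  proof -
    have k: "((\<lambda>t. of_real (Kd 0 t) :: complex) has_vector_derivative of_real (Kd (Suc 0) t)) (at t)"
      by (rule has_vector_derivative_of_real) (use Suc.prems(1) in \<open>simp add: kernel_derivs_def\<close>)
    have e: "((\<lambda>t. exp (\<i> * \<zeta> * of_real t)) has_vector_derivative \<i> * \<zeta> * exp (\<i> * \<zeta> * of_real t)) (at t)"
      by (rule has_vector_derivative_real_field) (auto intro!: derivative_eq_intros)
    have "((\<lambda>t. t / \<alpha>) has_vector_derivative 1 / \<alpha>) (at t)"
      unfolding has_real_derivative_iff_has_vector_derivative[symmetric]
      using \<alpha> by (auto intro!: derivative_eq_intros)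
    note vector_diff_chain_at[OF this G(1)]
    from has_vector_derivative_mult_right[OF this, of "of_real \<alpha>"]
    have g: "((\<lambda>t. of_real \<alpha> * G (t / \<alpha>)) has_vector_derivative of_real \<alpha> * ((1 / \<alpha>) *\<^sub>R g (t / \<alpha>))) (at t)"
      unfolding o_def .
    from has_vector_derivative_mult[OF has_vector_derivative_mult[OF k e] g]
    have "(\<Phi> has_vector_derivative of_real (Kd 0 t) * exp (\<i> * \<zeta> * of_real t) * (of_real \<alpha> * ((1 / \<alpha>) *\<^sub>R g (t / \<alpha>))) +
        (of_real (Kd 0 t) * (\<i> * \<zeta> * exp (\<i> * \<zeta> * of_real t)) + of_real (Kd (Suc 0) t) * exp (\<i> * \<zeta> * of_real t)) *
        (of_real \<alpha> * G (t / \<alpha>))) (at t)"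
      unfolding \<Phi>_def .
    then show ?thesis
      unfolding parts_algebra eq by (rule has_vector_derivative_at_within)
  qed
  define J1 J2 J3 where "J1 = (\<lambda>t. of_real (Kd 0 t) * exp (\<i> * \<zeta> * of_real t) * g (t / \<alpha>))"
    and "J2 = (\<lambda>t. of_real (Kd (Suc 0) t) * exp (\<i> * \<zeta> * of_real t) * G (t / \<alpha>))"
    and "J3 = (\<lambda>t. of_real (Kd 0 t) * exp (\<i> * \<zeta> * of_real t) * G (t / \<alpha>))"
  have "((\<lambda>t. J1 t + of_real \<alpha> * (J2 t + \<i> * \<zeta> * J3 t)) has_integral (\<Phi> 1 - \<Phi> (-1))) {-1..1}"
    by (rule fundamental_theorem_of_calculus) (simp, unfold J1_def J2_def J3_def, rule d)
  moreover have "\<Phi> 1 = 0" "\<Phi> (-1) = 0"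
    using Suc.prems(1) by (simp_all add: \<Phi>_def kernel_derivs_def)
  ultimately have "integral {-1..1} (\<lambda>t. J1 t + of_real \<alpha> * (J2 t + \<i> * \<zeta> * J3 t)) = 0"
    by (simp add: has_integral_iff)
  moreover have "integral {-1..1} (\<lambda>t. J1 t + of_real \<alpha> * (J2 t + \<i> * \<zeta> * J3 t)) =
      integral {-1..1} J1 + of_real \<alpha> * (integral {-1..1} J2 + \<i> * \<zeta> * integral {-1..1} J3)"
    using has_integral_add[OF integrable_integral[OF ii[OF kc(1) kc(3), folded J1_def]]
        has_integral_mult_right[OF has_integral_add[OF integrable_integral[OF ii[OF kc(2) kc(4), folded J2_def]]
          has_integral_mult_right[OF integrable_integral[OF ii[OF kc(1) kc(4), folded J3_def]], of "\<i> * \<zeta>"]], of "of_real \<alpha>"]]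
    by (rule integral_unique)
  ultimately have "integral {-1..1} J1 + of_real \<alpha> * (integral {-1..1} J2 + \<i> * \<zeta> * integral {-1..1} J3) = 0"
    by simp
  then have "?I (Kd 0) g + of_real \<alpha> * (?I (Kd (Suc 0)) G + \<i> * \<zeta> * ?I (Kd 0) G) = 0"
    unfolding J1_def J2_def J3_def .
  then have "?I (Kd 0) g = - (of_real \<alpha> * (?I (Kd (Suc 0)) G + \<i> * \<zeta> * ?I (Kd 0) G))"
    by (simp add: eq_neg_iff_add_eq_0)
  then have "norm (?I (Kd 0) g) = \<alpha> * norm (?I (Kd (Suc 0)) G + \<i> * \<zeta> * ?I (Kd 0) G)"
    using \<alpha> by (simp add: norm_mult)
  also have "\<dots> \<le> \<alpha> * (norm (?I (Kd (Suc 0)) G) + norm \<zeta> * norm (?I (Kd 0) G))"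
    using \<alpha> by (intro mult_left_mono order_trans[OF norm_triangle_ineq]) (auto simp: norm_mult)
  \<comment> \<open>The derivative falls either on the kernel, giving the shifted sequence, or on
    the exponential, giving a factor of size at most R. Together they produce the 1 + R that
    accompanies each \<alpha>.\<close>
  also have "\<dots> \<le> \<alpha> * (2 * M * exp R * Bd * ((1 + R) * \<alpha>) ^ q + R * (2 * M * exp R * Bd * ((1 + R) * \<alpha>) ^ q))"
    using Suc.IH[OF kernel_derivs_shift[OF Suc.prems(1)] Gc G(2,3,4)]
      Suc.IH[OF kernel_derivs_mono[OF Suc.prems(1)] Gc G(2,3,4)] \<alpha> \<zeta> R
    by (intro mult_left_mono add_mono mult_mono) auto
  also have "\<dots> = 2 * M * exp R * Bd * ((1 + R) * \<alpha>) ^ Suc q"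
    by (simp add: algebra_simps)
  finally show ?case .
qed

section \<open>Averages of periodic functions over the rescaled window\<close>

lemma periodic_window_bound:
  fixes g :: "real \<Rightarrow> complex"
  assumes g: "continuous_on UNIV g" "\<And>y. g (y + 1) = g y" and \<alpha>: "0 < \<alpha>" "\<alpha> \<le> 1"
  shows "integral {-1..1} (\<lambda>t. norm (g (t / \<alpha>))) \<le> 5 * integral {-1/2..1/2} (\<lambda>y. norm (g y))"
proof -
  \<comment> \<open>The stretched window of half-width 1/\<alpha> is covered by 2 J + 1 full
    periods, and \<alpha> (2 J + 1) \<le> 2 + 3 \<alpha> \<le> 5.\<close>
  define J where "J = nat \<lceil>1 / \<alpha>\<rceil>"
  have J: "1 / \<alpha> \<le> real J" "real J \<le> 1 / \<alpha> + 1"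
    using \<alpha> unfolding J_def by (simp_all add: of_nat_ceiling)
  have nc: "continuous_on S (\<lambda>y. norm (g y))" for S
    using g(1) continuous_on_subset by (intro continuous_intros) blast
  have "integral {-1..1} (\<lambda>t. norm (g (t / \<alpha>))) = \<alpha> * integral {-(1/\<alpha>)..1/\<alpha>} (\<lambda>y. norm (g y))"
  proof -
    have "((\<lambda>y. norm (g y)) has_integral integral {-(1/\<alpha>)..1/\<alpha>} (\<lambda>y. norm (g y))) {-(1/\<alpha>)..1/\<alpha>}"
      by (intro integrable_integral integrable_continuous_interval nc)
    from has_integral_stretch_real[OF this, of "1 / \<alpha>"]
    have "((\<lambda>t. norm (g (t / \<alpha>))) has_integral (\<alpha> * integral {-(1/\<alpha>)..1/\<alpha>} (\<lambda>y. norm (g y)))) ((\<lambda>x. x / (1 / \<alpha>)) ` {-(1/\<alpha>)..1/\<alpha>})"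
      using \<alpha> by simp
    moreover have "(\<lambda>x. x / (1 / \<alpha>)) ` {-(1/\<alpha>)..1/\<alpha>} = {-1..1}"
      using \<alpha> image_mult_atLeastAtMost[of \<alpha> "-(1/\<alpha>)" "1/\<alpha>"] by (simp add: mult.commute)
    ultimately show ?thesis by (simp add: has_integral_iff)
  qed
  also have "integral {-(1/\<alpha>)..1/\<alpha>} (\<lambda>y. norm (g y)) \<le> integral {- real J - 1/2..real J + 1/2} (\<lambda>y. norm (g y))"
    using J by (intro integral_subset_le integrable_continuous_interval nc) auto
  also have "\<dots> = real (2 * J + 1) * integral {-1/2..1/2} (\<lambda>y. norm (g y))"
    by (rule integral_symmetric_periods) (simp add: g(2), rule nc)
  also have "\<alpha> * (real (2 * J + 1) * integral {-1/2..1/2} (\<lambda>y. norm (g y)))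
      = (\<alpha> * real (2 * J + 1)) * integral {-1/2..1/2} (\<lambda>y. norm (g y))" by (simp only: mult.assoc)
  also have "\<dots> \<le> 5 * integral {-1/2..1/2} (\<lambda>y. norm (g y))"
  proof (intro mult_right_mono)
    have "\<alpha> * real (2 * J + 1) \<le> \<alpha> * (2 * (1 / \<alpha> + 1) + 1)"
      using J \<alpha> by (intro mult_left_mono) auto
    also have "\<dots> = 2 + 3 * \<alpha>" using \<alpha> by (simp add: field_simps)
    finally show "\<alpha> * real (2 * J + 1) \<le> 5" using \<alpha> by simp
    show "0 \<le> integral {-1/2..1/2} (\<lambda>y. norm (g y))"
      by (rule integral_nonneg) (auto intro!: integrable_continuous_interval nc)
  qed
  finally show ?thesis using \<alpha> by (simp add: mult_left_mono)
qed

lemma weighted_window_bound: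
  fixes g \<kappa> :: "real \<Rightarrow> complex"
  assumes \<kappa>: "continuous_on {-1..1} \<kappa>" "\<And>t. t \<in> {-1..1} \<Longrightarrow> norm (\<kappa> t) \<le> M" and M: "0 \<le> M"
    and g: "continuous_on UNIV g" "\<And>y. g (y + 1) = g y" and \<alpha>: "0 < \<alpha>" "\<alpha> \<le> 1"
  shows "norm (integral {-1..1} (\<lambda>t. \<kappa> t * g (t / \<alpha>))) \<le> M * (5 * integral {-1/2..1/2} (\<lambda>y. norm (g y)))"
proof -
  have gc: "continuous_on S (\<lambda>t. g (t / \<alpha>))" for S
    using \<alpha> by (intro continuous_on_compose2[OF g(1)] continuous_intros) auto
  have "norm (integral {-1..1} (\<lambda>t. \<kappa> t * g (t / \<alpha>))) \<le> integral {-1..1} (\<lambda>t. M * norm (g (t / \<alpha>)))"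
  proof (rule integral_norm_bound_integral)
    show "(\<lambda>t. \<kappa> t * g (t / \<alpha>)) integrable_on {-1..1}"
      by (intro integrable_continuous_interval continuous_intros gc \<kappa>)
    show "(\<lambda>t. M * norm (g (t / \<alpha>))) integrable_on {-1..1}"
      by (intro integrable_continuous_interval continuous_intros gc)
  qed (auto simp: norm_mult intro!: mult_right_mono \<kappa>)
  also have "\<dots> = M * integral {-1..1} (\<lambda>t. norm (g (t / \<alpha>)))" by simp
  also have "\<dots> \<le> M * (5 * integral {-1/2..1/2} (\<lambda>y. norm (g y)))"
    by (intro mult_left_mono periodic_window_bound[OF g \<alpha>] M)
  finally show ?thesis .
qed

text \<open>The substitution x = \<eta> t. It is the reason why all coefficients depend on
  \<epsilon> and \<eta> through their ratio alone.\<close>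

lemma scaled_kernel_integral:
  fixes F :: "real \<Rightarrow> 'a::euclidean_space"
  assumes Kc: "continuous_on UNIV K" and Kz: "\<And>x. 1 \<le> \<bar>x\<bar> \<Longrightarrow> K x = 0"
    and F: "continuous_on UNIV F" and e: "0 < \<epsilon>" "0 < \<eta>"
  shows "(LINT x|lebesgue. scaled_kernel K \<eta> x *\<^sub>R F (x / \<epsilon>)) = integral {-1..1} (\<lambda>t. K t *\<^sub>R F (t / (\<epsilon> / \<eta>)))"
proof -
  define f where "f = (\<lambda>x. scaled_kernel K \<eta> x *\<^sub>R F (x / \<epsilon>))"
  have fc: "continuous_on S f" for S
    unfolding f_def scaled_kernel_def using e
    by (intro continuous_intros continuous_on_compose2[OF F] continuous_on_compose2[OF Kc]) auto
  have fz: "f x = 0" if "x \<notin> {-\<eta>..\<eta>}" for x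
  proof -
    have "1 \<le> \<bar>x / \<eta>\<bar>" using that e by (auto simp: abs_if field_simps)
    then show ?thesis using Kz by (simp add: f_def scaled_kernel_def)
  qed
  have "(LINT x|lebesgue. f x) = (LINT x|lebesgue. indicator {-\<eta>..\<eta>} x *\<^sub>R f x)"
    by (intro Bochner_Integration.integral_cong) (use fz in \<open>auto simp: indicator_def\<close>)
  also have "\<dots> = integral {-\<eta>..\<eta>} f"
    using set_lebesgue_integral_eq_integral(2)[of "{-\<eta>..\<eta>}" f] absolutely_integrable_continuous_real[OF fc]
    by (simp add: set_lebesgue_integral_def)
  also have "\<dots> = integral {-1..1} (\<lambda>t. K t *\<^sub>R F (t / (\<epsilon> / \<eta>)))"
  proof -
    have "(f has_integral integral {-\<eta>..\<eta>} f) {-\<eta>..\<eta>}"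
      by (intro integrable_integral integrable_continuous_interval fc)
    from has_integral_stretch_real[OF this, of \<eta>]
    have "((\<lambda>x. f (\<eta> * x)) has_integral (1 / \<eta>) *\<^sub>R integral {-\<eta>..\<eta>} f) ((\<lambda>x. x / \<eta>) ` {-\<eta>..\<eta>})"
      using e by simp
    moreover have "(\<lambda>x. x / \<eta>) ` {-\<eta>..\<eta>} = {-1..1}"
      using e image_divide_atLeastAtMost[of \<eta> "-\<eta>" \<eta>] by simp
    ultimately have "((\<lambda>x. \<eta> *\<^sub>R f (\<eta> * x)) has_integral integral {-\<eta>..\<eta>} f) {-1..1}"
      using has_integral_cmul[of "\<lambda>x. f (\<eta> * x)" "(1 / \<eta>) *\<^sub>R integral {-\<eta>..\<eta>} f" "{-1..1}" \<eta>] e by simp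
    moreover have "(\<lambda>x. \<eta> *\<^sub>R f (\<eta> * x)) = (\<lambda>t. K t *\<^sub>R F (t / (\<epsilon> / \<eta>)))"
      using e by (auto simp: f_def scaled_kernel_def fun_eq_iff mult.commute)
    ultimately show ?thesis by (simp add: has_integral_iff)
  qed
  finally show ?thesis by (simp add: f_def)
qed

section \<open>Weighted inner products and the weak form of the Bloch equation\<close>

text \<open>A gauge integral over the closed period, convenient since all functions inserted are
  continuous there. Weight 1 gives the L2 inner product, weight \<open>a\<close> applied to shifted
  derivatives gives the energy form.\<close>

definition wip :: "(real \<Rightarrow> real) \<Rightarrow> (real \<Rightarrow> complex) \<Rightarrow> (real \<Rightarrow> complex) \<Rightarrow> complex" where
  "wip a f g = integral {-1/2..1/2} (\<lambda>y. of_real (a y) * f y * cnj (g y))"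

definition wn2 :: "(real \<Rightarrow> real) \<Rightarrow> (real \<Rightarrow> complex) \<Rightarrow> real" where
  "wn2 a f = integral {-1/2..1/2} (\<lambda>y. a y * (norm (f y))\<^sup>2)"

abbreviation cI :: "(real \<Rightarrow> 'a::topological_space) \<Rightarrow> bool" where
  "cI f \<equiv> continuous_on {-1/2..1/2} f"

lemma wip_integrable:
  assumes "cI a" "cI f" "cI g"
  shows "(\<lambda>y. of_real (a y) * f y * cnj (g y)) integrable_on {-1/2..1/2}"
  by (intro integrable_continuous_interval continuous_intros assms)

lemma wn2_integrable:
  assumes "cI a" "cI f"
  shows "(\<lambda>y. a y * (norm (f y))\<^sup>2) integrable_on {-1/2..1/2}"
  by (intro integrable_continuous_interval continuous_intros assms)

lemma wip_cnj: "wip a g f = cnj (wip a f g)"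
  unfolding wip_def by (simp add: integral_cnj mult_ac)

lemma wip_self:
  assumes "cI a" "cI f"
  shows "wip a f f = of_real (wn2 a f)"
proof -
  have "((\<lambda>y. of_real (a y * (norm (f y))\<^sup>2) :: complex) has_integral of_real (wn2 a f)) {-1/2..1/2}"
    unfolding wn2_def by (intro has_integral_of_real integrable_integral wn2_integrable assms)
  moreover have "(\<lambda>y. of_real (a y * (norm (f y))\<^sup>2)) = (\<lambda>y. of_real (a y) * f y * cnj (f y))"
    by (simp only: of_real_mult complex_norm_square mult.assoc)
  ultimately show ?thesis unfolding wip_def by (simp only: has_integral_iff)
qed

lemma wn2_nonneg:
  assumes "cI a" "cI f" "\<And>y. 0 \<le> a y"
  shows "0 \<le> wn2 a f"
  unfolding wn2_def by (intro integral_nonneg wn2_integrable assms) (simp add: assms(3))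

lemma wip_diff_left:
  assumes "cI a" "cI f" "cI f'" "cI g"
  shows "wip a (\<lambda>y. f y - f' y) g = wip a f g - wip a f' g"
proof -
  have "(\<lambda>y. of_real (a y) * (f y - f' y) * cnj (g y)) =
      (\<lambda>y. of_real (a y) * f y * cnj (g y) - of_real (a y) * f' y * cnj (g y))"
    by (simp add: algebra_simps)
  then show ?thesis unfolding wip_def
    by (simp only: integral_diff[OF wip_integrable wip_integrable] assms)
qed

lemma wip_add_left:
  assumes "cI a" "cI f" "cI f'" "cI g"
  shows "wip a (\<lambda>y. f y + f' y) g = wip a f g + wip a f' g"
proof -
  have "(\<lambda>y. of_real (a y) * (f y + f' y) * cnj (g y)) =
      (\<lambda>y. of_real (a y) * f y * cnj (g y) + of_real (a y) * f' y * cnj (g y))"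
    by (simp add: algebra_simps)
  then show ?thesis unfolding wip_def
    by (simp only: integral_add[OF wip_integrable wip_integrable] assms)
qed

lemma wip_scale_left: "wip a (\<lambda>y. c * f y) g = c * wip a f g"
proof -
  have "(\<lambda>y. of_real (a y) * (c * f y) * cnj (g y)) = (\<lambda>y. c * (of_real (a y) * f y * cnj (g y)))"
    by (simp add: algebra_simps)
  then show ?thesis unfolding wip_def by simp
qed

lemma wip_scale_right: "wip a f (\<lambda>y. c * g y) = cnj c * wip a f g"
  by (simp add: wip_cnj[of a f] wip_scale_left)

lemma wip_add_right:
  assumes "cI a" "cI f" "cI g" "cI g'"
  shows "wip a f (\<lambda>y. g y + g' y) = wip a f g + wip a f g'"
  unfolding wip_cnj[of a f] wip_add_left[OF assms(1,3,4,2)] by simp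

lemma wip_diff_right:
  assumes "cI a" "cI f" "cI g" "cI g'"
  shows "wip a f (\<lambda>y. g y - g' y) = wip a f g - wip a f g'"
  unfolding wip_cnj[of a f] wip_diff_left[OF assms(1,3,4,2)] by simp

lemma wip_sum_left:
  assumes "cI a" "\<And>m. m \<in> S \<Longrightarrow> cI (f m)" "cI g" "finite S"
  shows "wip a (\<lambda>y. \<Sum>m\<in>S. c m * f m y) g = (\<Sum>m\<in>S. c m * wip a (f m) g)"
  using assms(4,2)
proof (induction S rule: finite_induct)
  case empty then show ?case by (simp add: wip_def)
next
  case (insert x S)
  have "wip a (\<lambda>y. c x * f x y + (\<Sum>m\<in>S. c m * f m y)) g = wip a (\<lambda>y. c x * f x y) g + wip a (\<lambda>y. \<Sum>m\<in>S. c m * f m y) g"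
    by (intro wip_add_left assms(1,3) continuous_intros insert.prems) auto
  then show ?case using insert by (simp add: wip_scale_left)
qed

text \<open>The optimal t is sqrt(G/F). Adding \<open>e\<close> to both F and G keeps this choice
  legitimate when one of them vanishes; then \<open>e\<close> tends to 0.\<close>

lemma le_sqrt_mult_of_weighted:
  fixes x F G :: real
  assumes "\<And>t. 0 < t \<Longrightarrow> x \<le> (t * F + G / t) / 2" "0 \<le> F" "0 \<le> G"
  shows "x \<le> sqrt F * sqrt G"
proof -
  have "x \<le> sqrt (F + e) * sqrt (G + e)" if e: "0 < e" for e
  proof -
    define f g where "f = sqrt (F + e)" and "g = sqrt (G + e)"
    have fg: "0 < f" "0 < g" "F + e = f * f" "G + e = g * g" using assms e by (auto simp: f_def g_def)
    have "x \<le> ((g / f) * F + G / (g / f)) / 2" using assms(1)[of "g / f"] fg by simp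
    also have "\<dots> \<le> ((g / f) * (F + e) + (G + e) / (g / f)) / 2"
      using fg e by (intro divide_right_mono add_mono mult_left_mono) (auto simp: divide_right_mono)
    also have "\<dots> = f * g" using fg by (simp add: field_simps)
    finally show ?thesis by (simp add: f_def g_def)
  qed
  then have "eventually (\<lambda>e. x \<le> sqrt (F + e) * sqrt (G + e)) (at_right 0)"
    unfolding eventually_at_right_field by (intro exI[of _ 1]) auto
  moreover have "((\<lambda>e. sqrt (F + e) * sqrt (G + e)) \<longlongrightarrow> sqrt (F + 0) * sqrt (G + 0)) (at_right 0)"
    by (intro tendsto_intros)
  ultimately have "x \<le> sqrt (F + 0) * sqrt (G + 0)"
    by (intro tendsto_lowerbound[where F = "at_right 0"]) auto
  then show ?thesis by simp
qed

text \<open>Kept with absolute values inside the integral: besides the usual inequality it then also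
  bounds L1 norms, by taking one of the two functions to be 1.\<close>

lemma wip_Cauchy_Schwarz_abs:
  assumes a: "cI a" "\<And>y. 0 \<le> a y" and f: "cI f" and g: "cI g"
  shows "integral {-1/2..1/2} (\<lambda>y. a y * (norm (f y) * norm (g y))) \<le> sqrt (wn2 a f) * sqrt (wn2 a g)"
proof (rule le_sqrt_mult_of_weighted)
  fix t :: real assume t: "0 < t"
  have am: "u * v \<le> (t * u\<^sup>2 + v\<^sup>2 / t) / 2" for u v :: real
  proof -
    have "0 \<le> (t * u - v)\<^sup>2 / t" using t by simp
    then show ?thesis using t by (simp add: power2_eq_square field_simps)
  qed
  have "integral {-1/2..1/2} (\<lambda>y. a y * (norm (f y) * norm (g y))) \<le>
      integral {-1/2..1/2} (\<lambda>y. t / 2 * (a y * (norm (f y))\<^sup>2) + 1 / (2 * t) * (a y * (norm (g y))\<^sup>2))"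
  proof (rule integral_le)
    show "(\<lambda>y. a y * (norm (f y) * norm (g y))) integrable_on {-1/2..1/2}"
      by (intro integrable_continuous_interval continuous_intros a f g)
    show "(\<lambda>y. t / 2 * (a y * (norm (f y))\<^sup>2) + 1 / (2 * t) * (a y * (norm (g y))\<^sup>2)) integrable_on {-1/2..1/2}"
      by (intro integrable_continuous_interval continuous_intros a f g)
    fix y
    have "a y * (norm (f y) * norm (g y)) \<le> a y * ((t * (norm (f y))\<^sup>2 + (norm (g y))\<^sup>2 / t) / 2)"
      by (intro mult_left_mono am a)
    then show "a y * (norm (f y) * norm (g y)) \<le> t / 2 * (a y * (norm (f y))\<^sup>2) + 1 / (2 * t) * (a y * (norm (g y))\<^sup>2)"
      by (simp add: algebra_simps add_divide_distrib)
  qed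
  also have "\<dots> = t / 2 * wn2 a f + 1 / (2 * t) * wn2 a g"
    unfolding wn2_def
    by (simp only: integral_add[OF integrable_on_mult_right[OF wn2_integrable[OF a(1) f]]
          integrable_on_mult_right[OF wn2_integrable[OF a(1) g]]] integral_mult_right)
  finally show "integral {-1/2..1/2} (\<lambda>y. a y * (norm (f y) * norm (g y))) \<le> (t * wn2 a f + wn2 a g / t) / 2"
    by (simp add: field_simps)
qed (use wn2_nonneg a f g in auto)

lemma wip_Cauchy_Schwarz:
  assumes a: "cI a" "\<And>y. 0 \<le> a y" and f: "cI f" and g: "cI g"
  shows "norm (wip a f g) \<le> sqrt (wn2 a f) * sqrt (wn2 a g)"
proof -
  have "norm (wip a f g) \<le> integral {-1/2..1/2} (\<lambda>y. a y * (norm (f y) * norm (g y)))"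
    unfolding wip_def
  proof (rule integral_norm_bound_integral)
    show "(\<lambda>y. of_real (a y) * f y * cnj (g y)) integrable_on {-1/2..1/2}"
      by (rule wip_integrable[OF a(1) f g])
    show "(\<lambda>y. a y * (norm (f y) * norm (g y))) integrable_on {-1/2..1/2}"
      by (intro integrable_continuous_interval continuous_intros a f g)
  qed (use a(2) in \<open>auto simp: norm_mult\<close>)
  then show ?thesis using wip_Cauchy_Schwarz_abs[OF a f g] by linarith
qed

text \<open>Closes the Bessel arguments: testing with the partial sum itself bounds a sum by its own
  square root times a constant.\<close>

lemma self_bound:
  fixes X B :: real
  assumes "0 \<le> X" "X \<le> sqrt X * sqrt B" "0 \<le> B"
  shows "X \<le> B"
proof (cases "X = 0")
  case False
  then have p: "0 < sqrt X" using assms by simp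
  have "sqrt X * sqrt X \<le> sqrt X * sqrt B" using assms by simp
  then have "sqrt X \<le> sqrt B" using p by (simp only: mult_le_cancel_left_pos)
  then show ?thesis by simp
qed (use assms in simp)

section \<open>Periodic test functions and the shifted derivative\<close>

definition cper :: "(real \<Rightarrow> complex) \<Rightarrow> bool" where
  "cper f \<longleftrightarrow> (\<forall>y. f (y + 1) = f y) \<and> (\<forall>y. f differentiable (at y)) \<and>
     continuous_on UNIV (\<lambda>y. vector_derivative f (at y))"

lemma cper_deriv: "cper f \<Longrightarrow> (f has_vector_derivative vector_derivative f (at y)) (at y)"
  by (simp add: cper_def flip: vector_derivative_works)

lemma cper_cont: "cper f \<Longrightarrow> continuous_on S f"
  by (auto simp: cper_def intro!: continuous_at_imp_continuous_on differentiable_imp_continuous_within)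

lemma cper_deriv_cont: "cper f \<Longrightarrow> continuous_on S (\<lambda>y. vector_derivative f (at y))"
  using continuous_on_subset[of UNIV "\<lambda>y. vector_derivative f (at y)" S] by (simp add: cper_def)

lemma shifted_deriv_cont: "cper f \<Longrightarrow> continuous_on S (shifted_deriv k f)"
  unfolding shifted_deriv_def by (intro continuous_intros cper_cont cper_deriv_cont)

lemma cper_I:
  assumes "\<And>y. f (y + 1) = f y" "\<And>y. (f has_vector_derivative f' y) (at y)" "continuous_on UNIV f'"
  shows "cper f"
proof -
  have "(\<lambda>y. vector_derivative f (at y)) = f'"
    using assms(2) by (auto intro!: vector_derivative_at)
  then show ?thesis using assms by (auto simp: cper_def intro: differentiableI_vector)
qed

lemma shifted_deriv_eq: "(f has_vector_derivative f') (at y) \<Longrightarrow> shifted_deriv k f y = f' + \<i> * of_real k * f y"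
  by (simp add: shifted_deriv_def vector_derivative_at)

lemma shifted_deriv_periodic:
  assumes "cper f" shows "shifted_deriv k f (y + 1) = shifted_deriv k f y"
proof -
  have "((f \<circ> (\<lambda>y. y + 1)) has_vector_derivative 1 *\<^sub>R vector_derivative f (at (y + 1))) (at y)"
    by (rule vector_diff_chain_at[OF _ cper_deriv[OF assms]]) (auto intro!: derivative_eq_intros)
  moreover have "f \<circ> (\<lambda>y. y + 1) = f" using assms by (auto simp: cper_def)
  ultimately have "vector_derivative f (at y) = vector_derivative f (at (y + 1))"
    by (simp add: vector_derivative_at)
  then show ?thesis using assms by (simp add: shifted_deriv_def cper_def)
qed

lemma cper_diff:
  assumes "cper f" "cper g" shows "cper (\<lambda>y. f y - g y)"
  by (rule cper_I[OF _ has_vector_derivative_diff[OF cper_deriv[OF assms(1)] cper_deriv[OF assms(2)]]])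
    (use assms in \<open>auto intro!: continuous_intros cper_deriv_cont simp: cper_def\<close>)

lemma cper_const: "cper (\<lambda>_. c)"
  by (rule cper_I) (auto intro!: derivative_eq_intros)

lemma shifted_deriv_const: "shifted_deriv k (\<lambda>_. c) = (\<lambda>_. \<i> * of_real k * c)"
  by (auto simp: shifted_deriv_def)

lemma shifted_deriv_diff:
  assumes "cper f" "cper g"
  shows "shifted_deriv k (\<lambda>y. f y - g y) = (\<lambda>y. shifted_deriv k f y - shifted_deriv k g y)"
  using shifted_deriv_eq[OF has_vector_derivative_diff[OF cper_deriv[OF assms(1)] cper_deriv[OF assms(2)]]]
  by (auto simp: shifted_deriv_def algebra_simps)

lemma has_vector_derivative_comb:
  assumes "\<And>m. cper (f m)"
  shows "((\<lambda>y. \<Sum>m\<in>S. c m * f m y) has_vector_derivative (\<Sum>m\<in>S. c m * vector_derivative (f m) (at y))) (at y)"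
  by (intro has_vector_derivative_sum has_vector_derivative_mult_right cper_deriv assms)

lemma cper_comb:
  assumes "\<And>m. cper (f m)" shows "cper (\<lambda>y. \<Sum>m\<in>S. c m * f m y)"
  by (rule cper_I[OF _ has_vector_derivative_comb[OF assms]])
    (use assms in \<open>auto intro!: continuous_intros cper_deriv_cont simp: cper_def\<close>)

lemma shifted_deriv_comb:
  assumes "\<And>m. cper (f m)"
  shows "shifted_deriv k (\<lambda>y. \<Sum>m\<in>S. c m * f m y) = (\<lambda>y. \<Sum>m\<in>S. c m * shifted_deriv k (f m) y)"
proof
  fix y
  show "shifted_deriv k (\<lambda>y. \<Sum>m\<in>S. c m * f m y) y = (\<Sum>m\<in>S. c m * shifted_deriv k (f m) y)"
    unfolding shifted_deriv_eq[OF has_vector_derivative_comb[of f, OF assms]] unfolding shifted_deriv_def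
    by (simp add: algebra_simps sum.distrib sum_distrib_left)
qed

lemma L2_inner_on_eq_wip:
  assumes "cI f" "cI g"
  shows "L2_inner_on {-1/2<..<1/2} f g = wip (\<lambda>_. 1) f g"
proof -
  have "(\<lambda>x. f x * cnj (g x)) absolutely_integrable_on {-1/2..1/2}"
    by (intro absolutely_integrable_continuous_real continuous_intros assms)
  then have "set_integrable lebesgue {-1/2<..<1/2} (\<lambda>x. f x * cnj (g x))"
    by (rule set_integrable_subset) auto
  then have "integrable (lebesgue_on {-1/2<..<1/2}) (\<lambda>x. f x * cnj (g x))"
    by (subst integrable_restrict_space) (auto simp: set_integrable_def)
  then show ?thesis
    unfolding L2_inner_on_def wip_def
    by (subst lebesgue_integral_eq_integral) (auto simp: integral_open_interval_real)
qed

lemma L2_norm_on_eq_wn2: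
  assumes "cI f"
  shows "L2_norm_on {-1/2<..<1/2} f = sqrt (wn2 (\<lambda>_. 1) f)"
proof -
  have "(\<lambda>x. (norm (f x))\<^sup>2) absolutely_integrable_on {-1/2..1/2}"
    by (intro absolutely_integrable_continuous_real continuous_intros assms)
  then have "set_integrable lebesgue {-1/2<..<1/2} (\<lambda>x. (norm (f x))\<^sup>2)"
    by (rule set_integrable_subset) auto
  then have "integrable (lebesgue_on {-1/2<..<1/2}) (\<lambda>x. (norm (f x))\<^sup>2)"
    by (subst integrable_restrict_space) (auto simp: set_integrable_def)
  then show ?thesis
    unfolding L2_norm_on_def wn2_def
    by (subst lebesgue_integral_eq_integral) (auto simp: integral_open_interval_real)
qed

text \<open>The derivative of flux times conjugated test function is integrated over one period. Its
  boundary terms cancel by periodicity, and the i k parts combine because conjugation changes their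
  sign.\<close>

lemma weak_identity:
  assumes a: "continuous_on UNIV a" and ap: "\<And>y. a (y + 1) = a y"
    and e: "bloch_eigenfunction a k \<mu> \<phi>" and f: "cper \<phi>" and v: "cper v"
  shows "wip a (shifted_deriv k \<phi>) (shifted_deriv k v) = of_real \<mu> * wip (\<lambda>_. 1) \<phi> v"
proof -
  define p where "p = (\<lambda>z. of_real (a z) * shifted_deriv k \<phi> z)"
  have pd: "(p has_vector_derivative vector_derivative p (at y)) (at y)" for y
    using e by (simp add: bloch_eigenfunction_def p_def flip: vector_derivative_works)
  have pe: "vector_derivative p (at y) = - of_real \<mu> * \<phi> y - \<i> * of_real k * p y" for y
  proof -
    have "- shifted_deriv k p y = of_real \<mu> * \<phi> y"
      using e by (simp add: bloch_eigenfunction_def p_def)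
    then show ?thesis by (simp add: shifted_deriv_def algebra_simps eq_neg_iff_add_eq_0 add_eq_0_iff)
  qed
  have pc: "continuous_on S p" for S
    unfolding p_def by (intro continuous_intros shifted_deriv_cont f continuous_on_subset[OF a]) auto
  have d: "((\<lambda>y. p y * cnj (v y)) has_vector_derivative
      p y * cnj (shifted_deriv k v y) - of_real \<mu> * (\<phi> y * cnj (v y))) (at y within S)" for y S
  proof -
    have "((\<lambda>y. p y * cnj (v y)) has_vector_derivative
       p y * cnj (vector_derivative v (at y)) + vector_derivative p (at y) * cnj (v y)) (at y)"
      by (intro has_vector_derivative_mult pd bounded_linear.has_vector_derivative[OF bounded_linear_cnj] cper_deriv v)
    moreover have "p y * cnj (vector_derivative v (at y)) + vector_derivative p (at y) * cnj (v y) =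
       p y * cnj (shifted_deriv k v y) - of_real \<mu> * (\<phi> y * cnj (v y))"
      unfolding pe by (simp add: shifted_deriv_def algebra_simps)
    ultimately show ?thesis by (simp add: has_vector_derivative_at_within)
  qed
  have "((\<lambda>y. p y * cnj (shifted_deriv k v y) - of_real \<mu> * (\<phi> y * cnj (v y))) has_integral
      (p (1/2) * cnj (v (1/2)) - p (-1/2) * cnj (v (-1/2)))) {-1/2..1/2}"
    by (rule fundamental_theorem_of_calculus[OF _ d]) simp
  moreover have "p (1/2) = p (-1/2)" "v (1/2) = v (-1/2)"
    using shifted_deriv_periodic[OF f, of k "-1/2"] ap[of "-1/2"] v[unfolded cper_def, THEN conjunct1, rule_format, of "-1/2"]
    by (simp_all add: p_def)
  ultimately have "integral {-1/2..1/2} (\<lambda>y. p y * cnj (shifted_deriv k v y) - of_real \<mu> * (\<phi> y * cnj (v y))) = 0"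
    by (simp add: has_integral_iff)
  moreover have "integral {-1/2..1/2} (\<lambda>y. p y * cnj (shifted_deriv k v y) - of_real \<mu> * (\<phi> y * cnj (v y))) =
     integral {-1/2..1/2} (\<lambda>y. p y * cnj (shifted_deriv k v y)) - of_real \<mu> * integral {-1/2..1/2} (\<lambda>y. \<phi> y * cnj (v y))"
    by (subst integral_diff; (intro integrable_continuous_interval continuous_intros pc shifted_deriv_cont[OF v] cper_cont[OF v] cper_cont[OF f])?; simp)
  ultimately show ?thesis by (simp add: wip_def p_def)
qed

section \<open>Energy identities for finite combinations of Bloch waves\<close>

locale bloch =
  fixes a :: "real \<Rightarrow> real" and \<omega> :: "nat \<Rightarrow> real \<Rightarrow> real" and \<psi> :: "nat \<Rightarrow> real \<Rightarrow> real \<Rightarrow> complex"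
  assumes a_C1: "a C1_differentiable_on UNIV"
    and a_periodic: "\<forall>y. a (y + 1) = a y"
    and a_positive: "\<exists>c>0. \<forall>y. c \<le> a y"
    and bloch: "bloch_waves a \<omega> \<psi>"
begin

definition amin :: real where "amin = (SOME c. 0 < c \<and> (\<forall>y. c \<le> a y))"

lemma amin: "0 < amin" "amin \<le> a y"
  using someI_ex[of "\<lambda>c. 0 < c \<and> (\<forall>y. c \<le> a y)"] a_positive unfolding amin_def by auto

lemma a_pos: "0 < a y" using amin(1) amin(2)[of y] by linarith

lemma a_per: "a (y + 1) = a y" using a_periodic by simp

lemma a_cont: "continuous_on S a"
  using C1_differentiable_imp_continuous_on[OF a_C1] by (rule continuous_on_subset) simp

lemma a_nonneg: "0 \<le> a y" using a_pos[of y] by simp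

abbreviation ev :: "nat \<Rightarrow> real \<Rightarrow> real" where "ev m k \<equiv> (\<omega> m k)\<^sup>2"
abbreviation \<phi> :: "nat \<Rightarrow> real \<Rightarrow> real \<Rightarrow> complex" where "\<phi> m k \<equiv> \<lambda>y. \<psi> m y k"
abbreviation b :: "nat \<Rightarrow> real \<Rightarrow> complex" where "b \<equiv> b_coef \<psi>"
abbreviation ip :: "(real \<Rightarrow> complex) \<Rightarrow> (real \<Rightarrow> complex) \<Rightarrow> complex" where "ip \<equiv> wip (\<lambda>_. 1)"
abbreviation n2 :: "(real \<Rightarrow> complex) \<Rightarrow> real" where "n2 \<equiv> wn2 (\<lambda>_. 1)"

lemma eig: "k \<in> {-pi..pi} \<Longrightarrow> bloch_eigenfunction a k (ev m k) (\<phi> m k)"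
  using bloch unfolding bloch_waves_def by blast

text \<open>The flux is differentiable, hence continuous; dividing by the positive \<open>a\<close>
  recovers a continuous derivative of the eigenfunction.\<close>

lemma \<phi>_cper:
  assumes k: "k \<in> {-pi..pi}" shows "cper (\<phi> m k)"
proof -
  note e = eig[OF k, of m, unfolded bloch_eigenfunction_def]
  have d: "\<phi> m k differentiable (at y)" for y using e by blast
  have c: "continuous_on UNIV (\<phi> m k)"
    by (intro continuous_at_imp_continuous_on ballI differentiable_imp_continuous_within d)
  have c2: "continuous_on UNIV (\<lambda>z. of_real (a z) * shifted_deriv k (\<phi> m k) z)"
    using e by (intro continuous_at_imp_continuous_on ballI differentiable_imp_continuous_within) blast
  have "continuous_on UNIV (\<lambda>z. of_real (a z) * shifted_deriv k (\<phi> m k) z / of_real (a z) - \<i> * of_real k * \<phi> m k z)"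
    by (rule continuous_on_diff[OF continuous_on_divide[OF c2 continuous_on_of_real[OF a_cont]] continuous_on_mult[OF continuous_on_const c]])
      (use a_pos in \<open>auto simp: less_imp_neq[symmetric]\<close>)
  moreover have "of_real (a z) * shifted_deriv k (\<phi> m k) z / of_real (a z) - \<i> * of_real k * \<phi> m k z
      = vector_derivative (\<phi> m k) (at z)" for z
    using a_pos[of z] by (simp add: shifted_deriv_def)
  ultimately have "continuous_on UNIV (\<lambda>z. vector_derivative (\<phi> m k) (at z))" by simp
  then show ?thesis using e by (simp add: cper_def)
qed

lemma \<phi>_cont: "k \<in> {-pi..pi} \<Longrightarrow> continuous_on S (\<phi> m k)"
  by (intro cper_cont \<phi>_cper)

lemma D\<phi>_cont: "k \<in> {-pi..pi} \<Longrightarrow> continuous_on S (shifted_deriv k (\<phi> m k))"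
  by (intro shifted_deriv_cont \<phi>_cper)

lemma \<phi>_orth:
  assumes k: "k \<in> {-pi..pi}" shows "ip (\<phi> m k) (\<phi> n k) = (if m = n then 1 else 0)"
proof -
  have "L2_inner_on {-1/2<..<1/2} (\<phi> m k) (\<phi> n k) = (if m = n then 1 else 0)"
    using bloch k unfolding bloch_waves_def orthonormal_basis_L2_def by blast
  then show ?thesis using L2_inner_on_eq_wip[OF \<phi>_cont[OF k] \<phi>_cont[OF k]] by simp
qed

lemma \<phi>_weak:
  "k \<in> {-pi..pi} \<Longrightarrow> cper v \<Longrightarrow>
    wip a (shifted_deriv k (\<phi> m k)) (shifted_deriv k v) = of_real (ev m k) * ip (\<phi> m k) v"
  by (intro weak_identity a_cont a_per eig \<phi>_cper)

lemma b_eq: "k \<in> {-pi..pi} \<Longrightarrow> b m k = ip (\<lambda>_. 1) (\<phi> m k)"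
proof -
  assume k: "k \<in> {-pi..pi}"
  have "(\<lambda>x. cnj (\<phi> m k x)) absolutely_integrable_on {-1/2..1/2}"
    by (intro absolutely_integrable_continuous_real continuous_intros \<phi>_cont k)
  then have "integrable (lebesgue_on {-1/2..1/2}) (\<lambda>x. cnj (\<phi> m k x))"
    by (subst integrable_restrict_space) (auto simp: set_integrable_def)
  then show ?thesis
    unfolding b_coef_def wip_def by (subst lebesgue_integral_eq_integral) auto
qed

definition comb :: "(nat \<Rightarrow> complex) \<Rightarrow> nat \<Rightarrow> real \<Rightarrow> real \<Rightarrow> complex" where
  "comb c N k = (\<lambda>y. \<Sum>m<N. c m * \<phi> m k y)"

lemma comb_cper: "k \<in> {-pi..pi} \<Longrightarrow> cper (comb c N k)"
  unfolding comb_def by (intro cper_comb \<phi>_cper)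

lemma D_comb: "k \<in> {-pi..pi} \<Longrightarrow> shifted_deriv k (comb c N k) = (\<lambda>y. \<Sum>m<N. c m * shifted_deriv k (\<phi> m k) y)"
  unfolding comb_def by (intro shifted_deriv_comb \<phi>_cper)

lemma ip_comb: "k \<in> {-pi..pi} \<Longrightarrow> cI v \<Longrightarrow> ip (comb c N k) v = (\<Sum>m<N. c m * ip (\<phi> m k) v)"
  unfolding comb_def by (intro wip_sum_left continuous_intros \<phi>_cont) auto

lemma comb_weak:
  assumes "k \<in> {-pi..pi}" "cper v"
  shows "wip a (shifted_deriv k (comb c N k)) (shifted_deriv k v) = (\<Sum>m<N. c m * of_real (ev m k) * ip (\<phi> m k) v)"
  unfolding D_comb[OF assms(1)]
  by (subst wip_sum_left) (simp_all add: a_cont D\<phi>_cont[OF assms(1)] shifted_deriv_cont[OF assms(2)] \<phi>_weak[OF assms] mult.assoc)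

lemma ip_\<phi>_comb:
  assumes k: "k \<in> {-pi..pi}" and "m < N" shows "ip (\<phi> m k) (comb c N k) = cnj (c m)"
proof -
  have "ip (comb c N k) (\<phi> m k) = (\<Sum>j<N. c j * ip (\<phi> j k) (\<phi> m k))"
    by (rule ip_comb[OF k \<phi>_cont[OF k]])
  also have "\<dots> = c m" using assms by (simp add: \<phi>_orth[OF k] if_distrib cong: if_cong)
  finally show ?thesis by (subst wip_cnj) simp
qed

lemma n2_comb:
  assumes k: "k \<in> {-pi..pi}" shows "n2 (comb c N k) = (\<Sum>m<N. (norm (c m))\<^sup>2)"
proof -
  have "complex_of_real (n2 (comb c N k)) = (\<Sum>m<N. c m * ip (\<phi> m k) (comb c N k))"
    using wip_self[OF _ cper_cont[OF comb_cper[OF k]], of "\<lambda>_. 1"] ip_comb[OF k cper_cont[OF comb_cper[OF k]]] by simp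
  also have "\<dots> = (\<Sum>m<N. of_real ((norm (c m))\<^sup>2))"
    by (intro sum.cong refl) (simp add: ip_\<phi>_comb[OF k] complex_norm_square[symmetric])
  finally show ?thesis by (simp only: of_real_sum[symmetric] of_real_eq_iff)
qed

lemma energy_comb:
  assumes k: "k \<in> {-pi..pi}" shows "wn2 a (shifted_deriv k (comb c N k)) = (\<Sum>m<N. ev m k * (norm (c m))\<^sup>2)"
proof -
  have "complex_of_real (wn2 a (shifted_deriv k (comb c N k))) = (\<Sum>m<N. c m * of_real (ev m k) * ip (\<phi> m k) (comb c N k))"
    by (simp only: wip_self[OF a_cont shifted_deriv_cont[OF comb_cper[OF k]], symmetric] comb_weak[OF k comb_cper[OF k]])
  also have "\<dots> = (\<Sum>m<N. of_real (ev m k * (norm (c m))\<^sup>2))"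
    by (intro sum.cong refl) (simp add: ip_\<phi>_comb[OF k] mult_ac flip: complex_norm_square)
  finally show ?thesis by (simp only: of_real_sum[symmetric] of_real_eq_iff)
qed

definition amean :: real where "amean = integral {-1/2..1/2} a"

lemma amean_nonneg: "0 \<le> amean"
  unfolding amean_def by (intro integral_nonneg integrable_continuous_interval a_cont a_nonneg)

lemma energy_const: "wn2 a (shifted_deriv k (\<lambda>_. 1)) = k\<^sup>2 * amean"
  by (simp add: wn2_def shifted_deriv_const amean_def norm_mult mult.commute)

lemma ip_\<phi>_one: "k \<in> {-pi..pi} \<Longrightarrow> ip (\<phi> m k) (\<lambda>_. 1) = cnj (b m k)"
  by (simp add: b_eq wip_cnj[of _ "\<phi> m k"])

text \<open>The left side is both the energy of the partial expansion of 1 and the energy pairing of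
  that expansion with 1, whose own energy is only \<open>k\<^sup>2 * amean\<close> because the
  shifted derivative of 1 is i k. This is the source of every factor |k| below.\<close>

lemma energy_b_bound:
  assumes k: "k \<in> {-pi..pi}"
  shows "(\<Sum>m<N. ev m k * (norm (b m k))\<^sup>2) \<le> k\<^sup>2 * amean"
proof (rule self_bound)
  let ?X = "\<Sum>m<N. ev m k * (norm (b m k))\<^sup>2"
  let ?u = "comb (\<lambda>m. b m k) N k"
  have "of_real (e * (norm z)\<^sup>2) = z * of_real e * cnj z" for e z
    unfolding of_real_mult complex_norm_square by simp
  then have "of_real ?X = (\<Sum>m<N. b m k * of_real (ev m k) * cnj (b m k))"
    unfolding of_real_sum by presburger
  also have "\<dots> = wip a (shifted_deriv k ?u) (shifted_deriv k (\<lambda>_. 1))"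
    using comb_weak[OF k cper_const] by (simp add: ip_\<phi>_one[OF k])
  finally have "norm (of_real ?X :: complex) \<le> sqrt (wn2 a (shifted_deriv k ?u)) * sqrt (wn2 a (shifted_deriv k (\<lambda>_. 1)))"
    using wip_Cauchy_Schwarz[OF a_cont a_nonneg shifted_deriv_cont[OF comb_cper[OF k]] shifted_deriv_cont[OF cper_const]]
    by simp
  then show "?X \<le> sqrt ?X * sqrt (k\<^sup>2 * amean)"
    unfolding energy_comb[OF k] energy_const norm_of_real by linarith
qed (auto intro!: sum_nonneg simp: amean_nonneg)

end

section \<open>Bounds for the series\<close>

lemma exp_2pi_mean: "integral {-1/2..1/2} (\<lambda>y::real. exp (\<i> * of_real (2 * pi * y))) = 0"
proof -
  have d: "((\<lambda>y. exp (\<i> * of_real (2 * pi * y)) / (2 * pi * \<i>)) has_vector_derivative exp (\<i> * of_real (2 * pi * y))) (at y within S)"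
    for y :: real and S
  proof -
    have "((\<lambda>z. exp (\<i> * (2 * pi * z)) / (2 * pi * \<i>)) has_field_derivative exp (\<i> * (2 * pi * of_real y))) (at (of_real y))"
      by (auto intro!: derivative_eq_intros)
    from has_vector_derivative_real_field[OF this] show ?thesis
      by (simp add: has_vector_derivative_at_within)
  qed
  have "((\<lambda>y::real. exp (\<i> * of_real (2 * pi * y))) has_integral
     (exp (\<i> * of_real (2 * pi * (1/2))) / (2 * pi * \<i>) - exp (\<i> * of_real (2 * pi * (-1/2))) / (2 * pi * \<i>))) {-1/2..1/2}"
    by (rule fundamental_theorem_of_calculus[OF _ d]) simp
  moreover have "exp (\<i> * of_real (2 * pi * (1/2))) = -1" "exp (\<i> * of_real (2 * pi * (-1/2))) = -1"
    using exp_pi_i exp_minus[of "\<i> * complex_of_real pi"] by (simp_all add: mult.commute)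
  ultimately show ?thesis by (simp only: has_integral_iff) simp
qed

section \<open>The coefficients as integrals over the fixed window\<close>

locale bloch_kernel = bloch +
  fixes K :: "real \<Rightarrow> real" and q :: nat and M :: real
  assumes kd: "kernel_derivs q (\<lambda>j. nderiv j K) M" and q_pos: "1 \<le> q"
begin

lemma K_cont: "continuous_on S K"
  and K_bound: "\<bar>K x\<bar> \<le> M"
  and K_zero: "1 \<le> \<bar>x\<bar> \<Longrightarrow> K x = 0"
proof -
  show "\<bar>K x\<bar> \<le> M" "1 \<le> \<bar>x\<bar> \<Longrightarrow> K x = 0"
    using kd by (simp_all add: kernel_derivs_def nderiv_0 le0[of q] del: le0) (metis le0 nderiv_0)+
  have "continuous_on UNIV K"
    using kd unfolding kernel_derivs_def by (metis le0 nderiv_0)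
  then show "continuous_on S K" by (rule continuous_on_subset) simp
qed

lemma M_nonneg: "0 \<le> M" using K_bound[of 0] by linarith

definition sK :: "real \<Rightarrow> real \<Rightarrow> real" where
  "sK \<alpha> w = integral {-1..1} (\<lambda>t. K t * cos (w * t / \<alpha>))"

text \<open>The averaging behind w_m, detached from the eigenfunction: being linear in
  \<open>g\<close>, it can be applied to whole combinations of fluxes and not merely to one.\<close>

definition LK :: "real \<Rightarrow> real \<Rightarrow> (real \<Rightarrow> complex) \<Rightarrow> complex" where
  "LK \<alpha> k g = integral {-1..1} (\<lambda>t. of_real (K t) * exp (\<i> * of_real (k / \<alpha>) * of_real t) * g (t / \<alpha>))"

definition flux :: "nat \<Rightarrow> real \<Rightarrow> real \<Rightarrow> complex" where
  "flux m k = (\<lambda>y. of_real (a y) * shifted_deriv k (\<phi> m k) y)"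

abbreviation wm :: "real \<Rightarrow> nat \<Rightarrow> real \<Rightarrow> complex" where "wm \<alpha> m k \<equiv> LK \<alpha> k (flux m k)"

lemma s_coef_eq:
  assumes "0 < \<epsilon>" "0 < \<eta>"
  shows "s_coef K \<omega> \<epsilon> \<eta> m k = sK (\<epsilon> / \<eta>) (\<omega> m k)"
proof -
  have "(LINT x|lebesgue. scaled_kernel K \<eta> x *\<^sub>R (\<lambda>y. cos (\<omega> m k * y)) (x / \<epsilon>)) =
      integral {-1..1} (\<lambda>t. K t *\<^sub>R (\<lambda>y. cos (\<omega> m k * y)) (t / (\<epsilon> / \<eta>)))"
    by (intro scaled_kernel_integral K_cont K_zero continuous_intros assms)
  then show ?thesis by (simp add: s_coef_def sK_def mult.assoc)
qed

lemma flux_cont: "k \<in> {-pi..pi} \<Longrightarrow> continuous_on S (flux m k)"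
  unfolding flux_def by (intro continuous_intros D\<phi>_cont a_cont)

text \<open>The product rule turns the derivative of the modulated wave into the shifted derivative
  times 1/\<epsilon>, which the prefactor \<epsilon> in \<open>w_coef\<close> cancels.\<close>

lemma w_coef_eq:
  assumes e: "0 < \<epsilon>" "0 < \<eta>" and k: "k \<in> {-pi..pi}"
  shows "w_coef a K \<psi> \<epsilon> \<eta> m k = wm (\<epsilon> / \<eta>) m k"
proof -
  define F where "F = (\<lambda>y. flux m k y * exp (\<i> * of_real (k * y)))"
  have vd: "vector_derivative (\<lambda>z. \<psi> m (z / \<epsilon>) k * exp (\<i> * of_real (k * z / \<epsilon>))) (at x) =
      of_real (1 / \<epsilon>) * (shifted_deriv k (\<phi> m k) (x / \<epsilon>) * exp (\<i> * of_real (k * (x / \<epsilon>))))" for x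
  proof -
    have 1: "((\<lambda>z. z / \<epsilon>) has_vector_derivative 1 / \<epsilon>) (at x)"
      unfolding has_real_derivative_iff_has_vector_derivative[symmetric]
      using e by (auto intro!: derivative_eq_intros)
    have 2: "((\<lambda>z. exp (\<i> * of_real (k * z / \<epsilon>))) has_vector_derivative
        \<i> * of_real (k / \<epsilon>) * exp (\<i> * of_real (k * x / \<epsilon>))) (at x)"
    proof -
      have "((\<lambda>z. exp (\<i> * (k * z / \<epsilon>))) has_field_derivative \<i> * of_real (k / \<epsilon>) * exp (\<i> * (k * of_real x / \<epsilon>))) (at (of_real x))"
        using e by (auto intro!: derivative_eq_intros)
      from has_vector_derivative_real_field[OF this] show ?thesis by simp
    qed
    have "((\<lambda>z. \<psi> m (z / \<epsilon>) k) has_vector_derivative (1 / \<epsilon>) *\<^sub>R vector_derivative (\<phi> m k) (at (x / \<epsilon>))) (at x)"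
      using vector_diff_chain_at[OF 1 cper_deriv[OF \<phi>_cper[OF k]]] by (simp add: o_def)
    from has_vector_derivative_mult[OF this 2] show ?thesis
      by (simp add: vector_derivative_at shifted_deriv_def scaleR_conv_of_real algebra_simps)
  qed
  have "(LINT x|lebesgue. scaled_kernel K \<eta> x *\<^sub>R F (x / \<epsilon>)) = integral {-1..1} (\<lambda>t. K t *\<^sub>R F (t / (\<epsilon> / \<eta>)))"
    unfolding F_def by (intro scaled_kernel_integral K_cont K_zero continuous_intros e flux_cont k)
  also have "\<dots> = wm (\<epsilon> / \<eta>) m k"
    unfolding LK_def by (rule arg_cong[where f = "integral _"]) (auto simp: F_def scaleR_conv_of_real fun_eq_iff mult_ac)
  finally have *: "(LINT x|lebesgue. scaled_kernel K \<eta> x *\<^sub>R F (x / \<epsilon>)) = wm (\<epsilon> / \<eta>) m k" .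
  have "w_coef a K \<psi> \<epsilon> \<eta> m k = of_real \<epsilon> * (LINT x|lebesgue. of_real (1 / \<epsilon>) * (scaled_kernel K \<eta> x *\<^sub>R F (x / \<epsilon>)))"
    unfolding w_coef_def vd F_def flux_def by (simp add: scaleR_conv_of_real mult_ac)
  also have "\<dots> = of_real \<epsilon> * (of_real (1 / \<epsilon>) * (LINT x|lebesgue. (scaled_kernel K \<eta> x *\<^sub>R F (x / \<epsilon>))))"
    by (simp only: integral_mult_right_zero)
  also have "\<dots> = wm (\<epsilon> / \<eta>) m k" using e * by simp
  finally show ?thesis .
qed

lemma W_term_eq:
  assumes "0 < \<epsilon>" "0 < \<eta>" "k \<in> {-pi..pi}"
  shows "W_term a K \<omega> \<psi> \<epsilon> \<eta> m k = b m k * of_real (sK (\<epsilon> / \<eta>) (\<omega> m k)) * wm (\<epsilon> / \<eta>) m k"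
  using assms by (simp add: W_term_def s_coef_eq w_coef_eq)

text \<open>The 5 comes from covering the window by periods, \<open>M\<close> bounds the kernel, and
  \<open>sqrt amean\<close> is the weighted norm of 1 in Cauchy-Schwarz.\<close>

definition CL :: real where "CL = 5 * M * sqrt amean"

lemma CL_nonneg: "0 \<le> CL" by (simp add: CL_def M_nonneg amean_nonneg)

lemma LK_integrable:
  assumes "continuous_on UNIV g" "0 < \<alpha>"
  shows "(\<lambda>t. of_real (K t) * exp (\<i> * of_real (k / \<alpha>) * of_real t) * g (t / \<alpha>)) integrable_on {-1..1}"
  using assms(2) by (intro integrable_continuous_interval continuous_intros K_cont
      continuous_on_compose2[OF assms(1)]) auto

text \<open>The weight stays general because it is used both for the kernel times one exponential
  and for the kernel times the difference of two exponentials, where \<open>C\<close> is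
  small.\<close>

lemma weighted_flux_bound:
  assumes \<kappa>: "continuous_on {-1..1} \<kappa>" "\<And>t. t \<in> {-1..1} \<Longrightarrow> norm (\<kappa> t) \<le> C * M" "0 \<le> C"
    and v: "continuous_on UNIV v" "\<And>y. v (y + 1) = v y" and \<alpha>: "0 < \<alpha>" "\<alpha> \<le> 1"
  shows "norm (integral {-1..1} (\<lambda>t. \<kappa> t * (of_real (a (t / \<alpha>)) * v (t / \<alpha>)))) \<le> C * CL * sqrt (wn2 a v)"
proof -
  have vc: "cI v" using v(1) continuous_on_subset by blast
  have "norm (integral {-1..1} (\<lambda>t. \<kappa> t * (of_real (a (t / \<alpha>)) * v (t / \<alpha>))))
      \<le> (C * M) * (5 * integral {-1/2..1/2} (\<lambda>y. norm (of_real (a y) * v y)))"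
    using weighted_window_bound[OF \<kappa>(1,2), of "\<lambda>y. of_real (a y) * v y" \<alpha>] \<kappa>(3) v \<alpha> M_nonneg a_cont
    by (simp add: a_per continuous_on_mult)
  also have "\<dots> \<le> (C * M) * (5 * (sqrt amean * sqrt (wn2 a v)))"
  proof (intro mult_left_mono)
    have "(\<lambda>y. norm (of_real (a y) * v y)) = (\<lambda>y. a y * (norm ((\<lambda>_. 1 :: complex) y) * norm (v y)))"
      using a_nonneg by (simp add: norm_mult)
    moreover have "wn2 a (\<lambda>_. 1) = amean" by (simp add: wn2_def amean_def)
    ultimately show "integral {-1/2..1/2} (\<lambda>y. norm (of_real (a y) * v y)) \<le> sqrt amean * sqrt (wn2 a v)"
      using wip_Cauchy_Schwarz_abs[OF a_cont a_nonneg continuous_on_const vc, of 1] by (simp only:)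
  qed (use M_nonneg \<kappa>(3) in auto)
  also have "\<dots> = C * CL * sqrt (wn2 a v)" by (simp add: CL_def)
  finally show ?thesis .
qed

lemma LK_weighted_bound:
  assumes v: "continuous_on UNIV v" "\<And>y. v (y + 1) = v y" and \<alpha>: "0 < \<alpha>" "\<alpha> \<le> 1"
  shows "norm (LK \<alpha> k (\<lambda>y. of_real (a y) * v y)) \<le> CL * sqrt (wn2 a v)"
proof -
  have "norm (integral {-1..1} (\<lambda>t. (of_real (K t) * exp (\<i> * of_real (k / \<alpha>) * of_real t)) * (of_real (a (t / \<alpha>)) * v (t / \<alpha>))))
    \<le> 1 * CL * sqrt (wn2 a v)"
  proof (rule weighted_flux_bound[OF _ _ _ v \<alpha>])
    show "continuous_on {-1..1} (\<lambda>t. of_real (K t) * exp (\<i> * of_real (k / \<alpha>) * of_real t))"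
      by (intro continuous_intros K_cont)
    fix t
    have "norm (exp (\<i> * of_real (k / \<alpha>) * of_real t)) = 1"
      by (simp only: mult.assoc of_real_mult[symmetric] norm_exp_i_times)
    then show "norm (of_real (K t) * exp (\<i> * of_real (k / \<alpha>) * of_real t)) \<le> 1 * M"
      using K_bound[of t] by (simp add: norm_mult del: of_real_divide)
  qed simp
  then show ?thesis by (simp add: LK_def)
qed

lemma LK_D_bound:
  assumes "cper u" "0 < \<alpha>" "\<alpha> \<le> 1"
  shows "norm (LK \<alpha> k (\<lambda>y. of_real (a y) * shifted_deriv k u y)) \<le> CL * sqrt (wn2 a (shifted_deriv k u))"
  by (rule LK_weighted_bound) (use assms in \<open>auto intro!: shifted_deriv_cont shifted_deriv_periodic\<close>)

lemma LK_sum: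
  assumes "\<And>m. m \<in> S \<Longrightarrow> continuous_on UNIV (g m)" "0 < \<alpha>" "finite S"
  shows "LK \<alpha> k (\<lambda>y. \<Sum>m\<in>S. c m * g m y) = (\<Sum>m\<in>S. c m * LK \<alpha> k (g m))"
proof -
  have "(\<lambda>t. of_real (K t) * exp (\<i> * of_real (k / \<alpha>) * of_real t) * (\<Sum>m\<in>S. c m * g m (t / \<alpha>))) =
      (\<lambda>t. \<Sum>m\<in>S. c m * (of_real (K t) * exp (\<i> * of_real (k / \<alpha>) * of_real t) * g m (t / \<alpha>)))"
    by (simp only: sum_distrib_left mult.left_commute mult.assoc)
  moreover have "integral {-1..1} (\<lambda>t. \<Sum>m\<in>S. c m * (of_real (K t) * exp (\<i> * of_real (k / \<alpha>) * of_real t) * g m (t / \<alpha>)))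
     = (\<Sum>m\<in>S. integral {-1..1} (\<lambda>t. c m * (of_real (K t) * exp (\<i> * of_real (k / \<alpha>) * of_real t) * g m (t / \<alpha>))))"
    by (intro integral_sum integrable_on_mult_right LK_integrable assms)
  ultimately show ?thesis by (simp add: LK_def)
qed

lemma LK_D_comb:
  assumes k: "k \<in> {-pi..pi}" and "0 < \<alpha>"
  shows "LK \<alpha> k (\<lambda>y. of_real (a y) * shifted_deriv k (comb c N k) y) = (\<Sum>m<N. c m * wm \<alpha> m k)"
proof -
  have "(\<lambda>y. of_real (a y) * shifted_deriv k (comb c N k) y) = (\<lambda>y. \<Sum>m<N. c m * flux m k y)"
    by (simp add: D_comb[OF k] flux_def sum_distrib_left mult_ac)
  then show ?thesis using LK_sum[of "{..<N}" "\<lambda>m. flux m k" \<alpha> k c] flux_cont[OF k] assms by simp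
qed

lemma wm_bound:
  assumes k: "k \<in> {-pi..pi}" and \<alpha>: "0 < \<alpha>" "\<alpha> \<le> 1"
  shows "norm (wm \<alpha> m k) \<le> CL * sqrt (ev m k)"
proof -
  have "of_real (wn2 a (shifted_deriv k (\<phi> m k))) = (of_real (ev m k) :: complex)"
    using wip_self[OF a_cont D\<phi>_cont[OF k], of m] \<phi>_weak[OF k \<phi>_cper[OF k], of m m] \<phi>_orth[OF k, of m m] by simp
  then have "wn2 a (shifted_deriv k (\<phi> m k)) = ev m k" by (simp only: of_real_eq_iff)
  then show ?thesis using LK_D_bound[OF \<phi>_cper[OF k, of m] \<alpha>, of k] by (simp add: flux_def)
qed

text \<open>Duality: the averaging functional is bounded in the energy norm by \<open>CL\<close>,
  and evaluating it on a suitable combination recovers the sum of squares of its values on the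
  normalised fluxes.\<close>

lemma wm_Bessel:
  assumes k: "k \<in> {-pi..pi}" and \<alpha>: "0 < \<alpha>" "\<alpha> \<le> 1"
  shows "(\<Sum>m<N. (norm (wm \<alpha> m k))\<^sup>2 / ev m k) \<le> CL\<^sup>2"
proof (rule self_bound)
  let ?X = "\<Sum>m<N. (norm (wm \<alpha> m k))\<^sup>2 / ev m k"
  \<comment> \<open>The extremal coefficients: both the energy of the combination and the value of
    the functional on it equal \<open>?X\<close>. Where the eigenvalue is 0, division by zero makes
    the corresponding terms 0 throughout.\<close>
  define c where "c = (\<lambda>m. cnj (wm \<alpha> m k) / of_real (ev m k))"
  have "wn2 a (shifted_deriv k (comb c N k)) = (\<Sum>m<N. ev m k * (norm (c m))\<^sup>2)"
    by (rule energy_comb[OF k])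
  also have "\<dots> = ?X"
  proof (intro sum.cong refl)
    have "e * (norm (cnj w / of_real e))\<^sup>2 = (norm w)\<^sup>2 / e" for w e
      by (cases "e = 0") (simp_all add: norm_divide power_divide power2_eq_square)
    then show "ev m k * (norm (c m))\<^sup>2 = (norm (wm \<alpha> m k))\<^sup>2 / ev m k" for m
      unfolding c_def by blast
  qed
  finally have e: "wn2 a (shifted_deriv k (comb c N k)) = ?X" .
  have "complex_of_real ((norm z)\<^sup>2 / e) = cnj z / of_real e * z" for z e
    unfolding of_real_divide complex_norm_square by simp
  then have "complex_of_real ?X = (\<Sum>m<N. c m * wm \<alpha> m k)"
    unfolding of_real_sum c_def by presburger
  also have "\<dots> = LK \<alpha> k (\<lambda>y. of_real (a y) * shifted_deriv k (comb c N k) y)"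
    by (rule LK_D_comb[OF k \<alpha>(1), symmetric])
  finally have "norm (complex_of_real ?X) \<le> CL * sqrt ?X"
    using LK_D_bound[OF comb_cper[OF k] \<alpha>, of k c N] e by simp
  then show "?X \<le> sqrt ?X * sqrt (CL\<^sup>2)"
    using CL_nonneg by (simp only: norm_of_real real_sqrt_abs abs_of_nonneg[OF CL_nonneg]) (simp add: mult.commute)
qed (auto intro!: sum_nonneg)

section \<open>Absolute convergence of the series\<close>

definition CW :: real where "CW = sqrt amean * CL"

lemma CW_nonneg: "0 \<le> CW" by (simp add: CW_def CL_nonneg amean_nonneg)

text \<open>Each term is split as \<open>sqrt (ev m k)\<close> times |b| against |w| divided by that
  root, and the two Bessel bounds are multiplied. The multiplier \<sigma> is arbitrary, so that s_m,
  resolvent powers and approximation errors are all covered.\<close>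

lemma partial_series_bound:
  assumes k: "k \<in> {-pi..pi}" and \<alpha>: "0 < \<alpha>" "\<alpha> \<le> 1" and S: "\<And>m. \<bar>\<sigma> m\<bar> \<le> S"
  shows "(\<Sum>m<N. norm (b m k * of_real (\<sigma> m) * wm \<alpha> m k)) \<le> S * (\<bar>k\<bar> * CW)"
proof -
  have S0: "0 \<le> S" using S[of 0] by linarith
  let ?x = "\<lambda>m. sqrt (ev m k) * norm (b m k)" and ?y = "\<lambda>m. norm (wm \<alpha> m k) / sqrt (ev m k)"
  have t: "norm (b m k * of_real (\<sigma> m) * wm \<alpha> m k) \<le> S * (\<bar>?x m\<bar> * \<bar>?y m\<bar>)" for m
  \<comment> \<open>With eigenvalue 0 the splitting would replace |b| |w| by 0; this is harmless
    since then w itself vanishes.\<close>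
  proof (cases "ev m k = 0")
    case True
    then have "wm \<alpha> m k = 0" using wm_bound[OF k \<alpha>, of m] by simp
    then show ?thesis using S0 by simp
  next
    case False
    have "norm (b m k * of_real (\<sigma> m) * wm \<alpha> m k) = \<bar>\<sigma> m\<bar> * (norm (b m k) * norm (wm \<alpha> m k))"
      by (simp add: norm_mult)
    also have "\<dots> \<le> S * (norm (b m k) * norm (wm \<alpha> m k))"
      by (intro mult_right_mono S) simp
    also have "norm (b m k) * norm (wm \<alpha> m k) = \<bar>?x m\<bar> * \<bar>?y m\<bar>"
      using False by (simp add: abs_mult)
    finally show ?thesis .
  qed
  have "(\<Sum>m<N. norm (b m k * of_real (\<sigma> m) * wm \<alpha> m k)) \<le> (\<Sum>m<N. S * (\<bar>?x m\<bar> * \<bar>?y m\<bar>))"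
    by (intro sum_mono t)
  also have "\<dots> = S * (\<Sum>m<N. \<bar>?x m\<bar> * \<bar>?y m\<bar>)"
    by (simp only: sum_distrib_left)
  also have "\<dots> \<le> S * (L2_set ?x {..<N} * L2_set ?y {..<N})"
    by (intro mult_left_mono L2_set_mult_ineq S0)
  also have "\<dots> \<le> S * (sqrt (k\<^sup>2 * amean) * sqrt (CL\<^sup>2))"
  proof (intro mult_left_mono mult_mono S0)
    show "L2_set ?x {..<N} \<le> sqrt (k\<^sup>2 * amean)"
      unfolding L2_set_def using energy_b_bound[OF k, of N] by (simp add: power_mult_distrib)
    show "L2_set ?y {..<N} \<le> sqrt (CL\<^sup>2)"
      unfolding L2_set_def using wm_Bessel[OF k \<alpha>, of N] by (intro real_sqrt_le_mono) (simp add: power_divide)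
  qed (auto simp: amean_nonneg)
  also have "\<dots> = S * (\<bar>k\<bar> * CW)"
    using CL_nonneg by (simp add: CW_def real_sqrt_mult mult.assoc)
  finally show ?thesis .
qed

lemma series_bound:
  assumes k: "k \<in> {-pi..pi}" and \<alpha>: "0 < \<alpha>" "\<alpha> \<le> 1" and S: "\<And>m. \<bar>\<sigma> m\<bar> \<le> S"
  shows "summable (\<lambda>m. b m k * of_real (\<sigma> m) * wm \<alpha> m k)"
    and "norm (\<Sum>m. b m k * of_real (\<sigma> m) * wm \<alpha> m k) \<le> S * (\<bar>k\<bar> * CW)"
proof -
  let ?f = "\<lambda>m. b m k * of_real (\<sigma> m) * wm \<alpha> m k"
  have sn: "summable (\<lambda>m. norm (?f m))"
    by (rule summableI_nonneg_bounded[OF _ partial_series_bound[OF k \<alpha> S]]) simp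
  then show "summable ?f" by (rule summable_norm_cancel)
  have "norm (suminf ?f) \<le> (\<Sum>m. norm (?f m))" by (rule summable_norm[OF sn])
  also have "\<dots> \<le> S * (\<bar>k\<bar> * CW)"
    by (rule suminf_le_const[OF sn partial_series_bound[OF k \<alpha> S]])
  finally show "norm (suminf ?f) \<le> S * (\<bar>k\<bar> * CW)" .
qed

lemma sK_bound: "0 < \<alpha> \<Longrightarrow> \<bar>sK \<alpha> w\<bar> \<le> 2 * M"
proof -
  assume \<alpha>: "0 < \<alpha>"
  have "norm (sK \<alpha> w) \<le> M * (1 - (-1))"
    unfolding sK_def
  proof (rule integral_bound)
    show "continuous_on {-1..1} (\<lambda>t. K t * cos (w * t / \<alpha>))" using \<alpha> by (intro continuous_intros K_cont) auto
    fix t :: real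
    show "norm (K t * cos (w * t / \<alpha>)) \<le> M"
      using mult_mono[OF K_bound[of t] abs_cos_le_one[of "w * t / \<alpha>"] M_nonneg] by (simp add: abs_mult)
  qed simp
  then show ?thesis by simp
qed

text \<open>The cosine is the real part of exp(2 pi i y) at y = t / \<beta> with \<beta> = 2 pi
  \<alpha> / w. That exponential is 1-periodic with mean zero, so the oscillatory bound applies at
  scale \<beta> with \<zeta> = 0.\<close>

lemma sK_decay:
  assumes "0 < \<alpha>" "0 < w"
  shows "\<bar>sK \<alpha> w\<bar> \<le> 2 * M * (2 * pi) ^ q * (\<alpha> / w) ^ q"
proof -
  let ?g = "\<lambda>y::real. exp (\<i> * of_real (2 * pi * y))" and ?\<beta> = "2 * pi * \<alpha> / w"
  have ii: "(\<lambda>t. of_real (nderiv 0 K t) * exp (\<i> * 0 * of_real t) * ?g (t / ?\<beta>)) integrable_on {-1..1}"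
    unfolding nderiv_0 using assms by (intro integrable_continuous_interval continuous_intros K_cont) auto
  have "norm (integral {-1..1} (\<lambda>t. of_real (nderiv 0 K t) * exp (\<i> * 0 * of_real t) * ?g (t / ?\<beta>)))
     \<le> 2 * M * exp 0 * 1 * ((1 + 0) * ?\<beta>) ^ q"
  proof (rule oscillatory_bound[OF kd])
    show "continuous_on UNIV ?g" by (intro continuous_intros)
    show "?g (y + 1) = ?g y" for y
    proof -
      have "\<i> * of_real (2 * pi * (y + 1)) = \<i> * of_real (2 * pi * y) + 2 * of_real pi * \<i>"
        by (simp add: algebra_simps)
      then show ?thesis by (simp only: exp_add exp_two_pi_i mult_1_right)
    qed
    show "norm (?g y) \<le> 1" for y by simp
  qed (use assms exp_2pi_mean in auto)
  moreover have "sK \<alpha> w = Re (integral {-1..1} (\<lambda>t. of_real (nderiv 0 K t) * exp (\<i> * 0 * of_real t) * ?g (t / ?\<beta>)))"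
  proof -
    have "Re (integral {-1..1} (\<lambda>t. of_real (nderiv 0 K t) * exp (\<i> * 0 * of_real t) * ?g (t / ?\<beta>)))
      = integral {-1..1} (\<lambda>t. Re (of_real (nderiv 0 K t) * exp (\<i> * 0 * of_real t) * ?g (t / ?\<beta>)))"
      using integral_linear[OF ii bounded_linear_Re] by (simp add: o_def)
    also have "\<dots> = sK \<alpha> w"
      unfolding sK_def using assms by (intro integral_cong) (simp add: nderiv_0 Re_exp mult.commute)
    finally show ?thesis by simp
  qed
  ultimately show ?thesis
    using abs_Re_le_cmod order_trans by (fastforce simp: power_mult_distrib power_divide)
qed

lemma sK_cont:
  assumes "0 < \<alpha>" shows "continuous_on UNIV (sK \<alpha>)"
proof -
  have "continuous_on (UNIV \<times> cbox (-1) 1) (\<lambda>(w, t). K t * cos (w * t / \<alpha>))"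
    unfolding case_prod_unfold using assms
    by (intro continuous_intros continuous_on_compose2[OF K_cont[of UNIV]]) auto
  from integral_continuous_on_param[OF this] show ?thesis by (simp add: sK_def[abs_def])
qed

end

section \<open>The spectral gap near zero\<close>

lemma wn2_diff_le:
  assumes "cI a" "cI f" "cI g" "\<And>y. 0 \<le> a y"
  shows "wn2 a (\<lambda>y. f y - g y) \<le> 2 * wn2 a f + 2 * wn2 a g"
proof -
  have "wn2 a (\<lambda>y. f y - g y) \<le> integral {-1/2..1/2} (\<lambda>y. 2 * (a y * (norm (f y))\<^sup>2) + 2 * (a y * (norm (g y))\<^sup>2))"
    unfolding wn2_def
  proof (rule integral_le)
    show "(\<lambda>y. a y * (norm (f y - g y))\<^sup>2) integrable_on {-1/2..1/2}"
      "(\<lambda>y. 2 * (a y * (norm (f y))\<^sup>2) + 2 * (a y * (norm (g y))\<^sup>2)) integrable_on {-1/2..1/2}"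
      by (intro integrable_continuous_interval continuous_intros assms)+
    fix y
    have "(norm (f y - g y))\<^sup>2 \<le> (norm (f y) + norm (g y))\<^sup>2"
      by (intro power_mono norm_triangle_ineq4) simp
    also have "\<dots> \<le> 2 * (norm (f y))\<^sup>2 + 2 * (norm (g y))\<^sup>2"
      using sum_squares_bound[of "norm (f y)" "norm (g y)"] by (simp add: power2_sum)
    finally have "a y * (norm (f y - g y))\<^sup>2 \<le> a y * (2 * (norm (f y))\<^sup>2 + 2 * (norm (g y))\<^sup>2)"
      by (intro mult_left_mono assms)
    then show "a y * (norm (f y - g y))\<^sup>2 \<le> 2 * (a y * (norm (f y))\<^sup>2) + 2 * (a y * (norm (g y))\<^sup>2)"
      by (simp add: algebra_simps)
  qed
  also have "\<dots> = 2 * wn2 a f + 2 * wn2 a g"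
    unfolding wn2_def
    by (simp only: integral_add[OF integrable_on_mult_right[OF wn2_integrable[OF assms(1,2)]]
          integrable_on_mult_right[OF wn2_integrable[OF assms(1,3)]]] integral_mult_right)
  finally show ?thesis .
qed

lemma wn2_mono:
  assumes "cI a" "cI a'" "cI f" "\<And>y. a y \<le> c * a' y"
  shows "wn2 a f \<le> c * wn2 a' f"
proof -
  have "wn2 a f \<le> integral {-1/2..1/2} (\<lambda>y. c * (a' y * (norm (f y))\<^sup>2))"
    unfolding wn2_def
  proof (rule integral_le)
    fix y show "a y * (norm (f y))\<^sup>2 \<le> c * (a' y * (norm (f y))\<^sup>2)"
      using mult_right_mono[OF assms(4)[of y], of "(norm (f y))\<^sup>2"] by (simp add: mult.assoc)
  qed (intro integrable_continuous_interval continuous_intros assms)+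
  then show ?thesis by (simp add: wn2_def)
qed

lemma wn2_scale: "wn2 a (\<lambda>y. c * f y) = (norm c)\<^sup>2 * wn2 a f"
proof -
  have "(\<lambda>y. a y * (norm (c * f y))\<^sup>2) = (\<lambda>y. (norm c)\<^sup>2 * (a y * (norm (f y))\<^sup>2))"
    by (simp add: norm_mult power_mult_distrib mult.left_commute)
  then show ?thesis unfolding wn2_def by (simp only: integral_mult_right)
qed

text \<open>A mean-zero function is at each point the average of its increments, and these are
  bounded by the L1 norm of the derivative. The constant 1 is not sharp but suffices for a spectral
  gap.\<close>

lemma Poincare_mean_zero:
  assumes u: "cper u" and mean: "integral {-1/2..1/2} u = 0"
  shows "wn2 (\<lambda>_. 1) u \<le> wn2 (\<lambda>_. 1) (\<lambda>y. vector_derivative u (at y))"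
proof -
  let ?u' = "\<lambda>y. vector_derivative u (at y)"
  let ?D = "integral {-1/2..1/2} (\<lambda>y. norm (?u' y))"
  have c: "continuous_on S u" "continuous_on S ?u'" for S using cper_cont[OF u] cper_deriv_cont[OF u] by auto
  have D2: "?D \<le> sqrt (wn2 (\<lambda>_. 1) ?u')"
    using wip_Cauchy_Schwarz_abs[of "\<lambda>_. 1" "\<lambda>_. 1" ?u'] c(2) by (simp add: wn2_def)
  have le: "norm (u y - u x) \<le> ?D" if xy: "x \<in> {-1/2..1/2}" "y \<in> {-1/2..1/2}" "x \<le> y" for x y
  proof -
    have "(?u' has_integral (u y - u x)) {x..y}"
      using xy(3) by (rule fundamental_theorem_of_calculus[OF _ has_vector_derivative_at_within[OF cper_deriv[OF u]]])
    then have "norm (u y - u x) = norm (integral {x..y} ?u')" by (simp add: has_integral_iff)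
    also have "\<dots> \<le> integral {x..y} (\<lambda>y. norm (?u' y))"
      by (intro integral_norm_bound_integral integrable_continuous_interval continuous_intros c) auto
    also have "\<dots> \<le> ?D"
      using xy by (intro integral_subset_le integrable_continuous_interval continuous_intros c) auto
    finally show ?thesis .
  qed
  have le': "norm (u y - u x) \<le> ?D" if xy: "x \<in> {-1/2..1/2}" "y \<in> {-1/2..1/2}" for x y
    using le[OF xy] le[OF xy(2,1)] by (cases "x \<le> y") (auto simp: norm_minus_commute)
  have b: "norm (u y) \<le> ?D" if y: "y \<in> {-1/2..1/2}" for y
  proof -
    have "u y = integral {-1/2..1/2} (\<lambda>x. u y - u x)"
      using mean by (simp add: integral_diff integrable_continuous_interval c)
    also have "norm \<dots> \<le> ?D * (1/2 - (-1/2))"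
      by (intro integral_bound continuous_on_diff continuous_on_const c le' y) auto
    finally show ?thesis by simp
  qed
  have "wn2 (\<lambda>_. 1) u \<le> integral {-1/2..1/2} (\<lambda>_::real. ?D\<^sup>2)"
    unfolding wn2_def
  proof (rule integral_le)
    show "(\<lambda>y. 1 * (norm (u y))\<^sup>2) integrable_on {-1/2..1/2}"
      by (intro integrable_continuous_interval continuous_intros c)
  qed (use b in \<open>auto intro!: power_mono\<close>)
  also have "\<dots> = ?D\<^sup>2" by simp
  also have "\<dots> \<le> (sqrt (wn2 (\<lambda>_. 1) ?u'))\<^sup>2"
  proof (rule power_mono[OF D2])
    show "0 \<le> ?D" using order_trans[OF norm_ge_zero b[of 0]] by simp
  qed
  also have "\<dots> = wn2 (\<lambda>_. 1) ?u'"
    using wn2_nonneg[of "\<lambda>_. 1" ?u'] c(2) by simp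
  finally show ?thesis .
qed

context bloch
begin

lemma amax_ex: "\<exists>c>0. \<forall>y. a y \<le> c"
proof -
  have "bounded (a ` {-1/2..1/2})"
    by (intro compact_imp_bounded compact_continuous_image a_cont) simp
  then obtain c where c: "\<forall>y\<in>a ` {-1/2..1/2}. norm y \<le> c" unfolding bounded_iff by blast
  have "a y \<le> c" for y
  proof -
    obtain x where "x \<in> {-1/2..1/2}" "a y = a x" using periodic_reduce[of a y] a_per by metis
    then have "norm (a y) \<le> c" using c by (metis image_eqI)
    then show ?thesis by simp
  qed
  moreover from this have "0 < c" using less_le_trans[OF a_pos] by blast
  ultimately show ?thesis by blast
qed

definition amax :: real where "amax = (SOME c. 0 < c \<and> (\<forall>y. a y \<le> c))"

lemma amax: "0 < amax" "a y \<le> amax"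
  using someI_ex[of "\<lambda>c. 0 < c \<and> (\<forall>y. a y \<le> c)"] amax_ex unfolding amax_def by auto

lemma wn2_le_n2: "cI f \<Longrightarrow> wn2 a f \<le> amax * n2 f"
  by (rule wn2_mono) (auto intro: a_cont amax)

lemma n2_le_wn2: "cI f \<Longrightarrow> amin * n2 f \<le> wn2 a f"
proof -
  assume f: "cI f"
  have "n2 f \<le> (1 / amin) * wn2 a f"
  proof (rule wn2_mono[OF continuous_on_const a_cont f])
    show "1 \<le> 1 / amin * a y" for y using amin(1) amin(2)[of y] by (simp add: field_simps)
  qed
  then show ?thesis using amin by (simp add: field_simps)
qed

lemma ev_mono:
  assumes k: "k \<in> {-pi..pi}" and "m \<le> n" shows "ev m k \<le> ev n k"
proof -
  have "\<forall>m. ev m k \<le> ev (Suc m) k" using bloch k unfolding bloch_waves_def by blast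
  then show ?thesis by (intro lift_Suc_mono_le[of "\<lambda>m. ev m k", OF _ assms(2)]) simp
qed

lemma \<omega>_nonneg: "k \<in> {-pi..pi} \<Longrightarrow> 0 \<le> \<omega> m k"
  using bloch unfolding bloch_waves_def by blast

lemma n2_one_minus_comb:
  assumes k: "k \<in> {-pi..pi}"
  shows "n2 (\<lambda>y. 1 - comb (\<lambda>m. b m k) N k y) = 1 - (\<Sum>m<N. (norm (b m k))\<^sup>2)"
proof -
  let ?P = "comb (\<lambda>m. b m k) N k"
  have Pc: "cI ?P" by (intro cper_cont comb_cper k)
  have c1: "cI (\<lambda>y. 1 - ?P y)" by (intro continuous_intros Pc)
  have "complex_of_real (n2 (\<lambda>y. 1 - ?P y)) = ip (\<lambda>y. 1 - ?P y) (\<lambda>y. 1 - ?P y)"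
    by (rule wip_self[symmetric, OF continuous_on_const c1])
  also have "\<dots> = ip (\<lambda>_. 1) (\<lambda>_. 1) - ip (\<lambda>_. 1) ?P - (ip ?P (\<lambda>_. 1) - ip ?P ?P)"
    by (simp only: wip_diff_left[OF continuous_on_const continuous_on_const Pc c1]
        wip_diff_right[OF continuous_on_const continuous_on_const continuous_on_const Pc]
        wip_diff_right[OF continuous_on_const Pc continuous_on_const Pc])
  also have "ip (\<lambda>_. 1) (\<lambda>_. 1) = 1" by (simp add: wip_def)
  also have "ip ?P ?P = of_real (n2 ?P)" by (rule wip_self[OF continuous_on_const Pc])
  also have "n2 ?P = (\<Sum>m<N. (norm (b m k))\<^sup>2)" by (rule n2_comb[OF k])
  also have "ip ?P (\<lambda>_. 1) = (\<Sum>m<N. b m k * cnj (b m k))"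
    by (simp add: ip_comb[OF k] ip_\<phi>_one[OF k])
  also have "\<dots> = of_real (\<Sum>m<N. (norm (b m k))\<^sup>2)"
    by (simp only: of_real_sum complex_norm_square)
  also have "ip (\<lambda>_. 1) ?P = cnj (ip ?P (\<lambda>_. 1))" by (rule wip_cnj)
  also have "ip ?P (\<lambda>_. 1) = of_real (\<Sum>m<N. (norm (b m k))\<^sup>2)"
    by (simp only: of_real_sum complex_norm_square ip_comb[OF k continuous_on_const] ip_\<phi>_one[OF k])
  finally have "complex_of_real (n2 (\<lambda>y. 1 - ?P y)) = of_real (1 - (\<Sum>m<N. (norm (b m k))\<^sup>2))" by simp
  then show ?thesis by (simp only: of_real_eq_iff)
qed

text \<open>Completeness of the basis, applied to the constant function 1 and moved from Lebesgue
  norms on the open interval to \<open>n2\<close>.\<close>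

lemma n2_one_minus_comb_tendsto:
  assumes k: "k \<in> {-pi..pi}"
  shows "(\<lambda>N. n2 (\<lambda>y. 1 - comb (\<lambda>m. b m k) N k y)) \<longlonglongrightarrow> 0"
proof -
  have "in_L2 {-1/2<..<1/2} (\<lambda>_. 1)"
  proof -
    have "(\<lambda>x::real. (1::real)) absolutely_integrable_on {-1/2..1/2}"
      by (intro absolutely_integrable_continuous_real continuous_on_const)
    then have "set_integrable lebesgue {-1/2<..<1/2} (\<lambda>x::real. (1::real))"
      by (rule set_integrable_subset) auto
    then have "integrable (lebesgue_on {-1/2<..<1/2}) (\<lambda>x::real. (1::real))"
      by (subst integrable_restrict_space) (auto simp: set_integrable_def)
    then show ?thesis by (simp add: in_L2_def)
  qed
  moreover have "\<forall>f. in_L2 {-1/2<..<1/2} f \<longrightarrow>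
        (\<lambda>N. L2_norm_on {-1/2<..<1/2} (\<lambda>x. f x - (\<Sum>m<N. L2_inner_on {-1/2<..<1/2} f (\<phi> m k) * \<phi> m k x))) \<longlonglongrightarrow> 0"
    using bloch k unfolding bloch_waves_def orthonormal_basis_L2_def by blast
  ultimately have "(\<lambda>N. L2_norm_on {-1/2<..<1/2} (\<lambda>x. 1 - (\<Sum>m<N. L2_inner_on {-1/2<..<1/2} (\<lambda>_. 1) (\<phi> m k) * \<phi> m k x))) \<longlonglongrightarrow> 0"
    by blast
  moreover have "(\<lambda>x. 1 - (\<Sum>m<N. L2_inner_on {-1/2<..<1/2} (\<lambda>_. 1) (\<phi> m k) * \<phi> m k x)) = (\<lambda>y. 1 - comb (\<lambda>m. b m k) N k y)" for N
    unfolding comb_def b_eq[OF k] by (subst L2_inner_on_eq_wip[OF continuous_on_const \<phi>_cont[OF k]]) (rule refl)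
  moreover have "L2_norm_on {-1/2<..<1/2} (\<lambda>y. 1 - comb (\<lambda>m. b m k) N k y) = sqrt (n2 (\<lambda>y. 1 - comb (\<lambda>m. b m k) N k y))" for N
    by (intro L2_norm_on_eq_wn2 continuous_intros cper_cont comb_cper k)
  ultimately have "(\<lambda>N. sqrt (n2 (\<lambda>y. 1 - comb (\<lambda>m. b m k) N k y))) \<longlonglongrightarrow> 0" by simp
  from tendsto_power[OF this, of 2] show ?thesis
    by (simp add: wn2_nonneg[OF continuous_on_const continuous_on_diff[OF continuous_on_const cper_cont[OF comb_cper[OF k]]]])
qed

lemma b_Bessel:
  assumes k: "k \<in> {-pi..pi}" shows "(\<Sum>m<N. (norm (b m k))\<^sup>2) \<le> 1"
  using n2_one_minus_comb[OF k, of N]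
    wn2_nonneg[OF continuous_on_const continuous_on_diff[OF continuous_on_const cper_cont[OF comb_cper[OF k]]], of 1 1]
  by (metis diff_ge_0_iff_ge zero_le_one)

text \<open>The squares |b_m|^2 sum to 1 by completeness, so the lowest eigenvalue is at most the
  weighted mean of all eigenvalues, which is the energy sum bounded above.\<close>

lemma ev0_bound:
  assumes k: "k \<in> {-pi..pi}" shows "ev 0 k \<le> k\<^sup>2 * amean"
proof -
  have "(\<lambda>N. 1 - n2 (\<lambda>y. 1 - comb (\<lambda>m. b m k) N k y)) \<longlonglongrightarrow> 1 - 0"
    by (intro tendsto_intros n2_one_minus_comb_tendsto k)
  then have "(\<lambda>N. \<Sum>m<N. (norm (b m k))\<^sup>2) \<longlonglongrightarrow> 1"
    by (simp add: n2_one_minus_comb[OF k])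
  then have "(\<lambda>N. ev 0 k * (\<Sum>m<N. (norm (b m k))\<^sup>2)) \<longlonglongrightarrow> ev 0 k * 1"
    by (intro tendsto_intros)
  moreover have "ev 0 k * (\<Sum>m<N. (norm (b m k))\<^sup>2) \<le> k\<^sup>2 * amean" for N
  proof -
    have "ev 0 k * (\<Sum>m<N. (norm (b m k))\<^sup>2) \<le> (\<Sum>m<N. ev m k * (norm (b m k))\<^sup>2)"
      unfolding sum_distrib_left by (intro sum_mono mult_right_mono ev_mono k) auto
    then show ?thesis using energy_b_bound[OF k, of N] by linarith
  qed
  ultimately show ?thesis by (intro LIMSEQ_le_const2[where X = "\<lambda>N. ev 0 k * (\<Sum>m<N. (norm (b m k))\<^sup>2)"]) auto
qed

text \<open>Some combination of \<open>\<psi>\<^sub>0\<close> and \<open>\<psi>\<^sub>m\<close> has mean zero; Poincare's inequality bounds its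
  energy, hence \<open>\<omega>\<^sub>m\<^sup>2\<close>, from below.\<close>

lemma spectral_gap:
  assumes k: "\<bar>k\<bar> \<le> 1/4" and m: "1 \<le> m"
  shows "amin / 4 \<le> ev m k"
proof -
  have kp: "k \<in> {-pi..pi}" using k pi_gt3 by auto
  obtain c0 cm :: complex where c: "(c0, cm) \<noteq> (0, 0)" "c0 * cnj (b 0 k) + cm * cnj (b m k) = 0"
  proof (cases "b 0 k = 0")
    case True then show ?thesis using that[of 1 0] by simp
  next
    case False then show ?thesis using that[of "cnj (b m k)" "- cnj (b 0 k)"] by simp
  qed
  define c where "c = (\<lambda>j. if j = 0 then c0 else if j = m then cm else 0)"
  define u where "u = comb c (Suc m) k"
  have split: "(\<Sum>j<Suc m. F j) = F 0 + F m" if "\<And>j. c j = 0 \<Longrightarrow> F j = 0" for F :: "nat \<Rightarrow> 'z::comm_monoid_add"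
  proof -
    have "(\<Sum>j<Suc m. F j) = (\<Sum>j\<in>{0, m}. F j)"
      by (rule sum.mono_neutral_right) (auto intro!: that simp: c_def split: if_splits)
    then show ?thesis using m by simp
  qed
  have uc: "cper u" unfolding u_def by (rule comb_cper[OF kp])
  have c0: "c 0 = c0" "c m = cm" using m by (auto simp: c_def)
  define s where "s = (norm c0)\<^sup>2 + (norm cm)\<^sup>2"
  have s: "0 < s" using c(1) by (auto simp: s_def add_pos_nonneg add_nonneg_pos)
  have n2u: "n2 u = s"
    unfolding u_def n2_comb[OF kp] s_def by (subst split) (auto simp: c0)
  have "wn2 a (shifted_deriv k u) = ev 0 k * (norm c0)\<^sup>2 + ev m k * (norm cm)\<^sup>2"
    unfolding u_def energy_comb[OF kp] by (subst split) (auto simp: c0)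
  also have "\<dots> \<le> ev m k * (norm c0)\<^sup>2 + ev m k * (norm cm)\<^sup>2"
    by (intro add_mono mult_right_mono ev_mono kp) auto
  finally have en: "wn2 a (shifted_deriv k u) \<le> ev m k * s" by (simp add: s_def algebra_simps)
  have "integral {-1/2..1/2} u = ip u (\<lambda>_. 1)" by (simp add: wip_def)
  also have "\<dots> = (\<Sum>j<Suc m. c j * cnj (b j k))"
    unfolding u_def by (simp only: ip_comb[OF kp continuous_on_const] ip_\<phi>_one[OF kp])
  also have "\<dots> = 0" using c(2) by (subst split) (auto simp: c0)
  finally have mean: "integral {-1/2..1/2} u = 0" .
  have "n2 u \<le> n2 (\<lambda>y. vector_derivative u (at y))" by (rule Poincare_mean_zero[OF uc mean])
  also have "(\<lambda>y. vector_derivative u (at y)) = (\<lambda>y. shifted_deriv k u y - (\<i> * of_real k) * u y)"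
    by (simp add: shifted_deriv_def)
  also have "n2 \<dots> \<le> 2 * n2 (shifted_deriv k u) + 2 * n2 (\<lambda>y. (\<i> * of_real k) * u y)"
    by (intro wn2_diff_le continuous_intros shifted_deriv_cont[OF uc] cper_cont[OF uc]) simp
  also have "n2 (\<lambda>y. (\<i> * of_real k) * u y) = k\<^sup>2 * n2 u" by (simp only: wn2_scale) (simp add: norm_mult)
  also have "k\<^sup>2 * n2 u \<le> 1/16 * n2 u"
    using power_mono[OF k, of 2] s n2u by (intro mult_right_mono) (auto simp: power2_eq_square)
  \<comment> \<open>The term with k contributes 2 * 1/16 = 1/8 of \<open>n2 u\<close>, absorbed on
    the left; half of the remaining 7/8 is 7/16.\<close>
  finally have "7/16 * s \<le> n2 (shifted_deriv k u)" using n2u by simp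
  then have "amin * (7/16 * s) \<le> amin * n2 (shifted_deriv k u)" using amin by (intro mult_left_mono) auto
  also have "\<dots> \<le> ev m k * s" by (rule order_trans[OF n2_le_wn2[OF shifted_deriv_cont[OF uc]] en])
  finally have "(amin * (7/16)) * s \<le> ev m k * s" by simp
  then have "amin * (7/16) \<le> ev m k" using s by simp
  then show ?thesis using amin by simp
qed

end

section \<open>Continuity in the Bloch parameter\<close>

context bloch
begin

text \<open>The eigenvalue of the resolvent (1 + A_k)^(-1). Unlike the frequencies it stays in a
  compact interval, where polynomial approximation is possible.\<close>

definition xr :: "nat \<Rightarrow> real \<Rightarrow> real" where "xr m k = 1 / (1 + ev m k)"

lemma xr: "0 < xr m k" "xr m k \<le> 1" "xr m k * (1 + ev m k) = 1"
proof -
  have p: "0 < 1 + ev m k" by (simp add: add_pos_nonneg)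
  show "0 < xr m k" "xr m k \<le> 1" "xr m k * (1 + ev m k) = 1"
    using p by (simp_all add: xr_def)
qed

text \<open>The partial sums of \<open>(1 + A\<^sub>k)\<^sup>-\<^sup>j 1\<close>, where \<open>A\<^sub>k\<close> is the Bloch operator.\<close>

definition res :: "nat \<Rightarrow> nat \<Rightarrow> real \<Rightarrow> real \<Rightarrow> complex" where
  "res j N k = comb (\<lambda>m. b m k * of_real (xr m k ^ j)) N k"

lemma res_cper: "k \<in> {-pi..pi} \<Longrightarrow> cper (res j N k)"
  unfolding res_def by (rule comb_cper)

lemma res_0: "res 0 N k = comb (\<lambda>m. b m k) N k"
  by (simp add: res_def)

text \<open>The weak form of (1 + A_k) u_(j+1) = u_j, where u_j is the j-th resolvent power applied
  to the truncated 1. It mentions eigenfunctions only through these combinations, so solutions at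
  different k can be compared.\<close>

lemma res_weak:
  assumes k: "k \<in> {-pi..pi}" and v: "cper v"
  shows "ip (res (Suc j) N k) v + wip a (shifted_deriv k (res (Suc j) N k)) (shifted_deriv k v) = ip (res j N k) v"
proof -
  have t: "b m k * of_real (xr m k ^ Suc j) * z + b m k * of_real (xr m k ^ Suc j) * of_real (ev m k) * z
      = b m k * of_real (xr m k ^ j) * z" for m z
  proof -
    have "b m k * of_real (xr m k ^ Suc j) * z + b m k * of_real (xr m k ^ Suc j) * of_real (ev m k) * z
      = b m k * of_real (xr m k ^ j) * z * of_real (xr m k * (1 + ev m k))"
      by (simp add: algebra_simps)
    then show ?thesis by (simp only: xr(3) of_real_1 mult_1_right)
  qed
  show ?thesis
    unfolding res_def ip_comb[OF k cper_cont[OF v]] comb_weak[OF k v]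
    by (simp only: sum.distrib[symmetric] t)
qed

lemma n2_res: 
  assumes k: "k \<in> {-pi..pi}" shows "n2 (res j N k) \<le> 1"
proof -
  have "n2 (res j N k) = (\<Sum>m<N. (norm (b m k))\<^sup>2 * ((xr m k ^ j))\<^sup>2)"
    unfolding res_def n2_comb[OF k] by (simp add: norm_mult power_mult_distrib norm_power abs_of_pos[OF xr(1)])
  also have "\<dots> \<le> (\<Sum>m<N. (norm (b m k))\<^sup>2 * 1)"
    using xr by (intro sum_mono mult_left_mono power_le_one) (auto simp: less_imp_le)
  also have "\<dots> \<le> 1" using b_Bessel[OF k, of N] by simp
  finally show ?thesis .
qed

lemma energy_res:
  assumes k: "k \<in> {-pi..pi}" shows "wn2 a (shifted_deriv k (res j N k)) \<le> pi\<^sup>2 * amean"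
proof -
  have "wn2 a (shifted_deriv k (res j N k)) = (\<Sum>m<N. (ev m k * (norm (b m k))\<^sup>2) * ((xr m k ^ j))\<^sup>2)"
    unfolding res_def energy_comb[OF k] by (simp add: norm_mult power_mult_distrib norm_power abs_of_pos[OF xr(1)] mult.assoc)
  also have "\<dots> \<le> (\<Sum>m<N. (ev m k * (norm (b m k))\<^sup>2) * 1)"
    using xr by (intro sum_mono mult_left_mono power_le_one) (auto simp: less_imp_le)
  also have "\<dots> \<le> k\<^sup>2 * amean" using energy_b_bound[OF k, of N] by simp
  also have "\<dots> \<le> pi\<^sup>2 * amean"
  proof (rule mult_right_mono[OF _ amean_nonneg])
    show "k\<^sup>2 \<le> pi\<^sup>2" using k by (intro abs_le_square_iff[THEN iffD1]) auto
  qed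
  finally show ?thesis .
qed

definition CA :: real where "CA = sqrt amax + sqrt (pi\<^sup>2 * amean) * sqrt amax"

lemma CA_nonneg: "0 \<le> CA" by (simp add: CA_def amean_nonneg amax less_imp_le)

lemma shifted_deriv_shift: "shifted_deriv k f y = shifted_deriv l f y + \<i> * of_real (k - l) * f y"
  by (simp add: shifted_deriv_def algebra_simps)

definition rd :: "nat \<Rightarrow> nat \<Rightarrow> real \<Rightarrow> real \<Rightarrow> real \<Rightarrow> complex" where
  "rd j N k l = (\<lambda>y. res j N k y - res j N l y)"

lemma rd_cper: "k \<in> {-pi..pi} \<Longrightarrow> l \<in> {-pi..pi} \<Longrightarrow> cper (rd j N k l)"
  unfolding rd_def by (intro cper_diff res_cper)

text \<open>The weak equations at k and l are subtracted and tested with the difference itself. The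
  left side is the square of its full energy norm, the right side at most that norm times the bound,
  so one factor cancels. Keeping the energy, and not just the L2 part, matters because the averaging
  functional is controlled by energy.\<close>

lemma res_diff_step:
  assumes k: "k \<in> {-pi..pi}" and l: "l \<in> {-pi..pi}"
  shows "sqrt (n2 (rd (Suc j) N k l) + wn2 a (shifted_deriv k (rd (Suc j) N k l)))
     \<le> sqrt (n2 (rd j N k l)) + \<bar>k - l\<bar> * CA"
proof -
  let ?d = "rd (Suc j) N k l" and ?u = "res (Suc j) N k" and ?u' = "res (Suc j) N l"
  let ?\<delta> = "\<i> * of_real (k - l)"
  let ?D = "shifted_deriv k" and ?D' = "shifted_deriv l"
  define X where "X = sqrt (n2 ?d + wn2 a (?D ?d))"
  note dcp = rd_cper[OF k l]
  have dc: "cI ?d" "cI (?D ?d)" "cI (?D' ?d)" by (intro cper_cont shifted_deriv_cont dcp)+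
  have u'c: "cI ?u'" "cI (?D ?u')" "cI (?D' ?u')" by (intro cper_cont shifted_deriv_cont res_cper l)+
  have uc: "cI ?u" "cI (?D ?u)" by (intro cper_cont shifted_deriv_cont res_cper k)+
  have jc: "cI (res j N k)" "cI (res j N l)" "cI (rd j N k l)" by (intro cper_cont res_cper rd_cper k l)+
  have nn: "0 \<le> n2 ?d" "0 \<le> wn2 a (?D ?d)"
    using wn2_nonneg[OF continuous_on_const dc(1), of 1] wn2_nonneg[OF a_cont dc(2) a_nonneg] by simp_all
  have Dd: "?D ?d = (\<lambda>y. ?D ?u y - ?D ?u' y)"
    unfolding rd_def by (rule shifted_deriv_diff[OF res_cper[OF k] res_cper[OF l]])
  have sh: "?D f = (\<lambda>y. ?D' f y + ?\<delta> * f y)" for f by (rule ext) (rule shifted_deriv_shift)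
  \<comment> \<open>What remains after replacing the shifted derivatives at k by those at l in the
    energy form: two terms, each carrying a factor k - l.\<close>
  define R where "R = ?\<delta> * wip a ?u' (?D ?d) + cnj ?\<delta> * wip a (?D' ?u') ?d"
  have "of_real (n2 ?d + wn2 a (?D ?d)) = ip ?d ?d + wip a (?D ?d) (?D ?d)"
    by (simp add: wip_self[OF continuous_on_const dc(1), symmetric] wip_self[OF a_cont dc(2), symmetric])
  also have "ip ?d ?d = ip ?u ?d - ip ?u' ?d"
    using wip_diff_left[OF continuous_on_const uc(1) u'c(1) dc(1)] unfolding rd_def .
  also have "wip a (?D ?d) (?D ?d) = wip a (?D ?u) (?D ?d) - wip a (?D ?u') (?D ?d)"
    using wip_diff_left[OF a_cont uc(2) u'c(2) dc(2)] unfolding Dd[symmetric] .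
  also have "wip a (?D ?u') (?D ?d) = wip a (?D' ?u') (?D' ?d) + R"
  proof -
    have "wip a (?D ?u') (?D ?d) = wip a (?D' ?u') (?D ?d) + wip a (\<lambda>y. ?\<delta> * ?u' y) (?D ?d)"
      unfolding sh[of ?u'] by (intro wip_add_left a_cont continuous_on_mult continuous_on_const u'c dc)
    also have "wip a (?D' ?u') (?D ?d) = wip a (?D' ?u') (?D' ?d) + wip a (?D' ?u') (\<lambda>y. ?\<delta> * ?d y)"
      unfolding sh[of ?d] by (intro wip_add_right a_cont continuous_on_mult continuous_on_const u'c dc)
    finally show ?thesis unfolding wip_scale_left wip_scale_right R_def by simp
  qed
  also have "ip ?u ?d - ip ?u' ?d + (wip a (?D ?u) (?D ?d) - (wip a (?D' ?u') (?D' ?d) + R)) =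
      (ip ?u ?d + wip a (?D ?u) (?D ?d)) - (ip ?u' ?d + wip a (?D' ?u') (?D' ?d)) - R" by simp
  also have "\<dots> = ip (res j N k) ?d - ip (res j N l) ?d - R"
    unfolding res_weak[OF k dcp] res_weak[OF l dcp] ..
  also have "ip (res j N k) ?d - ip (res j N l) ?d = ip (rd j N k l) ?d"
    using wip_diff_left[OF continuous_on_const jc(1,2) dc(1)] unfolding rd_def[of j] by simp
  finally have eq: "of_real (n2 ?d + wn2 a (?D ?d)) = ip (rd j N k l) ?d - R" .
  have X2: "X * X = n2 ?d + wn2 a (?D ?d)" and X0: "0 \<le> X" using nn by (simp_all add: X_def)
  have le: "sqrt (n2 ?d) \<le> X" "sqrt (wn2 a (?D ?d)) \<le> X" using nn by (simp_all add: X_def)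
  have 1: "norm (ip (rd j N k l) ?d) \<le> sqrt (n2 (rd j N k l)) * X"
    using wip_Cauchy_Schwarz[OF continuous_on_const _ jc(3) dc(1), of 1]
      mult_left_mono[OF le(1), of "sqrt (n2 (rd j N k l))"] wn2_nonneg[OF continuous_on_const jc(3), of 1] by simp
  have w1: "sqrt (wn2 a ?u') \<le> sqrt amax"
    by (intro real_sqrt_le_mono order_trans[OF wn2_le_n2[OF u'c(1)]])
      (use n2_res[OF l, of "Suc j" N] amax(1) in simp)
  have w2: "sqrt (wn2 a (?D' ?u')) \<le> sqrt (pi\<^sup>2 * amean)" by (intro real_sqrt_le_mono energy_res l)
  have w3: "sqrt (wn2 a ?d) \<le> sqrt amax * X"
  proof -
    have "sqrt (wn2 a ?d) \<le> sqrt (amax * n2 ?d)" by (intro real_sqrt_le_mono wn2_le_n2 dc)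
    also have "\<dots> \<le> sqrt amax * X" unfolding real_sqrt_mult using le amax(1) by (intro mult_left_mono) auto
    finally show ?thesis .
  qed
  have n\<delta>: "norm ?\<delta> = \<bar>k - l\<bar>" "norm (cnj ?\<delta>) = \<bar>k - l\<bar>" by (simp_all add: norm_mult flip: of_real_diff)
  have R1: "norm (wip a ?u' (?D ?d)) \<le> sqrt amax * X"
    by (rule order_trans[OF wip_Cauchy_Schwarz[OF a_cont a_nonneg u'c(1) dc(2)]])
      (use w1 le nn amax(1) in \<open>intro mult_mono, auto\<close>)
  have R2: "norm (wip a (?D' ?u') ?d) \<le> sqrt (pi\<^sup>2 * amean) * (sqrt amax * X)"
  proof (rule order_trans[OF wip_Cauchy_Schwarz[OF a_cont a_nonneg u'c(3) dc(1)]])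
    show "sqrt (wn2 a (?D' ?u')) * sqrt (wn2 a ?d) \<le> sqrt (pi\<^sup>2 * amean) * (sqrt amax * X)"
      using amean_nonneg wn2_nonneg[OF a_cont dc(1) a_nonneg] by (intro mult_mono w2 w3) auto
  qed
  have "norm R \<le> norm ?\<delta> * norm (wip a ?u' (?D ?d)) + norm (cnj ?\<delta>) * norm (wip a (?D' ?u') ?d)"
    unfolding R_def norm_mult[symmetric] by (rule norm_triangle_ineq)
  also have "\<dots> \<le> \<bar>k - l\<bar> * (sqrt amax * X) + \<bar>k - l\<bar> * (sqrt (pi\<^sup>2 * amean) * (sqrt amax * X))"
    unfolding n\<delta> by (intro add_mono mult_left_mono R1 R2) auto
  also have "\<dots> = \<bar>k - l\<bar> * CA * X" unfolding CA_def by (simp only: distrib_left distrib_right mult.assoc)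
  finally have 2: "norm R \<le> \<bar>k - l\<bar> * CA * X" .
  have "X * X = norm (of_real (n2 ?d + wn2 a (?D ?d)) :: complex)"
    unfolding norm_of_real X2 using nn by simp
  also have "\<dots> \<le> norm (ip (rd j N k l) ?d) + norm R" unfolding eq by (rule norm_triangle_ineq4)
  also have "\<dots> \<le> (sqrt (n2 (rd j N k l)) + \<bar>k - l\<bar> * CA) * X" using 1 2 by (simp add: algebra_simps)
  finally have "X * X \<le> (sqrt (n2 (rd j N k l)) + \<bar>k - l\<bar> * CA) * X" .
  then have "X \<le> sqrt (n2 (rd j N k l)) + \<bar>k - l\<bar> * CA"
    using X0 wn2_nonneg[OF continuous_on_const jc(3), of 1] CA_nonneg
    by (cases "X = 0") (auto simp: mult_le_cancel_right)
  then show ?thesis by (simp add: X_def)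
qed

lemma res_diff_bound:
  assumes k: "k \<in> {-pi..pi}" and l: "l \<in> {-pi..pi}"
  shows "sqrt (n2 (rd j N k l)) \<le> sqrt (n2 (rd 0 N k l)) + real j * (\<bar>k - l\<bar> * CA)"
proof (induction j)
  case (Suc j)
  have "n2 (rd (Suc j) N k l) \<le> n2 (rd (Suc j) N k l) + wn2 a (shifted_deriv k (rd (Suc j) N k l))"
    using wn2_nonneg[OF a_cont shifted_deriv_cont[OF rd_cper[OF k l]] a_nonneg] by simp
  then have "sqrt (n2 (rd (Suc j) N k l)) \<le> sqrt (n2 (rd (Suc j) N k l) + wn2 a (shifted_deriv k (rd (Suc j) N k l)))"
    by (rule real_sqrt_le_mono)
  also note res_diff_step[OF k l]
  finally show ?case using Suc by (simp add: algebra_simps)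
qed simp

text \<open>Both truncations converge to the same function 1, whatever k and l. Eigenvalue crossings
  at the cut-off \<open>N\<close> may make them differ for finite \<open>N\<close>, so an estimate
  by |k - l| alone can be expected only in the limit.\<close>

lemma rd_0_tendsto:
  assumes k: "k \<in> {-pi..pi}" and l: "l \<in> {-pi..pi}"
  shows "(\<lambda>N. sqrt (n2 (rd 0 N k l))) \<longlonglongrightarrow> 0"
proof -
  let ?E = "\<lambda>k N. n2 (\<lambda>y. 1 - comb (\<lambda>m. b m k) N k y)"
  have c: "cI (\<lambda>y. 1 - comb (\<lambda>m. b m k) N k y)" if "k \<in> {-pi..pi}" for N k
    by (intro continuous_on_diff continuous_on_const cper_cont comb_cper that)
  have "(\<lambda>N. 2 * ?E l N + 2 * ?E k N) \<longlonglongrightarrow> 2 * 0 + 2 * 0"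
    by (intro tendsto_intros n2_one_minus_comb_tendsto k l)
  then have 1: "(\<lambda>N. 2 * ?E l N + 2 * ?E k N) \<longlonglongrightarrow> 0" by simp
  have 2: "n2 (rd 0 N k l) \<le> 2 * ?E l N + 2 * ?E k N" for N
  proof -
    have "rd 0 N k l = (\<lambda>y. (1 - comb (\<lambda>m. b m l) N l y) - (1 - comb (\<lambda>m. b m k) N k y))"
      by (simp add: rd_def res_0)
    then show ?thesis
      by (simp only:) (rule wn2_diff_le[OF continuous_on_const c[OF l] c[OF k]], simp)
  qed
  have 3: "0 \<le> n2 (rd 0 N k l)" for N
    by (rule wn2_nonneg[OF continuous_on_const cper_cont[OF rd_cper[OF k l]]]) simp
  have "(\<lambda>N. n2 (rd 0 N k l)) \<longlonglongrightarrow> 0"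
    by (rule tendsto_sandwich[OF always_eventually always_eventually tendsto_const 1]) (use 2 3 in simp_all)
  from tendsto_real_sqrt[OF this] show ?thesis by simp
qed

end

lemma norm_exp_i_diff_le: "norm (exp (\<i> * of_real x) - exp (\<i> * of_real y)) \<le> \<bar>x - y\<bar>" for x y :: real
proof -
  have "norm (exp (\<i> * of_real x) - exp (\<i> * of_real y)) \<le> 1 * norm (x - y)"
  proof (rule differentiable_bound[of UNIV "\<lambda>x::real. exp (\<i> * of_real x)" "\<lambda>x h. h *\<^sub>R (\<i> * exp (\<i> * of_real x))"])
    show "((\<lambda>x. exp (\<i> * of_real x)) has_derivative (\<lambda>h. h *\<^sub>R (\<i> * exp (\<i> * of_real x)))) (at x within UNIV)" for x :: real
    proof -
      have "((\<lambda>z. exp (\<i> * z)) has_field_derivative \<i> * exp (\<i> * of_real x)) (at (of_real x))"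
        by (auto intro!: derivative_eq_intros)
      from has_vector_derivative_real_field[OF this] show ?thesis by (simp add: has_vector_derivative_def)
    qed
    show "onorm (\<lambda>h. h *\<^sub>R (\<i> * exp (\<i> * of_real x))) \<le> 1" for x :: real
      by (rule onorm_bound) (auto simp: norm_mult)
  qed auto
  then show ?thesis by simp
qed

section \<open>Continuity in k of the resolvent series and then of the series for W\<close>

context bloch_kernel
begin

text \<open>The series of W with s_m replaced by the j-th power of the resolvent eigenvalue: the
  average of the flux of (1 + A_k)^(-j) applied to 1.\<close>

definition Sj :: "real \<Rightarrow> nat \<Rightarrow> real \<Rightarrow> complex" where
  "Sj \<alpha> j k = (\<Sum>m. b m k * of_real (xr m k ^ j) * wm \<alpha> m k)"

lemma Sj_summable:
  assumes k: "k \<in> {-pi..pi}" and \<alpha>: "0 < \<alpha>" "\<alpha> \<le> 1"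
  shows "summable (\<lambda>m. b m k * of_real (xr m k ^ j) * wm \<alpha> m k)"
  by (rule series_bound(1)[OF k \<alpha>, of _ 1]) (use xr in \<open>auto simp: power_abs less_imp_le abs_of_pos intro!: power_le_one\<close>)

lemma LK_res: 
  assumes k: "k \<in> {-pi..pi}" and "0 < \<alpha>"
  shows "LK \<alpha> k (\<lambda>y. of_real (a y) * shifted_deriv k (res j N k) y) = (\<Sum>m<N. b m k * of_real (xr m k ^ j) * wm \<alpha> m k)"
  unfolding res_def by (rule LK_D_comb[OF assms])

text \<open>Three sources of change between k and l: the resolvent solution (\<open>P1\<close>), the
  shift in the derivative (\<open>P2\<close>) and the exponential in the average
  (\<open>P3\<close>). One resolvent power is spent on energy control of \<open>P1\<close>, hence
  the exponent \<open>Suc j\<close>.\<close>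

lemma Sj_partial_diff:
  assumes k: "k \<in> {-pi..pi}" and l: "l \<in> {-pi..pi}" and \<alpha>: "0 < \<alpha>" "\<alpha> \<le> 1"
  shows "norm ((\<Sum>m<N. b m k * of_real (xr m k ^ Suc j) * wm \<alpha> m k) - (\<Sum>m<N. b m l * of_real (xr m l ^ Suc j) * wm \<alpha> m l))
     \<le> CL * sqrt (n2 (rd 0 N k l)) + (CL * (real (Suc j) * CA) + CL * sqrt amax + (1 / \<alpha>) * CL * sqrt (pi\<^sup>2 * amean)) * \<bar>k - l\<bar>"
proof -
  let ?d = "rd (Suc j) N k l" and ?u = "res (Suc j) N k" and ?u' = "res (Suc j) N l"
  note dcp = rd_cper[OF k l]
  let ?A = "\<lambda>v. \<lambda>y. of_real (a y) * v y"
  have Dd: "shifted_deriv k ?d = (\<lambda>y. shifted_deriv k ?u y - shifted_deriv k ?u' y)"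
    unfolding rd_def by (rule shifted_deriv_diff[OF res_cper[OF k] res_cper[OF l]])
  have sh: "shifted_deriv k ?u' = (\<lambda>y. shifted_deriv l ?u' y + \<i> * of_real (k - l) * ?u' y)"
    by (rule ext) (rule shifted_deriv_shift)
  have c: "continuous_on UNIV (shifted_deriv k ?u)" "continuous_on UNIV (shifted_deriv k ?u')"
     "continuous_on UNIV (shifted_deriv l ?u')" "continuous_on UNIV ?u'"
    by (intro cper_cont shifted_deriv_cont res_cper k l)+
  define E where "E = (\<lambda>k t. of_real (K t) * exp (\<i> * of_real (k / \<alpha>) * of_real t))"
  have LKE: "LK \<alpha> k g = integral {-1..1} (\<lambda>t. E k t * g (t / \<alpha>))" for k g by (simp only: LK_def E_def)
  have i: "(\<lambda>t. E k t * (of_real (a (t / \<alpha>)) * v (t / \<alpha>))) integrable_on {-1..1}"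
    if "continuous_on UNIV v" for k v
    unfolding E_def using LK_integrable[OF continuous_on_mult[OF continuous_on_of_real[OF a_cont] that] \<alpha>(1)] .
  have 1: "LK \<alpha> k (?A (shifted_deriv k ?d)) = LK \<alpha> k (?A (shifted_deriv k ?u)) - LK \<alpha> k (?A (shifted_deriv k ?u'))"
    unfolding LKE Dd right_diff_distrib by (rule integral_diff[OF i[OF c(1)] i[OF c(2)]])
  have 2: "LK \<alpha> k (?A (shifted_deriv k ?u')) = LK \<alpha> k (?A (shifted_deriv l ?u')) + \<i> * of_real (k - l) * LK \<alpha> k (?A ?u')"
  proof -
    have "(\<lambda>t. E k t * (of_real (a (t / \<alpha>)) * shifted_deriv k ?u' (t / \<alpha>))) =
      (\<lambda>t. E k t * (of_real (a (t / \<alpha>)) * shifted_deriv l ?u' (t / \<alpha>)) + \<i> * of_real (k - l) * (E k t * (of_real (a (t / \<alpha>)) * ?u' (t / \<alpha>))))"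
      unfolding sh by (simp only: distrib_left mult_ac)
    then show ?thesis
      unfolding LKE by (simp only: integral_add[OF i[OF c(3)] integrable_on_mult_right[OF i[OF c(4)]]] integral_mult_right)
  qed
  \<comment> \<open>On the window the two exponentials differ by at most |k - l| / \<alpha>, which
    makes this an admissible weight for \<open>weighted_flux_bound\<close>.\<close>
  define \<kappa> where "\<kappa> = (\<lambda>t. of_real (K t) * (exp (\<i> * of_real (k / \<alpha>) * of_real t) - exp (\<i> * of_real (l / \<alpha>) * of_real t)))"
  have 3: "LK \<alpha> k (?A (shifted_deriv l ?u')) - LK \<alpha> l (?A (shifted_deriv l ?u')) =
      integral {-1..1} (\<lambda>t. \<kappa> t * (of_real (a (t / \<alpha>)) * shifted_deriv l ?u' (t / \<alpha>)))"
  proof -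
    have "\<kappa> t = E k t - E l t" for t unfolding \<kappa>_def E_def by (simp only: right_diff_distrib)
    then show ?thesis
      unfolding LKE by (simp only: left_diff_distrib integral_diff[OF i[OF c(3)] i[OF c(3)]])
  qed
  have b1: "norm (LK \<alpha> k (?A (shifted_deriv k ?d))) \<le> CL * (sqrt (n2 (rd 0 N k l)) + real (Suc j) * (\<bar>k - l\<bar> * CA))"
  proof -
    have "norm (LK \<alpha> k (?A (shifted_deriv k ?d))) \<le> CL * sqrt (wn2 a (shifted_deriv k ?d))"
      by (rule LK_D_bound[OF dcp \<alpha>])
    also have "\<dots> \<le> CL * (sqrt (n2 ?d + wn2 a (shifted_deriv k ?d)))"
      using wn2_nonneg[OF continuous_on_const cper_cont[OF dcp], of 1] by (intro mult_left_mono CL_nonneg) simp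
    also have "\<dots> \<le> CL * (sqrt (n2 (rd j N k l)) + \<bar>k - l\<bar> * CA)"
      by (intro mult_left_mono CL_nonneg res_diff_step k l)
    also have "\<dots> \<le> CL * (sqrt (n2 (rd 0 N k l)) + real (Suc j) * (\<bar>k - l\<bar> * CA))"
      using res_diff_bound[OF k l, of j N] by (intro mult_left_mono CL_nonneg) (simp add: algebra_simps)
    finally show ?thesis .
  qed
  have b2: "norm (\<i> * of_real (k - l) * LK \<alpha> k (?A ?u')) \<le> \<bar>k - l\<bar> * (CL * sqrt amax)"
  proof -
    have "norm (LK \<alpha> k (?A ?u')) \<le> CL * sqrt (wn2 a ?u')"
      by (rule LK_weighted_bound[OF c(4) _ \<alpha>]) (use res_cper[OF l] in \<open>simp add: cper_def\<close>)
    also have "\<dots> \<le> CL * sqrt amax"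
      by (intro mult_left_mono CL_nonneg real_sqrt_le_mono order_trans[OF wn2_le_n2[OF cper_cont[OF res_cper[OF l]]]])
        (use n2_res[OF l, of "Suc j" N] amax(1) in simp)
    finally show ?thesis by (simp add: norm_mult mult_left_mono flip: of_real_diff)
  qed
  have b3: "norm (integral {-1..1} (\<lambda>t. \<kappa> t * (of_real (a (t / \<alpha>)) * shifted_deriv l ?u' (t / \<alpha>)))) \<le> (\<bar>k - l\<bar> / \<alpha>) * CL * sqrt (wn2 a (shifted_deriv l ?u'))"
  proof (rule weighted_flux_bound[OF _ _ _ c(3) shifted_deriv_periodic[OF res_cper[OF l]] \<alpha>])
    show "continuous_on {-1..1} \<kappa>" unfolding \<kappa>_def by (intro continuous_intros K_cont)
    fix t :: real assume t: "t \<in> {-1..1}"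
    have e: "exp (\<i> * of_real (x / \<alpha>) * of_real t) = exp (\<i> * of_real (x * t / \<alpha>))" for x by (simp add: mult.assoc)
    have "norm (exp (\<i> * of_real (k / \<alpha>) * of_real t) - exp (\<i> * of_real (l / \<alpha>) * of_real t)) \<le> \<bar>k * t / \<alpha> - l * t / \<alpha>\<bar>"
      unfolding e by (rule norm_exp_i_diff_le)
    also have "k * t / \<alpha> - l * t / \<alpha> = (k - l) / \<alpha> * t" by (simp add: diff_divide_distrib algebra_simps)
    also have "\<bar>(k - l) / \<alpha> * t\<bar> \<le> \<bar>k - l\<bar> / \<alpha> * 1"
      unfolding abs_mult using t \<alpha> by (intro mult_mono) auto
    finally have n: "norm (exp (\<i> * of_real (k / \<alpha>) * of_real t) - exp (\<i> * of_real (l / \<alpha>) * of_real t)) \<le> \<bar>k - l\<bar> / \<alpha>" by simp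
    have "norm (\<kappa> t) = \<bar>K t\<bar> * norm (exp (\<i> * of_real (k / \<alpha>) * of_real t) - exp (\<i> * of_real (l / \<alpha>) * of_real t))"
      unfolding \<kappa>_def norm_mult by simp
    also have "\<dots> \<le> M * (\<bar>k - l\<bar> / \<alpha>)" by (intro mult_mono n K_bound M_nonneg) simp
    finally show "norm (\<kappa> t) \<le> \<bar>k - l\<bar> / \<alpha> * M" by (simp add: mult.commute)
  qed (use \<alpha> in simp)
  also have "\<dots> \<le> (\<bar>k - l\<bar> / \<alpha>) * CL * sqrt (pi\<^sup>2 * amean)"
    using \<alpha> CL_nonneg by (intro mult_left_mono real_sqrt_le_mono energy_res l) auto
  finally have b3: "norm (integral {-1..1} (\<lambda>t. \<kappa> t * (of_real (a (t / \<alpha>)) * shifted_deriv l ?u' (t / \<alpha>)))) \<le> (\<bar>k - l\<bar> / \<alpha>) * CL * sqrt (pi\<^sup>2 * amean)" .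
  define P1 P2 P3 where "P1 = LK \<alpha> k (?A (shifted_deriv k ?d))" and "P2 = \<i> * of_real (k - l) * LK \<alpha> k (?A ?u')"
    and "P3 = integral {-1..1} (\<lambda>t. \<kappa> t * (of_real (a (t / \<alpha>)) * shifted_deriv l ?u' (t / \<alpha>)))"
  have eq: "(\<Sum>m<N. b m k * of_real (xr m k ^ Suc j) * wm \<alpha> m k) - (\<Sum>m<N. b m l * of_real (xr m l ^ Suc j) * wm \<alpha> m l) = P1 + P2 + P3"
    unfolding LK_res[OF k \<alpha>(1), symmetric] LK_res[OF l \<alpha>(1), symmetric] P1_def P2_def P3_def 3[symmetric]
    using 1 2 by simp
  have "norm (P1 + P2 + P3) \<le> norm P1 + norm P2 + norm P3"
    using norm_triangle_ineq[of "P1 + P2" P3] norm_triangle_ineq[of P1 P2] by linarith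
  also have "\<dots> \<le> CL * (sqrt (n2 (rd 0 N k l)) + real (Suc j) * (\<bar>k - l\<bar> * CA)) + \<bar>k - l\<bar> * (CL * sqrt amax) + (\<bar>k - l\<bar> / \<alpha>) * CL * sqrt (pi\<^sup>2 * amean)"
    unfolding P1_def P2_def P3_def by (rule add_mono[OF add_mono[OF b1 b2] b3])
  also have "\<dots> = CL * sqrt (n2 (rd 0 N k l)) + (CL * (real (Suc j) * CA) + CL * sqrt amax + (1 / \<alpha>) * CL * sqrt (pi\<^sup>2 * amean)) * \<bar>k - l\<bar>"
    by (simp only: distrib_left distrib_right mult_ac divide_inverse mult_1_left add.assoc)
  finally show ?thesis unfolding eq .
qed

text \<open>Letting \<open>N\<close> tend to infinity removes the truncation error of the constant
  1. The constant contains 1/\<alpha>, but only continuity at fixed \<alpha> is drawn from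
  it.\<close>

lemma Sj_Lipschitz:
  assumes k: "k \<in> {-pi..pi}" and l: "l \<in> {-pi..pi}" and \<alpha>: "0 < \<alpha>" "\<alpha> \<le> 1"
  shows "norm (Sj \<alpha> (Suc j) k - Sj \<alpha> (Suc j) l) \<le> (CL * (real (Suc j) * CA) + CL * sqrt amax + (1 / \<alpha>) * CL * sqrt (pi\<^sup>2 * amean)) * \<bar>k - l\<bar>"
    (is "_ \<le> ?C * _")
proof -
  let ?p = "\<lambda>N k. \<Sum>m<N. b m k * of_real (xr m k ^ Suc j) * wm \<alpha> m k"
  have "(\<lambda>N. ?p N k) \<longlonglongrightarrow> Sj \<alpha> (Suc j) k" "(\<lambda>N. ?p N l) \<longlonglongrightarrow> Sj \<alpha> (Suc j) l"
    unfolding Sj_def by (intro summable_LIMSEQ Sj_summable k l \<alpha>)+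
  then have "(\<lambda>N. norm (?p N k - ?p N l)) \<longlonglongrightarrow> norm (Sj \<alpha> (Suc j) k - Sj \<alpha> (Suc j) l)"
    by (intro tendsto_intros)
  moreover have "(\<lambda>N. CL * sqrt (n2 (rd 0 N k l)) + ?C * \<bar>k - l\<bar>) \<longlonglongrightarrow> CL * 0 + ?C * \<bar>k - l\<bar>"
    by (intro tendsto_intros rd_0_tendsto k l)
  ultimately have "norm (Sj \<alpha> (Suc j) k - Sj \<alpha> (Suc j) l) \<le> CL * 0 + ?C * \<bar>k - l\<bar>"
    by (rule LIMSEQ_le) (intro exI[of _ 0] allI impI Sj_partial_diff[OF k l \<alpha>])
  then show ?thesis by simp
qed

lemma Sj_cont:
  assumes \<alpha>: "0 < \<alpha>" "\<alpha> \<le> 1"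
  shows "continuous_on {-pi..pi} (Sj \<alpha> (Suc j))"
proof -
  define C where "C = CL * (real (Suc j) * CA) + CL * sqrt amax + (1 / \<alpha>) * CL * sqrt (pi\<^sup>2 * amean)"
  have C: "0 \<le> C" unfolding C_def using CL_nonneg CA_nonneg amax(1) amean_nonneg \<alpha> by auto
  have "C-lipschitz_on {-pi..pi} (Sj \<alpha> (Suc j))"
    by (rule lipschitz_onI[OF _ C]) (use Sj_Lipschitz[OF _ _ \<alpha>] in \<open>simp add: dist_norm C_def\<close>)
  then show ?thesis by (rule lipschitz_on_continuous_on)
qed

text \<open>s_m as a function of x = 1/(1 + \<omega>^2), so that 1/x - 1 is the squared frequency.
  The value 0 at x = 0 stands for infinite frequency and is the limit there by the decay of
  \<open>sK\<close>.\<close>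

definition HK :: "real \<Rightarrow> real \<Rightarrow> real" where
  "HK \<alpha> x = (if x = 0 then 0 else sK \<alpha> (sqrt (1 / x - 1)))"

lemma HK_xr: "k \<in> {-pi..pi} \<Longrightarrow> HK \<alpha> (xr m k) = sK \<alpha> (\<omega> m k)"
  using xr(1)[of m k] \<omega>_nonneg[of k m] by (simp add: HK_def xr_def)

lemma HK_cont:
  assumes \<alpha>: "0 < \<alpha>" shows "continuous_on {0..1} (HK \<alpha>)"
  unfolding continuous_on_eq_continuous_within
proof
  fix x :: real assume x: "x \<in> {0..1}"
  show "continuous (at x within {0..1}) (HK \<alpha>)"
  proof (cases "x = 0")
    case False
    have "continuous_on {0<..} (\<lambda>x. sK \<alpha> (sqrt (1 / x - 1)))"
      by (intro continuous_on_compose2[OF sK_cont[OF \<alpha>]] continuous_intros) auto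
    then have "isCont (\<lambda>x. sK \<alpha> (sqrt (1 / x - 1))) x"
      using False x by (subst (asm) continuous_on_eq_continuous_at) auto
    moreover have "eventually (\<lambda>y. HK \<alpha> y = sK \<alpha> (sqrt (1 / y - 1))) (nhds x)"
      unfolding eventually_nhds using False x by (intro exI[of _ "{0<..}"]) (auto simp: HK_def)
    ultimately have "isCont (HK \<alpha>) x" by (simp add: isCont_cong)
    then show ?thesis by (rule continuous_at_imp_continuous_at_within)
  next
    case True
    define C where "C = 2 * M * (2 * pi) ^ q"
    have C: "0 \<le> C" using M_nonneg by (simp add: C_def)
    have bnd: "\<bar>HK \<alpha> y\<bar> \<le> C * (\<alpha> * sqrt (2 * y)) ^ q" if y: "0 < y" "y < 1/2" for y
    proof -
      \<comment> \<open>For y below 1/2 the squared frequency is at least 1/(2 y), which turns decay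
        in the frequency into the power (\<alpha> sqrt(2 y))^q; with q \<ge> 1 this tends to
        0.\<close>
      have p: "1 / (2 * y) \<le> 1 / y - 1" using y by (simp add: field_simps)
      then have p1: "1 / sqrt (2 * y) \<le> sqrt (1 / y - 1)" using real_sqrt_le_mono[OF p] by (simp add: real_sqrt_divide)
      have p2: "0 < 1 / sqrt (2 * y)" using y by simp
      have "\<bar>HK \<alpha> y\<bar> \<le> C * (\<alpha> / sqrt (1 / y - 1)) ^ q"
        unfolding HK_def C_def using y sK_decay[OF \<alpha>, of "sqrt (1 / y - 1)"] p1 p2 by auto
      also have "\<dots> \<le> C * (\<alpha> / (1 / sqrt (2 * y))) ^ q"
        using order.strict_trans2[OF p2 p1] p1 p2 \<alpha> C
        by (intro mult_left_mono power_mono divide_left_mono mult_pos_pos divide_nonneg_pos) auto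
      finally show ?thesis by simp
    qed
    have "((\<lambda>y. C * (\<alpha> * sqrt (2 * y)) ^ q) \<longlongrightarrow> C * (\<alpha> * sqrt (2 * 0)) ^ q) (at_right 0)"
      by (intro tendsto_intros)
    then have l: "((\<lambda>y. C * (\<alpha> * sqrt (2 * y)) ^ q) \<longlongrightarrow> 0) (at_right 0)" using q_pos by (simp add: zero_power)
    have "(HK \<alpha> \<longlongrightarrow> 0) (at_right 0)"
    proof (rule Lim_null_comparison[OF _ l])
      show "\<forall>\<^sub>F y in at_right 0. norm (HK \<alpha> y) \<le> C * (\<alpha> * sqrt (2 * y)) ^ q"
        unfolding eventually_at_right_field using bnd by (intro exI[of _ "1/2"]) auto
    qed
    then show ?thesis using True at_within_Icc_at_right[of 0 "1::real"]
      by (simp add: continuous_within HK_def)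
  qed
qed

definition Wsum :: "real \<Rightarrow> real \<Rightarrow> complex" where
  "Wsum \<alpha> k = (\<Sum>m. b m k * of_real (sK \<alpha> (\<omega> m k)) * wm \<alpha> m k)"

lemma Wsum_cont:
  assumes \<alpha>: "0 < \<alpha>" "\<alpha> \<le> 1"
  shows "continuous_on {-pi..pi} (Wsum \<alpha>)"
proof -
  have approx: "\<exists>g. continuous_on {-pi..pi} g \<and> (\<forall>k\<in>{-pi..pi}. norm (g k - Wsum \<alpha> k) \<le> e)" if e: "0 < e" for e
  proof -
    \<comment> \<open>Half of the tolerance per unit of the series bound, since the error below is 2
      \<open>e'\<close>; the + 1 keeps the denominator positive even when \<open>CW\<close> is
      0.\<close>
    define e' where "e' = e / (2 * (pi * CW + 1))"
    have CWp: "0 < pi * CW + 1" using CW_nonneg by (simp add: add_nonneg_pos)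
    have e': "0 < e'" using e CWp by (simp add: e'_def)
    obtain p where p: "real_polynomial_function p" "\<And>x. x \<in> {0..1} \<Longrightarrow> \<bar>HK \<alpha> x - p x\<bar> < e'"
      using Stone_Weierstrass_real_polynomial_function[OF compact_Icc HK_cont[OF \<alpha>(1)] e'] by blast
    obtain c n where pc: "p = (\<lambda>x. \<Sum>i\<le>n. c i * x ^ i)" using p(1) real_polynomial_function_iff_sum by blast
    \<comment> \<open>The constant coefficient is left out because continuity of \<open>Sj\<close>
      is available only for positive powers. As \<open>HK\<close> vanishes at 0, that coefficient is
      itself below \<open>e'\<close>, so the omission at most doubles the error.\<close>
    define g where "g = (\<lambda>k. \<Sum>i\<in>{1..n}. of_real (c i) * Sj \<alpha> i k)"
    have "continuous_on {-pi..pi} (Sj \<alpha> i)" if "i \<in> {1..n}" for i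
      using Sj_cont[OF \<alpha>, of "i - 1"] that by simp
    then have gc: "continuous_on {-pi..pi} g" unfolding g_def by (intro continuous_intros)
    have p0: "p 0 = c 0"
      unfolding pc by (subst sum.remove[of _ 0]) (auto intro!: sum.neutral)
    have "norm (g k - Wsum \<alpha> k) \<le> e" if k: "k \<in> {-pi..pi}" for k
    proof -
      have x: "xr m k \<in> {0..1}" for m using xr[of m k] by auto
      have pq: "(\<Sum>i\<in>{1..n}. c i * xr m k ^ i) = p (xr m k) - c 0" for m
      proof -
        have "{..n} - {0} = {1..n}" by auto
        then show ?thesis unfolding pc by (subst sum.remove[of "{..n}" 0]) auto
      qed
      have "of_real (c i) * Sj \<alpha> i k = (\<Sum>m. of_real (c i) * (b m k * of_real (xr m k ^ i) * wm \<alpha> m k))" for i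
        unfolding Sj_def by (rule suminf_mult[OF Sj_summable[OF k \<alpha>], symmetric])
      then have "g k = (\<Sum>i\<in>{1..n}. \<Sum>m. of_real (c i) * (b m k * of_real (xr m k ^ i) * wm \<alpha> m k))"
        unfolding g_def by simp
      also have "\<dots> = (\<Sum>m. \<Sum>i\<in>{1..n}. of_real (c i) * (b m k * of_real (xr m k ^ i) * wm \<alpha> m k))"
        by (rule suminf_sum[symmetric]) (rule summable_mult[OF Sj_summable[OF k \<alpha>]])
      also have "(\<lambda>m. \<Sum>i\<in>{1..n}. of_real (c i) * (b m k * of_real (xr m k ^ i) * wm \<alpha> m k)) =
          (\<lambda>m. b m k * of_real (p (xr m k) - c 0) * wm \<alpha> m k)"
      proof
        fix m
        have "(\<Sum>i\<in>{1..n}. of_real (c i) * (b m k * of_real (xr m k ^ i) * wm \<alpha> m k)) =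
            b m k * (\<Sum>i\<in>{1..n}. of_real (c i * xr m k ^ i)) * wm \<alpha> m k"
          unfolding sum_distrib_left sum_distrib_right of_real_mult by (intro sum.cong refl) (simp only: mult_ac)
        also have "(\<Sum>i\<in>{1..n}. of_real (c i * xr m k ^ i)) = complex_of_real (p (xr m k) - c 0)"
          by (simp only: pq[symmetric] of_real_sum)
        finally show "(\<Sum>i\<in>{1..n}. of_real (c i) * (b m k * of_real (xr m k ^ i) * wm \<alpha> m k)) =
            b m k * of_real (p (xr m k) - c 0) * wm \<alpha> m k" .
      qed
      finally have ge: "g k = (\<Sum>m. b m k * of_real (p (xr m k) - c 0) * wm \<alpha> m k)" .
      have d1: "\<bar>(p (xr m k) - c 0) - HK \<alpha> (xr m k)\<bar> \<le> 2 * e'" for m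
        using p(2)[OF x[of m]] p(2)[of 0] p0 by (simp add: HK_def[of _ 0] abs_if split: if_splits)
      have pb: "\<bar>HK \<alpha> (xr m k)\<bar> \<le> 2 * M" for m unfolding HK_xr[OF k] by (rule sK_bound[OF \<alpha>(1)])
      have pb': "\<bar>p (xr m k) - c 0\<bar> \<le> 2 * M + 2 * e'" for m using d1[of m] pb[of m] by linarith
      have "g k - Wsum \<alpha> k = (\<Sum>m. b m k * of_real (p (xr m k) - c 0) * wm \<alpha> m k - b m k * of_real (HK \<alpha> (xr m k)) * wm \<alpha> m k)"
        unfolding ge Wsum_def HK_xr[OF k, symmetric]
        by (rule suminf_diff[OF series_bound(1)[OF k \<alpha> pb'] series_bound(1)[OF k \<alpha> pb]])
      also have "(\<lambda>m. b m k * of_real (p (xr m k) - c 0) * wm \<alpha> m k - b m k * of_real (HK \<alpha> (xr m k)) * wm \<alpha> m k) =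
          (\<lambda>m. b m k * of_real ((p (xr m k) - c 0) - HK \<alpha> (xr m k)) * wm \<alpha> m k)"
        by (simp only: left_diff_distrib[symmetric] right_diff_distrib[symmetric] of_real_diff)
      finally have "norm (g k - Wsum \<alpha> k) = norm (\<Sum>m. b m k * of_real ((p (xr m k) - c 0) - HK \<alpha> (xr m k)) * wm \<alpha> m k)"
        by simp
      also have "\<dots> \<le> 2 * e' * (\<bar>k\<bar> * CW)" by (rule series_bound(2)[OF k \<alpha> d1])
      also have "\<dots> \<le> 2 * e' * (pi * CW + 1)"
      proof (rule mult_left_mono)
        have "\<bar>k\<bar> * CW \<le> pi * CW" using k by (intro mult_right_mono CW_nonneg) auto
        then show "\<bar>k\<bar> * CW \<le> pi * CW + 1" by simp
      qed (use e' in simp)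
      also have "\<dots> = e"
      proof -
        have "2 * (e / (2 * z)) * z = e" if "0 < z" for z :: real using that by simp
        then show ?thesis using CWp unfolding e'_def by blast
      qed
      finally show ?thesis .
    qed
    then show ?thesis using gc by blast
  qed
  have "\<forall>n. \<exists>g. continuous_on {-pi..pi} g \<and> (\<forall>k\<in>{-pi..pi}. norm (g k - Wsum \<alpha> k) \<le> inverse (real (Suc n)))"
    using approx by simp
  then obtain g where g: "\<And>n. continuous_on {-pi..pi} (g n)"
      "\<And>n k. k \<in> {-pi..pi} \<Longrightarrow> norm (g n k - Wsum \<alpha> k) \<le> inverse (real (Suc n))"
    unfolding choice_iff by blast
  have "uniform_limit {-pi..pi} g (Wsum \<alpha>) sequentially"
  proof (rule uniform_limitI)
    fix e :: real assume "0 < e"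
    then obtain N where N: "inverse (real (Suc N)) < e" using reals_Archimedean by blast
    show "\<forall>\<^sub>F n in sequentially. \<forall>k\<in>{-pi..pi}. dist (g n k) (Wsum \<alpha> k) < e"
      unfolding eventually_sequentially
    proof (intro exI allI impI ballI)
      fix n k assume "N \<le> n" and k: "k \<in> {-pi..pi}"
      then have "inverse (real (Suc n)) \<le> inverse (real (Suc N))" by (intro le_imp_inverse_le) auto
      then show "dist (g n k) (Wsum \<alpha> k) < e" using g(2)[OF k, of n] N unfolding dist_norm by linarith
    qed
  qed
  then show ?thesis
    by (rule uniform_limit_theorem[rotated]) (auto intro: always_eventually g(1))
qed

lemma Wsum_bound:
  assumes k: "k \<in> {-pi..pi}" and \<alpha>: "0 < \<alpha>" "\<alpha> \<le> 1"
  shows "summable (\<lambda>m. b m k * of_real (sK \<alpha> (\<omega> m k)) * wm \<alpha> m k)"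
    and "norm (Wsum \<alpha> k) \<le> 2 * M * (\<bar>k\<bar> * CW)"
  unfolding Wsum_def by (rule series_bound[OF k \<alpha> sK_bound[OF \<alpha>(1)]])+

text \<open>Beyond the ground state all frequencies are at least \<open>sqrt (amin / 4)\<close>, so
  \<open>sK\<close> is of order \<alpha>^q uniformly in m; the general series bound supplies the
  factor |k|.\<close>

lemma Wsum_minus_ground:
  assumes k: "\<bar>k\<bar> \<le> 1/4" and \<alpha>: "0 < \<alpha>" "\<alpha> \<le> 1"
  shows "norm (Wsum \<alpha> k - b 0 k * of_real (sK \<alpha> (\<omega> 0 k)) * wm \<alpha> 0 k)
    \<le> 2 * M * (2 * pi) ^ q * (1 / sqrt (amin / 4)) ^ q * CW * \<alpha> ^ q * \<bar>k\<bar>"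
proof -
  have kp: "k \<in> {-pi..pi}" using k pi_gt3 by auto
  define C where "C = 2 * M * (2 * pi) ^ q * (\<alpha> / sqrt (amin / 4)) ^ q"
  \<comment> \<open>The multiplier is zeroed at m = 0, so that the tail is again a full series to
    which \<open>series_bound\<close> applies.\<close>
  define \<sigma> where "\<sigma> = (\<lambda>m. if m = 0 then 0 else sK \<alpha> (\<omega> m k))"
  have C: "0 \<le> C" using M_nonneg \<alpha> amin by (simp add: C_def)
  have \<sigma>: "\<bar>\<sigma> m\<bar> \<le> C" for m
  proof (cases "m = 0")
    case False
    have "amin / 4 \<le> ev m k" using spectral_gap[OF k] False by simp
    then have w: "sqrt (amin / 4) \<le> \<omega> m k" using \<omega>_nonneg[OF kp] real_le_lsqrt by blast
    have p: "0 < sqrt (amin / 4)" using amin by simp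
    have "\<bar>\<sigma> m\<bar> \<le> 2 * M * (2 * pi) ^ q * (\<alpha> / \<omega> m k) ^ q"
      using False sK_decay[OF \<alpha>(1), of "\<omega> m k"] w p by (simp add: \<sigma>_def)
    also have "\<dots> \<le> C" unfolding C_def using w p less_le_trans[OF p w] \<alpha> M_nonneg
      by (intro mult_left_mono power_mono divide_left_mono mult_pos_pos divide_nonneg_pos) auto
    finally show ?thesis .
  qed (use C in \<open>simp add: \<sigma>_def\<close>)
  let ?f = "\<lambda>m. b m k * of_real (sK \<alpha> (\<omega> m k)) * wm \<alpha> m k"
  let ?g = "\<lambda>m. b m k * of_real (\<sigma> m) * wm \<alpha> m k"
  have "suminf ?f = ?f 0 + (\<Sum>m. ?f (Suc m))"
    using suminf_split_head[OF Wsum_bound(1)[OF kp \<alpha>]] by simp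
  moreover have "suminf ?g = ?g 0 + (\<Sum>m. ?g (Suc m))"
    using suminf_split_head[OF series_bound(1)[where \<sigma> = \<sigma>, OF kp \<alpha> \<sigma>]] by simp
  ultimately have "Wsum \<alpha> k - ?f 0 = suminf ?g" by (simp add: Wsum_def \<sigma>_def)
  also have "norm \<dots> \<le> C * (\<bar>k\<bar> * CW)" by (rule series_bound(2)[OF kp \<alpha> \<sigma>])
  also have "\<dots> = 2 * M * (2 * pi) ^ q * (1 / sqrt (amin / 4)) ^ q * CW * \<alpha> ^ q * \<bar>k\<bar>"
    by (simp add: C_def power_divide)
  finally show ?thesis .
qed

end

section \<open>The fundamental system as a power series in the spectral parameter\<close>

lemma summable_half_powers: "summable (\<lambda>n. C * (1/2) ^ n :: real)"
  by (intro summable_mult summable_geometric) simp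

text \<open>Coefficients of growth r^(-n) leave a geometric series of ratio 1/2 on the ball of
  radius r/2, so the Weierstrass test applies jointly in the parameter and in y.\<close>

lemma half_radius_series:
  fixes g :: "nat \<Rightarrow> real \<Rightarrow> complex" and r C :: real
  assumes g: "\<And>n. cI (g n)" and b: "\<forall>n. \<forall>y\<in>{-1/2..1/2}. norm (g n y) \<le> C * (1 / r) ^ n" and r: "0 < r"
  defines "G \<equiv> \<lambda>l y. \<Sum>n. (- l) ^ n * g n y"
  shows "continuous_on (ball 0 (r / 2) \<times> {-1/2..1/2}) (\<lambda>(l, y). G l y)"
    and "y \<in> {-1/2..1/2} \<Longrightarrow> (\<lambda>l. G l y) holomorphic_on ball 0 (r / 2)"
    and "l \<in> ball 0 (r / 2) \<Longrightarrow> uniform_limit {-1/2..1/2} (\<lambda>N y. \<Sum>n<N. (- l) ^ n * g n y) (G l) sequentially"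
    and "l \<in> ball 0 (r / 2) \<Longrightarrow> y \<in> {-1/2..1/2} \<Longrightarrow> summable (\<lambda>n. (- l) ^ n * g n y)"
proof -
  have C: "0 \<le> C" using order_trans[OF norm_ge_zero b[rule_format, of 0 0]] by simp
  have t: "norm ((- l) ^ n * g n y) \<le> C * (1/2) ^ n" if "l \<in> ball 0 (r / 2)" "y \<in> {-1/2..1/2}" for l n y
  proof -
    have "norm ((- l) ^ n * g n y) = norm l ^ n * norm (g n y)" by (simp add: norm_mult norm_power)
    also have "\<dots> \<le> (r / 2) ^ n * (C * (1 / r) ^ n)"
      using that r by (intro mult_mono power_mono b[rule_format]) auto
    also have "\<dots> = C * (1/2) ^ n" using r by (simp add: power_divide)
    finally show ?thesis .
  qed
  have u: "uniform_limit (ball 0 (r / 2) \<times> {-1/2..1/2}) (\<lambda>N x. \<Sum>n<N. (- fst x) ^ n * g n (snd x))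
      (\<lambda>x. \<Sum>n. (- fst x) ^ n * g n (snd x)) sequentially"
    by (rule Weierstrass_m_test[OF _ summable_half_powers[of C]]) (use t in auto)
  have "continuous_on (ball 0 (r / 2) \<times> {-1/2..1/2}) (\<lambda>x. \<Sum>n. (- fst x) ^ n * g n (snd x))"
  proof (rule uniform_limit_theorem[OF _ u])
    show "\<forall>\<^sub>F N in sequentially. continuous_on (ball 0 (r / 2) \<times> {-1/2..1/2}) (\<lambda>x. \<Sum>n<N. (- fst x) ^ n * g n (snd x))"
      by (intro always_eventually allI continuous_intros continuous_on_compose2[OF g]) auto
  qed simp
  then show "continuous_on (ball 0 (r / 2) \<times> {-1/2..1/2}) (\<lambda>(l, y). G l y)"
    by (simp add: G_def case_prod_unfold)
  show "(\<lambda>l. G l y) holomorphic_on ball 0 (r / 2)" if y: "y \<in> {-1/2..1/2}" for y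
  proof (rule holomorphic_uniform_sequence)
    have ul: "uniform_limit (ball 0 (r / 2)) (\<lambda>N l. \<Sum>n<N. (- l) ^ n * g n y) (\<lambda>l. G l y) sequentially"
      unfolding G_def by (rule Weierstrass_m_test[OF _ summable_half_powers[of C]]) (use t y in auto)
    show "(\<lambda>l. \<Sum>n<N. (- l) ^ n * g n y) holomorphic_on ball 0 (r / 2)" for N
      by (intro holomorphic_intros)
    fix x :: complex assume x: "x \<in> ball 0 (r / 2)"
    obtain d where d: "0 < d" "cball x d \<subseteq> ball 0 (r / 2)"
      using x open_contains_cball[THEN iffD1, rule_format, OF open_ball] by blast
    then show "\<exists>d>0. cball x d \<subseteq> ball 0 (r / 2) \<and> uniform_limit (cball x d) (\<lambda>N l. \<Sum>n<N. (- l) ^ n * g n y) (\<lambda>l. G l y) sequentially"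
      using uniform_limit_on_subset[OF ul d(2)] by blast
  qed simp
  show "uniform_limit {-1/2..1/2} (\<lambda>N y. \<Sum>n<N. (- l) ^ n * g n y) (G l) sequentially" if l: "l \<in> ball 0 (r / 2)" for l
    unfolding G_def by (rule Weierstrass_m_test[OF _ summable_half_powers[of C]]) (use t l in auto)
  show "summable (\<lambda>n. (- l) ^ n * g n y)" if "l \<in> ball 0 (r / 2)" "y \<in> {-1/2..1/2}" for l y
    by (rule summable_comparison_test'[OF summable_half_powers[of C], of 0]) (use t[OF that] in auto)
qed

context bloch
begin

text \<open>\<open>Vop\<close> and \<open>Uop\<close> invert the two halves of (a f')' = - l f,
  written as the system f' = p / a, p' = - l f, with integration starting at the left end of the
  period.\<close>

definition Vop :: "(real \<Rightarrow> complex) \<Rightarrow> real \<Rightarrow> complex" where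
  "Vop f y = integral {-1/2..y} f"

definition Uop :: "(real \<Rightarrow> complex) \<Rightarrow> real \<Rightarrow> complex" where
  "Uop f y = integral {-1/2..y} (\<lambda>z. f z / of_real (a z))"

lemma a_ne: "complex_of_real (a y) \<noteq> 0" using a_pos[of y] by simp

lemma div_a_cont:
  fixes f :: "real \<Rightarrow> complex"
  shows "cI f \<Longrightarrow> cI (\<lambda>z. f z / of_real (a z))"
  using a_ne by (intro continuous_on_divide continuous_on_of_real a_cont) blast+

lemma Uop_Vop: "Uop f = Vop (\<lambda>z. f z / of_real (a z))"
  by (simp add: Uop_def Vop_def fun_eq_iff)

lemma Vop_deriv:
  assumes "cI f" "y \<in> {-1/2..1/2}"
  shows "(Vop f has_vector_derivative f y) (at y within {-1/2..1/2})"
  unfolding Vop_def[abs_def] by (rule integral_has_vector_derivative[OF assms])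

lemma Vop_cont: "cI f \<Longrightarrow> cI (Vop f)"
  using Vop_deriv continuous_on_vector_derivative by blast

lemma Uop_deriv: "cI f \<Longrightarrow> y \<in> {-1/2..1/2} \<Longrightarrow> (Uop f has_vector_derivative f y / of_real (a y)) (at y within {-1/2..1/2})"
  unfolding Uop_Vop by (rule Vop_deriv[OF div_a_cont])

lemma Uop_cont: "cI f \<Longrightarrow> cI (Uop f)"
  unfolding Uop_Vop by (intro Vop_cont div_a_cont)

lemma Vop_bound:
  assumes "cI f" "\<And>y. y \<in> {-1/2..1/2} \<Longrightarrow> norm (f y) \<le> C" "y \<in> {-1/2..1/2}"
  shows "norm (Vop f y) \<le> C"
proof -
  have C: "0 \<le> C" using assms(2)[OF assms(3)] norm_ge_zero[of "f y"] by linarith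
  have "norm (Vop f y) \<le> C * (y - (-1/2))"
    unfolding Vop_def by (rule integral_bound) (use assms in \<open>auto intro: continuous_on_subset\<close>)
  also have "\<dots> \<le> C * 1" using assms(3) C by (intro mult_left_mono) auto
  finally show ?thesis by simp
qed

lemma Uop_bound:
  assumes "cI f" "\<And>y. y \<in> {-1/2..1/2} \<Longrightarrow> norm (f y) \<le> C" "y \<in> {-1/2..1/2}"
  shows "norm (Uop f y) \<le> C * (1 / amin)"
  unfolding Uop_Vop
proof (rule Vop_bound[OF div_a_cont[OF assms(1)] _ assms(3)])
  fix z :: real assume z: "z \<in> {-1/2..1/2}"
  have "norm (f z / of_real (a z)) = norm (f z) / a z" using a_pos[of z] by (simp add: norm_divide)
  also have "\<dots> \<le> C / amin"
    using assms(2)[OF z] amin(1) amin(2)[of z] order_trans[OF norm_ge_zero assms(2)[OF z]] by (intro frac_le) auto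
  finally show "norm (f z / of_real (a z)) \<le> C * (1 / amin)" by simp
qed

text \<open>Picard iterates. \<open>Vop\<close> has sup norm at most 1 and \<open>Uop\<close> at
  most 1 / \<open>amin\<close>, so the series in - l converges on \<open>Lball\<close> with ratio
  1/2.\<close>

primrec fs :: "(real \<Rightarrow> complex) \<Rightarrow> nat \<Rightarrow> real \<Rightarrow> complex" where
  "fs f0 0 = f0"
| "fs f0 (Suc n) = Uop (Vop (fs f0 n))"

lemma fs_cont: "cI f0 \<Longrightarrow> cI (fs f0 n)"
  by (induction n) (simp_all only: fs.simps Uop_cont Vop_cont)

lemma fs_bound:
  assumes "cI f0" "\<forall>y\<in>{-1/2..1/2}. norm (f0 y) \<le> C"
  shows "y \<in> {-1/2..1/2} \<Longrightarrow> norm (fs f0 n y) \<le> C * (1 / amin) ^ n"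
proof (induction n arbitrary: y)
  case 0 then show ?case using assms by simp
next
  case (Suc n)
  have "norm (Uop (Vop (fs f0 n)) y) \<le> C * (1 / amin) ^ n * (1 / amin)"
    by (intro Uop_bound Vop_bound Vop_cont fs_cont assms(1) Suc)
  then show ?case by (simp add: mult.assoc mult.commute)
qed

definition Fs :: "(real \<Rightarrow> complex) \<Rightarrow> complex \<Rightarrow> real \<Rightarrow> complex" where
  "Fs f0 l y = (\<Sum>n. (- l) ^ n * fs f0 n y)"

definition Ps :: "(real \<Rightarrow> complex) \<Rightarrow> complex \<Rightarrow> real \<Rightarrow> complex" where
  "Ps f0 l y = (\<Sum>n. (- l) ^ n * Vop (fs f0 n) y)"

definition Qs :: "(real \<Rightarrow> complex) \<Rightarrow> complex \<Rightarrow> real \<Rightarrow> complex" where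
  "Qs f0 l y = (\<Sum>n. (- l) ^ n * fs f0 (Suc n) y)"

abbreviation Lball :: "complex set" where "Lball \<equiv> ball 0 (amin / 2)"

lemma bounded_cI: "cI f0 \<Longrightarrow> \<exists>C. \<forall>y\<in>{-1/2..1/2::real}. norm (f0 y :: complex) \<le> C"
proof -
  assume "cI f0"
  then have "bounded (f0 ` {-1/2..1/2})" by (intro compact_imp_bounded compact_continuous_image) auto
  then show ?thesis unfolding bounded_iff by blast
qed

text \<open>Uniform convergence allows integration term by term, so the recursion for the iterates
  becomes integral equations for the sums.\<close>

lemma
  assumes f0: "cI f0"
  shows Fs_cont: "continuous_on (Lball \<times> {-1/2..1/2}) (\<lambda>(l, y). Fs f0 l y)"
    and Fs_hol: "y \<in> {-1/2..1/2} \<Longrightarrow> (\<lambda>l. Fs f0 l y) holomorphic_on Lball"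
    and Ps_cont: "continuous_on (Lball \<times> {-1/2..1/2}) (\<lambda>(l, y). Ps f0 l y)"
    and Ps_hol: "y \<in> {-1/2..1/2} \<Longrightarrow> (\<lambda>l. Ps f0 l y) holomorphic_on Lball"
    and Qs_hol: "y \<in> {-1/2..1/2} \<Longrightarrow> (\<lambda>l. Qs f0 l y) holomorphic_on Lball"
    and Vop_Fs: "l \<in> Lball \<Longrightarrow> y \<in> {-1/2..1/2} \<Longrightarrow> Vop (Fs f0 l) y = Ps f0 l y"
    and Uop_Ps: "l \<in> Lball \<Longrightarrow> y \<in> {-1/2..1/2} \<Longrightarrow> Uop (Ps f0 l) y = Qs f0 l y"
    and Fs_rec: "l \<in> Lball \<Longrightarrow> y \<in> {-1/2..1/2} \<Longrightarrow> Fs f0 l y = f0 y - l * Qs f0 l y"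
proof -
  obtain C where C: "\<forall>y\<in>{-1/2..1/2}. norm (f0 y) \<le> C" using bounded_cI[OF f0] by blast
  note Fb = fs_bound[OF f0 C]
  have Vb: "norm (Vop (fs f0 n) y) \<le> C * (1 / amin) ^ n" if "y \<in> {-1/2..1/2}" for n y
    by (intro Vop_bound fs_cont f0 Fb that)
  have Qb: "norm (fs f0 (Suc n) y) \<le> (C * (1 / amin)) * (1 / amin) ^ n" if "y \<in> {-1/2..1/2}" for n y
    using Fb[OF that, of "Suc n"] by (simp only: power_Suc mult.assoc)
  have Fb': "\<forall>n. \<forall>y\<in>{-1/2..1/2}. norm (fs f0 n y) \<le> C * (1 / amin) ^ n"
    and Vb': "\<forall>n. \<forall>y\<in>{-1/2..1/2}. norm (Vop (fs f0 n) y) \<le> C * (1 / amin) ^ n"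
    and Qb': "\<forall>n. \<forall>y\<in>{-1/2..1/2}. norm (fs f0 (Suc n) y) \<le> (C * (1 / amin)) * (1 / amin) ^ n"
    using Fb Vb Qb by blast+
  note F = half_radius_series[where g = "fs f0", OF fs_cont[OF f0] Fb' amin(1), folded Fs_def[abs_def]]
  note P = half_radius_series[where g = "\<lambda>n. Vop (fs f0 n)", OF Vop_cont[OF fs_cont[OF f0]] Vb' amin(1), folded Ps_def[abs_def]]
  note Q = half_radius_series[where g = "\<lambda>n. fs f0 (Suc n)", OF fs_cont[OF f0] Qb' amin(1), folded Qs_def[abs_def]]
  show "continuous_on (Lball \<times> {-1/2..1/2}) (\<lambda>(l, y). Fs f0 l y)" using F(1) by (simp add: Fs_def)
  show "continuous_on (Lball \<times> {-1/2..1/2}) (\<lambda>(l, y). Ps f0 l y)" using P(1) by (simp add: Ps_def)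
  show "(\<lambda>l. Fs f0 l y) holomorphic_on Lball" if "y \<in> {-1/2..1/2}" using F(2)[OF that] by (simp add: Fs_def)
  show "(\<lambda>l. Ps f0 l y) holomorphic_on Lball" if "y \<in> {-1/2..1/2}" using P(2)[OF that] by (simp add: Ps_def)
  show "(\<lambda>l. Qs f0 l y) holomorphic_on Lball" if "y \<in> {-1/2..1/2}" using Q(2)[OF that] by (simp add: Qs_def)
  have swap: "Vop (\<lambda>y. \<Sum>n. (- l) ^ n * g n y) y = (\<Sum>n. (- l) ^ n * Vop (g n) y)"
    if u: "uniform_limit {-1/2..1/2} (\<lambda>N y. \<Sum>n<N. (- l) ^ n * g n y) (\<lambda>y. \<Sum>n. (- l) ^ n * g n y) sequentially"
      and g: "\<And>n. cI (g n)" and y: "y \<in> {-1/2..1/2}" for g l y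
  proof -
    have sub: "{-1/2..y} \<subseteq> {-1/2..1/2}" using y by auto
    have c: "continuous_on {-1/2..y} (g n)" for n by (rule continuous_on_subset[OF g sub])
    have cs: "continuous_on {-1/2..y} (\<lambda>y. \<Sum>n<N. (- l) ^ n * g n y)" for N by (intro continuous_intros c)
    obtain I J where IJ: "\<And>N. ((\<lambda>y. \<Sum>n<N. (- l) ^ n * g n y) has_integral I N) {-1/2..y}"
      "((\<lambda>y. \<Sum>n. (- l) ^ n * g n y) has_integral J) {-1/2..y}" "I \<longlonglongrightarrow> J"
      by (rule uniform_limit_integral[OF uniform_limit_on_subset[OF u sub] cs]) auto
    have Ieq: "I N = (\<Sum>n<N. (- l) ^ n * Vop (g n) y)" for N
    proof -
      have "((\<lambda>y. \<Sum>n<N. (- l) ^ n * g n y) has_integral (\<Sum>n<N. (- l) ^ n * Vop (g n) y)) {-1/2..y}"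
        unfolding Vop_def
        by (intro has_integral_sum has_integral_mult_right integrable_integral integrable_continuous_interval c) simp
      then show ?thesis using IJ(1) has_integral_unique by blast
    qed
    have "I = (\<lambda>N. \<Sum>n<N. (- l) ^ n * Vop (g n) y)" by (rule ext) (rule Ieq)
    then have "(\<lambda>n. (- l) ^ n * Vop (g n) y) sums J" using IJ(3) unfolding sums_def by (simp only:)
    then show ?thesis using IJ(2) by (simp add: Vop_def sums_iff has_integral_iff)
  qed
  show "Vop (Fs f0 l) y = Ps f0 l y" if l: "l \<in> Lball" and y: "y \<in> {-1/2..1/2}"
    using swap[OF F(3)[OF l, unfolded Fs_def] fs_cont[OF f0] y] by (simp add: Fs_def[abs_def] Ps_def)
  show "Uop (Ps f0 l) y = Qs f0 l y" if l: "l \<in> Lball" and y: "y \<in> {-1/2..1/2}"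
  proof -
    let ?g = "\<lambda>n z. Vop (fs f0 n) z / of_real (a z)"
    have gc: "cI (?g n)" for n by (intro div_a_cont Vop_cont fs_cont f0)
    have gb: "norm (?g n z) \<le> (C / amin) * (1 / amin) ^ n" if z: "z \<in> {-1/2..1/2}" for n z
    proof -
      have "norm (?g n z) = norm (Vop (fs f0 n) z) / a z" using a_pos[of z] by (simp add: norm_divide)
      also have "\<dots> \<le> (C * (1 / amin) ^ n) / amin"
        using Vb[OF z, of n] amin(1) amin(2)[of z] order_trans[OF norm_ge_zero Vb[OF z, of n]] by (intro frac_le) auto
      finally show ?thesis by simp
    qed
    have gb': "\<forall>n. \<forall>z\<in>{-1/2..1/2}. norm (?g n z) \<le> (C / amin) * (1 / amin) ^ n" using gb by blast
    have "Uop (Ps f0 l) y = Vop (\<lambda>y. \<Sum>n. (- l) ^ n * ?g n y) y"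
      unfolding Uop_Vop Vop_def
    proof (rule integral_cong)
      fix z assume "z \<in> {-1/2..y}"
      then have z: "z \<in> {-1/2..1/2}" using y by auto
      show "Ps f0 l z / of_real (a z) = (\<Sum>n. (- l) ^ n * (integral {-1/2..z} (fs f0 n) / of_real (a z)))"
        using suminf_divide[OF P(4)[OF l z], of "of_real (a z)"] by (simp add: Ps_def Vop_def)
    qed
    also have "\<dots> = (\<Sum>n. (- l) ^ n * Vop (?g n) y)"
      by (rule swap[OF half_radius_series(3)[OF gc gb' amin(1) l] gc y])
    finally show ?thesis by (simp add: Qs_def Uop_Vop)
  qed
  show "Fs f0 l y = f0 y - l * Qs f0 l y" if l: "l \<in> Lball" and y: "y \<in> {-1/2..1/2}"
  proof -
    have "Fs f0 l y = f0 y + (\<Sum>n. (- l) ^ Suc n * fs f0 (Suc n) y)"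
      unfolding Fs_def using suminf_split_head[OF F(4)[OF l y]] by simp
    also have "(\<Sum>n. (- l) ^ Suc n * fs f0 (Suc n) y) = (\<Sum>n. (- l) * ((- l) ^ n * fs f0 (Suc n) y))"
      by (simp only: power_Suc mult.assoc)
    also have "\<dots> = (- l) * Qs f0 l y"
      unfolding Qs_def by (rule suminf_mult[OF Q(4)[OF l y]])
    finally show ?thesis by simp
  qed
qed

lemma slice_cont:
  assumes "continuous_on (Lball \<times> {-1/2..1/2}) (\<lambda>(l, y). F l y)" "l \<in> Lball"
  shows "cI (F l)"
proof -
  have "cI (\<lambda>y. case (l, y) of (l, y) \<Rightarrow> F l y)"
    by (rule continuous_on_compose2[OF assms(1)]) (use assms(2) in \<open>auto intro!: continuous_intros\<close>)
  then show ?thesis by simp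
qed

text \<open>The two solutions at l = 0: the constant with zero flux, and the integral of 1/a with
  flux 1. They seed the series.\<close>

definition C1 where "C1 = (\<lambda>_::real. 1 :: complex)"
definition A1 where "A1 = Uop C1"

lemma C1_cont: "cI C1" and A1_cont: "cI A1"
proof -
  show c: "cI C1" unfolding C1_def by (rule continuous_on_const)
  show "cI A1" unfolding A1_def by (rule Uop_cont[OF c])
qed

text \<open>The cosine- and sine-type solutions with their fluxes \<open>pC\<close> and
  \<open>pS\<close>, normalised at y = -1/2. Their values at y = 1/2 are the entries of the
  monodromy matrix.\<close>

definition fC where "fC l y = Fs C1 l y"
definition fS where "fS l y = Fs A1 l y"
definition pC where "pC l y = - l * Ps C1 l y"
definition pS where "pS l y = 1 - l * Ps A1 l y"

lemma fC_cont: "continuous_on (Lball \<times> {-1/2..1/2}) (\<lambda>(l, y). fC l y)"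
  and fS_cont: "continuous_on (Lball \<times> {-1/2..1/2}) (\<lambda>(l, y). fS l y)"
  and pC_cont: "continuous_on (Lball \<times> {-1/2..1/2}) (\<lambda>(l, y). pC l y)"
  and pS_cont: "continuous_on (Lball \<times> {-1/2..1/2}) (\<lambda>(l, y). pS l y)"
  unfolding fC_def fS_def pC_def pS_def case_prod_unfold
  using Fs_cont[OF C1_cont] Fs_cont[OF A1_cont] Ps_cont[OF C1_cont] Ps_cont[OF A1_cont]
  by (auto simp: case_prod_unfold intro!: continuous_intros)

lemma
  assumes "y \<in> {-1/2..1/2}"
  shows fC_hol: "(\<lambda>l. fC l y) holomorphic_on Lball" and fS_hol: "(\<lambda>l. fS l y) holomorphic_on Lball"
    and pC_hol: "(\<lambda>l. pC l y) holomorphic_on Lball" and pS_hol: "(\<lambda>l. pS l y) holomorphic_on Lball"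
  unfolding fC_def fS_def pC_def pS_def
  using Fs_hol[OF C1_cont assms] Fs_hol[OF A1_cont assms] Ps_hol[OF C1_cont assms] Ps_hol[OF A1_cont assms]
  by (auto intro!: holomorphic_intros)

lemma
  assumes l: "l \<in> Lball" and y: "y \<in> {-1/2..1/2}"
  shows fC_eq: "fC l y = 1 + Uop (pC l) y" and fS_eq: "fS l y = Uop (pS l) y"
    and pC_eq: "pC l y = - l * Vop (fC l) y" and pS_eq: "pS l y = 1 - l * Vop (fS l) y"
proof -
  have sub: "{-1/2..y} \<subseteq> {-1/2..1/2}" using y by auto
  have Psc: "continuous_on {-1/2..y} (\<lambda>z. Ps f l z / of_real (a z))" if "cI f" for f
    by (rule continuous_on_subset[OF div_a_cont[OF slice_cont[OF Ps_cont[OF that] l]] sub])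
  have Uc: "Uop (\<lambda>y. c * Ps f l y) y = c * Uop (Ps f l) y" for c f
    by (simp add: Uop_def flip: integral_mult_right)
  show "pC l y = - l * Vop (fC l) y" "pS l y = 1 - l * Vop (fS l) y"
    unfolding pC_def pS_def fC_def[abs_def] fS_def[abs_def] Vop_Fs[OF C1_cont l y] Vop_Fs[OF A1_cont l y] by simp_all
  show "fC l y = 1 + Uop (pC l) y"
    unfolding fC_def Fs_rec[OF C1_cont l y] Uop_Ps[OF C1_cont l y, symmetric] pC_def[abs_def] Uc[of "- l" C1]
    by (simp add: C1_def)
  have "Uop (pS l) y = integral {-1/2..y} (\<lambda>z. C1 z / of_real (a z) - l * (Ps A1 l z / of_real (a z)))"
    unfolding Uop_def pS_def C1_def by (simp add: diff_divide_distrib)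
  also have "\<dots> = Uop C1 y - l * Uop (Ps A1 l) y"
    unfolding Uop_def integral_mult_right[symmetric]
    by (intro integral_diff integrable_continuous_interval continuous_intros Psc A1_cont
       continuous_on_subset[OF div_a_cont[OF C1_cont] sub])
  finally show "fS l y = Uop (pS l) y"
    unfolding fS_def Fs_rec[OF A1_cont l y] Uop_Ps[OF A1_cont l y, symmetric] unfolding A1_def by simp
qed

lemma has_vector_derivative_cong_on:
  assumes "(g has_vector_derivative d) (at y within S)" "\<And>x. x \<in> S \<Longrightarrow> f x = g x" "y \<in> S"
  shows "(f has_vector_derivative d) (at y within S)"
  using has_vector_derivative_transform[of y S f g d] assms by simp

lemma
  assumes l: "l \<in> Lball" and y: "y \<in> {-1/2..1/2}"
  shows fC_deriv: "(fC l has_vector_derivative pC l y / of_real (a y)) (at y within {-1/2..1/2})"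
    and fS_deriv: "(fS l has_vector_derivative pS l y / of_real (a y)) (at y within {-1/2..1/2})"
    and pC_deriv: "(pC l has_vector_derivative - l * fC l y) (at y within {-1/2..1/2})"
    and pS_deriv: "(pS l has_vector_derivative - l * fS l y) (at y within {-1/2..1/2})"
proof -
  have c: "cI (fC l)" "cI (fS l)" "cI (pC l)" "cI (pS l)"
    using slice_cont[OF fC_cont l] slice_cont[OF fS_cont l] slice_cont[OF pC_cont l] slice_cont[OF pS_cont l] by auto
  have "((\<lambda>y. 1 + Uop (pC l) y) has_vector_derivative 0 + pC l y / of_real (a y)) (at y within {-1/2..1/2})"
    by (rule has_vector_derivative_add[OF has_vector_derivative_const Uop_deriv[OF c(3) y]])
  then show "(fC l has_vector_derivative pC l y / of_real (a y)) (at y within {-1/2..1/2})"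
    by (intro has_vector_derivative_cong_on[OF _ fC_eq[OF l] y]) simp
  show "(fS l has_vector_derivative pS l y / of_real (a y)) (at y within {-1/2..1/2})"
    by (rule has_vector_derivative_cong_on[OF Uop_deriv[OF c(4) y] fS_eq[OF l] y])
  show "(pC l has_vector_derivative - l * fC l y) (at y within {-1/2..1/2})"
    by (rule has_vector_derivative_cong_on[OF has_vector_derivative_mult_right[OF Vop_deriv[OF c(1) y]] pC_eq[OF l] y])
  have "((\<lambda>y. 1 - l * Vop (fS l) y) has_vector_derivative 0 - l * fS l y) (at y within {-1/2..1/2})"
    by (rule has_vector_derivative_diff[OF has_vector_derivative_const has_vector_derivative_mult_right[OF Vop_deriv[OF c(2) y]]])
  then show "(pS l has_vector_derivative - l * fS l y) (at y within {-1/2..1/2})"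
    by (intro has_vector_derivative_cong_on[OF _ pS_eq[OF l] y]) simp
qed

lemma initial_values:
  assumes l: "l \<in> Lball"
  shows "fC l (-1/2) = 1" "fS l (-1/2) = 0" "pC l (-1/2) = 0" "pS l (-1/2) = 1"
  using fC_eq[OF l, of "-1/2"] fS_eq[OF l, of "-1/2"] pC_eq[OF l, of "-1/2"] pS_eq[OF l, of "-1/2"]
  by (simp_all add: Uop_def Vop_def)

lemma Wronskian:
  assumes l: "l \<in> Lball" and y: "y \<in> {-1/2..1/2}"
  shows "fC l y * pS l y - fS l y * pC l y = 1"
proof -
  have "((\<lambda>y. fC l y * pS l y - fS l y * pC l y) has_vector_derivative 0) (at y within {-1/2..1/2})"
    if y: "y \<in> {-1/2..1/2}" for y
    by (rule has_vector_derivative_eq_rhs[OF has_vector_derivative_diff[OF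
        has_vector_derivative_mult[OF fC_deriv[OF l y] pS_deriv[OF l y]]
        has_vector_derivative_mult[OF fS_deriv[OF l y] pC_deriv[OF l y]]]])
      (simp add: a_ne field_simps)
  then obtain c where c: "\<And>y. y \<in> {-1/2..1/2} \<Longrightarrow> fC l y * pS l y - fS l y * pC l y = c"
    using has_vector_derivative_zero_constant[of "{-1/2..1/2}" "\<lambda>y. fC l y * pS l y - fS l y * pC l y"] by blast
  have "c = fC l (-1/2) * pS l (-1/2) - fS l (-1/2) * pC l (-1/2)" by (rule c[symmetric]) simp
  then show ?thesis unfolding c[OF y] initial_values[OF l] by simp
qed

text \<open>For \<open>\<bar>l\<bar> < amin / 2\<close> the map \<open>f \<mapsto> l * Uop (Vop f)\<close> is a contraction on \<open>[-1/2, 1/2]\<close>.\<close>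

lemma zero_data_unique:
  assumes l: "l \<in> Lball" and f: "cI f" and eq: "\<And>y. y \<in> {-1/2..1/2} \<Longrightarrow> f y = - l * Uop (Vop f) y" and y: "y \<in> {-1/2..1/2}"
  shows "f y = 0"
proof -
  obtain x0 where x0: "x0 \<in> {-1/2..1/2}" "\<And>y. y \<in> {-1/2..1/2} \<Longrightarrow> norm (f y) \<le> norm (f x0)"
    using continuous_attains_sup[of "{-1/2..1/2}" "\<lambda>y. norm (f y)"] continuous_on_norm[OF f] by auto
  have "norm (f x0) = norm l * norm (Uop (Vop f) x0)" using eq[OF x0(1)] by (simp add: norm_mult)
  also have "\<dots> \<le> norm l * (norm (f x0) * (1 / amin))"
    by (intro mult_left_mono Uop_bound Vop_bound Vop_cont f x0) auto
  also have "\<dots> = (norm l / amin) * norm (f x0)" by simp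
  also have "\<dots> \<le> 1/2 * norm (f x0)"
    using l amin(1) by (intro mult_right_mono) (auto simp: field_simps)
  finally have "norm (f x0) \<le> 0" by simp
  then show ?thesis using x0(2)[OF y] by simp
qed

text \<open>The trace of the monodromy matrix is 2 - l \<open>Dt l\<close>, so the Floquet condition
  that the trace equals 2 cos k reads l \<open>Dt l\<close> = 2 - 2 cos k. Factoring out l isolates
  the double zero of the right side at k = 0.\<close>

definition Dt :: "complex \<Rightarrow> complex" where "Dt l = Qs C1 l (1/2) + Ps A1 l (1/2)"

lemma Dt_hol: "Dt holomorphic_on Lball"
  unfolding Dt_def[abs_def] by (intro holomorphic_intros Qs_hol Ps_hol C1_cont A1_cont) auto

lemma trace_eq: "l \<in> Lball \<Longrightarrow> fC l (1/2) + pS l (1/2) = 2 - l * Dt l"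
  using Fs_rec[OF C1_cont, of l "1/2"] by (simp add: fC_def pS_def Dt_def C1_def algebra_simps)

lemma Lball_0: "0 \<in> Lball" using amin(1) by simp

lemma series_at_0: "(\<Sum>n. (- 0) ^ n * (g n :: complex)) = g 0"
proof -
  have "(\<Sum>n. (- 0) ^ n * g n) = (\<Sum>n\<in>{0}. (- 0) ^ n * g n)"
    by (rule suminf_finite) (auto simp: power_0_left)
  then show ?thesis by simp
qed

lemma at_0: "fC 0 y = 1" "fS 0 y = A1 y" "pC 0 y = 0" "pS 0 y = 1"
  using series_at_0[of "\<lambda>n. fs C1 n y"] series_at_0[of "\<lambda>n. fs A1 n y"]
  by (simp_all add: fC_def fS_def pC_def pS_def Fs_def C1_def)

lemma Vop_of_real: "continuous_on {-1/2..y} r \<Longrightarrow> Vop (\<lambda>z. of_real (r z)) y = of_real (integral {-1/2..y} r)"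
  unfolding Vop_def
  by (rule integral_unique, rule has_integral_of_real, rule integrable_integral, rule integrable_continuous_interval)

lemma rdiv_cont: "continuous_on S r \<Longrightarrow> continuous_on S (\<lambda>z. r z / a z)"
  by (intro continuous_on_divide a_cont) (use a_pos in \<open>auto simp: less_imp_neq[symmetric]\<close>)

lemma Uop_of_real: "continuous_on {-1/2..y} r \<Longrightarrow> Uop (\<lambda>z. of_real (r z)) y = of_real (integral {-1/2..y} (\<lambda>z. r z / a z))"
  using Vop_of_real[OF rdiv_cont, of y r] by (simp add: Uop_Vop)

definition A1r :: "real \<Rightarrow> real" where "A1r y = integral {-1/2..y} (\<lambda>z. 1 / a z)"

lemma A1_real: "A1 y = of_real (A1r y)"
  using Uop_of_real[of y "\<lambda>_. 1"] by (simp add: A1_def C1_def A1r_def)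

lemma A1r_ge: "y \<in> {-1/2..1/2} \<Longrightarrow> (1 / amax) * (y + 1/2) \<le> A1r y"
proof -
  assume y: "y \<in> {-1/2..1/2}"
  have "integral {-1/2..y} (\<lambda>z. 1 / amax) \<le> A1r y"
    unfolding A1r_def
  proof (rule integral_le)
    show "(\<lambda>z. 1 / a z) integrable_on {-1/2..y}"
      by (intro integrable_continuous_interval rdiv_cont continuous_on_const)
    show "1 / amax \<le> 1 / a z" for z using amax(2)[of z] a_pos[of z] by (intro divide_left_mono) auto
  qed (intro integrable_continuous_interval continuous_on_const)
  then show ?thesis using y by simp
qed

lemma A1_half: "A1 (1/2) \<noteq> 0"
  using A1r_ge[of "1/2"] amax(1) unfolding A1_real by (auto simp: field_simps)

text \<open>Both summands are integrals of nonnegative functions and the second is strictly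
  positive; together they amount to the mean of 1/a. Positivity later keeps the square root of
  \<open>Dt\<close> off its branch cut and makes the frequency map invertible.\<close>

lemma Dt_0: "\<exists>d>0. Dt 0 = of_real d"
proof -
  have cA: "continuous_on {-1/2..1/2} A1r"
    unfolding A1r_def[abs_def]
    by (rule continuous_on_vector_derivative, rule integral_has_vector_derivative[OF rdiv_cont[OF continuous_on_const]])
  have V1: "Vop C1 z = of_real (z + 1/2)" if "z \<in> {-1/2..1/2}" for z
    using Vop_of_real[of z "\<lambda>_. 1"] that by (simp add: C1_def)
  have "Uop (Vop C1) (1/2) = Uop (\<lambda>z. of_real (z + 1/2)) (1/2)"
    unfolding Uop_def by (rule integral_cong) (simp add: V1)
  also have "\<dots> = of_real (integral {-1/2..1/2} (\<lambda>z. (z + 1/2) / a z))"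
    by (rule Uop_of_real) (intro continuous_intros)
  finally have 1: "Uop (Vop C1) (1/2) = of_real (integral {-1/2..1/2} (\<lambda>z. (z + 1/2) / a z))" .
  have 2: "Vop A1 (1/2) = of_real (integral {-1/2..1/2} A1r)"
    unfolding A1_real[abs_def] by (rule Vop_of_real[OF cA])
  have D: "Dt 0 = Uop (Vop C1) (1/2) + Vop A1 (1/2)"
    using series_at_0[of "\<lambda>n. fs C1 (Suc n) (1/2)"] series_at_0[of "\<lambda>n. Vop (fs A1 n) (1/2)"]
    by (simp add: Dt_def Qs_def Ps_def)
  have p1: "0 \<le> integral {-1/2..1/2} (\<lambda>z. (z + 1/2) / a z)"
  proof (rule integral_nonneg)
    show "(\<lambda>z. (z + 1/2) / a z) integrable_on {-1/2..1/2}"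
      by (intro integrable_continuous_interval rdiv_cont continuous_intros)
    show "0 \<le> (z + 1/2) / a z" if "z \<in> {-1/2..1/2}" for z
      using that by (intro divide_nonneg_pos a_pos) auto
  qed
  have h: "((\<lambda>y. (1 / amax) * (y + 1/2)) has_integral (1 / amax) * (((1/2)\<^sup>2 - (-1/2)\<^sup>2) / 2 + (1/2 - (-1/2)) *\<^sub>R (1/2))) {-1/2..1/2}"
    by (intro has_integral_mult_right has_integral_add ident_has_integral)
      (simp, use has_integral_const_real[of "1/2::real" "-1/2" "1/2"] in simp)
  then have "(1 / amax) * (((1/2)\<^sup>2 - (-1/2)\<^sup>2) / 2 + (1/2 - (-1/2)) *\<^sub>R (1/2)) \<le> integral {-1/2..1/2} A1r"
    by (rule has_integral_le[OF _ integrable_integral[OF integrable_continuous_interval[OF cA]] A1r_ge])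
  then have "1 / amax * (1/2) \<le> integral {-1/2..1/2} A1r" by (simp add: power2_eq_square)
  moreover have "0 < 1 / amax * (1/2)" using amax(1) by simp
  ultimately have p2: "0 < integral {-1/2..1/2} A1r" by linarith
  show ?thesis
    by (rule exI[of _ "integral {-1/2..1/2} (\<lambda>z. (z + 1/2) / a z) + integral {-1/2..1/2} A1r"])
      (use D 1 2 p1 p2 in auto)
qed

lemma Vop_cnj: "cnj (Vop f y) = Vop (\<lambda>y. cnj (f y)) y"
  unfolding Vop_def by (rule integral_cnj)

lemma Uop_cnj: "cnj (Uop f y) = Uop (\<lambda>y. cnj (f y)) y"
  unfolding Uop_Vop Vop_cnj by simp

lemma fs_real: "(\<And>y. cnj (f0 y) = f0 y) \<Longrightarrow> cnj (fs f0 n y) = fs f0 n y"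
  by (induction n arbitrary: y) (simp_all add: Uop_cnj Vop_cnj)

text \<open>The iterates are real, so the series is real for real l. This determines the conjugate
  of the ground state at real k and with it a holomorphic substitute for that conjugate.\<close>

lemma Fs_real:
  assumes f0: "cI f0" "\<And>y. cnj (f0 y) = f0 y" and l: "l \<in> Lball" "cnj l = l" and y: "y \<in> {-1/2..1/2}"
  shows "cnj (Fs f0 l y) = Fs f0 l y"
proof -
  obtain C where C: "\<forall>y\<in>{-1/2..1/2}. norm (f0 y) \<le> C" using bounded_cI[OF f0(1)] by blast
  have Fb: "\<forall>n. \<forall>y\<in>{-1/2..1/2}. norm (fs f0 n y) \<le> C * (1 / amin) ^ n"
    using fs_bound[OF f0(1) C] by blast
  have "summable (\<lambda>n. (- l) ^ n * fs f0 n y)"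
    by (rule half_radius_series(4)[OF fs_cont[OF f0(1)] Fb amin(1) l(1) y])
  then have "(\<lambda>n. (- l) ^ n * fs f0 n y) sums Fs f0 l y" unfolding Fs_def by (rule summable_sums)
  then have "(\<lambda>n. cnj ((- l) ^ n * fs f0 n y)) sums cnj (Fs f0 l y)" by (simp only: sums_cnj)
  then have "(\<lambda>n. (- l) ^ n * fs f0 n y) sums cnj (Fs f0 l y)" using f0(2) l(2) by (simp add: fs_real)
  then show ?thesis unfolding Fs_def by (simp add: sums_iff)
qed

lemma
  assumes l: "l \<in> Lball" "cnj l = l" and y: "y \<in> {-1/2..1/2}"
  shows fC_real: "cnj (fC l y) = fC l y" and fS_real: "cnj (fS l y) = fS l y"
  unfolding fC_def fS_def
  by (rule Fs_real[OF C1_cont _ l y], simp add: C1_def) (rule Fs_real[OF A1_cont _ l y], simp add: A1_real)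

end

section \<open>The dispersion relation\<close>

text \<open>The strips from n - 1/2 to n + 3/2 are open, cover the line and contain a single break n
  + 1/2 each. There the two branches agree by the end condition.\<close>

lemma periodic_extension_cont:
  fixes h :: "complex \<Rightarrow> real \<Rightarrow> complex"
  assumes h: "continuous_on (S \<times> {-1/2..1/2}) (\<lambda>(z, y). h z y)"
    and ends: "\<And>z. z \<in> S \<Longrightarrow> h z (1/2) = h z (-1/2)" and S: "open S"
  shows "continuous_on (S \<times> UNIV) (\<lambda>(z, y). h z (y - of_int \<lfloor>y + 1/2\<rfloor>))"
proof -
  let ?hp = "\<lambda>(z, y). h z (y - of_int \<lfloor>y + 1/2\<rfloor>)"
  have piece: "continuous_on (S \<times> {of_int n - 1/2<..<of_int n + 3/2}) ?hp" for n :: int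
  proof -
    let ?T = "S \<times> {of_int n - 1/2<..<of_int n + 3/2 :: real}"
    have "continuous_on ?T (\<lambda>p. if snd p \<le> of_int n + 1/2 then h (fst p) (snd p - of_int n) else h (fst p) (snd p - of_int (n + 1)))"
    proof (rule continuous_on_cases_le)
      show "continuous_on {p \<in> ?T. snd p \<le> of_int n + 1/2} (\<lambda>p. h (fst p) (snd p - of_int n))"
      proof -
        have "continuous_on {p \<in> ?T. snd p \<le> of_int n + 1/2} (\<lambda>p. case (fst p, snd p - of_int n) of (z, y) \<Rightarrow> h z y)"
          by (rule continuous_on_compose2[OF h]) (intro continuous_intros, auto)
        then show ?thesis by (simp only: prod.case)
      qed
      show "continuous_on {p \<in> ?T. of_int n + 1/2 \<le> snd p} (\<lambda>p. h (fst p) (snd p - of_int (n + 1)))"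
      proof -
        have "continuous_on {p \<in> ?T. of_int n + 1/2 \<le> snd p} (\<lambda>p. case (fst p, snd p - of_int (n + 1)) of (z, y) \<Rightarrow> h z y)"
          by (rule continuous_on_compose2[OF h]) (intro continuous_intros, auto)
        then show ?thesis by (simp only: prod.case)
      qed
      show "h (fst p) (snd p - of_int n) = h (fst p) (snd p - of_int (n + 1))"
        if "p \<in> ?T" "snd p = of_int n + 1/2" for p
        using that ends[of "fst p"] by auto
    qed (intro continuous_intros)
    then show ?thesis
    proof (rule continuous_on_eq)
      fix p assume p: "p \<in> ?T"
      show "(if snd p \<le> of_int n + 1/2 then h (fst p) (snd p - of_int n) else h (fst p) (snd p - of_int (n + 1))) = ?hp p"
      proof (cases "snd p < of_int n + 1/2")
        case True
        then have "\<lfloor>snd p + 1/2\<rfloor> = n" using p by (intro floor_unique) auto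
        then show ?thesis using True by (simp add: case_prod_unfold)
      next
        case False
        then have f: "\<lfloor>snd p + 1/2\<rfloor> = n + 1" using p by (intro floor_unique) auto
        show ?thesis
        proof (cases "snd p = of_int n + 1/2")
          case True
          then show ?thesis using f ends[of "fst p"] p by (auto simp: case_prod_unfold)
        qed (use f False in \<open>simp add: case_prod_unfold\<close>)
      qed
    qed
  qed
  have "continuous_on (\<Union>n\<in>UNIV. S \<times> {of_int n - 1/2<..<of_int n + 3/2 :: real}) ?hp"
    by (rule continuous_on_open_UN) (use S piece in \<open>auto intro!: open_Times\<close>)
  moreover have "(\<Union>n\<in>UNIV. S \<times> {of_int n - 1/2<..<of_int n + 3/2 :: real}) = S \<times> UNIV"
  proof -
    have "y \<in> {of_int \<lfloor>y\<rfloor> - 1/2<..<of_int \<lfloor>y\<rfloor> + 3/2}" for y :: real by (simp; linarith)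
    then show ?thesis by blast
  qed
  ultimately show ?thesis by simp
qed

context bloch
begin

lemma ode_zero:
  assumes l: "l \<in> Lball"
    and f: "\<And>y. y \<in> {-1/2..1/2} \<Longrightarrow> (f has_vector_derivative p y / of_real (a y)) (at y within {-1/2..1/2})"
    and p: "\<And>y. y \<in> {-1/2..1/2} \<Longrightarrow> (p has_vector_derivative - l * f y) (at y within {-1/2..1/2})"
    and init: "f (-1/2) = 0" "p (-1/2) = 0" and y: "y \<in> {-1/2..1/2}"
  shows "f y = 0 \<and> p y = 0"
proof -
  have fc: "cI f" and pc: "cI p" by (rule continuous_on_vector_derivative[OF f], assumption) (rule continuous_on_vector_derivative[OF p])
  have sub: "(g has_vector_derivative g' x) (at x within {-1/2..y})"
    if "\<And>y. y \<in> {-1/2..1/2} \<Longrightarrow> (g has_vector_derivative g' y) (at y within {-1/2..1/2})" "y \<in> {-1/2..1/2}" "x \<in> {-1/2..y}"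
    for g :: "real \<Rightarrow> complex" and g' x y
    by (rule has_vector_derivative_within_subset[OF that(1)]) (use that(2,3) in auto)
  have fU: "f y = Uop p y" if y: "y \<in> {-1/2..1/2}" for y
  proof -
    have "((\<lambda>y. p y / of_real (a y)) has_integral (f y - f (-1/2))) {-1/2..y}"
      by (rule fundamental_theorem_of_calculus[OF _ sub[OF f y]]) (use y in auto)
    then show ?thesis using init by (simp add: Uop_def has_integral_iff)
  qed
  have pV: "p y = - l * Vop f y" if y: "y \<in> {-1/2..1/2}" for y
  proof -
    have "((\<lambda>y. - l * f y) has_integral (p y - p (-1/2))) {-1/2..y}"
      by (rule fundamental_theorem_of_calculus[OF _ sub[OF p y]]) (use y in auto)
    then show ?thesis using init by (simp add: Vop_def has_integral_iff)
  qed
  have "f y = - l * Uop (Vop f) y" if y: "y \<in> {-1/2..1/2}" for y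
  proof -
    have "Uop p y = Uop (\<lambda>y. - l * Vop f y) y"
      unfolding Uop_def by (rule integral_cong) (use y pV in auto)
    also have "\<dots> = - l * Uop (Vop f) y"
    proof -
      have "(\<lambda>z. - l * Vop f z / of_real (a z)) = (\<lambda>z. - l * (Vop f z / of_real (a z)))" by simp
      then show ?thesis unfolding Uop_def by (simp only: integral_mult_right)
    qed
    finally show ?thesis using fU[OF y] by simp
  qed
  then have z: "f y = 0" if "y \<in> {-1/2..1/2}" for y using zero_data_unique[OF l fc _ that] by blast
  have "Vop f y = 0" unfolding Vop_def
    using integral_cong[of "{-1/2..y}" f "\<lambda>_. 0"] z y by auto
  then show ?thesis using z[OF y] pV[OF y] by simp
qed

text \<open>Multiplication by exp(i k y) turns the shifted derivative into the ordinary one, so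
  eigenfunctions become solutions of the system solved by \<open>fC\<close> and
  \<open>fS\<close>.\<close>

lemma \<phi>_exp_deriv:
  assumes k: "k \<in> {-pi..pi}"
  shows "((\<lambda>y. exp (\<i> * of_real (k * y)) * \<phi> m k y) has_vector_derivative
      exp (\<i> * of_real (k * y)) * (of_real (a y) * shifted_deriv k (\<phi> m k) y) / of_real (a y)) (at y)"
    and "((\<lambda>y. exp (\<i> * of_real (k * y)) * (of_real (a y) * shifted_deriv k (\<phi> m k) y)) has_vector_derivative
      - of_real (ev m k) * (exp (\<i> * of_real (k * y)) * \<phi> m k y)) (at y)"
proof -
  note e = eig[OF k, of m, unfolded bloch_eigenfunction_def]
  let ?p = "\<lambda>z. of_real (a z) * shifted_deriv k (\<phi> m k) z"
  have ex: "((\<lambda>y. exp (\<i> * of_real (k * y))) has_vector_derivative \<i> * of_real k * exp (\<i> * of_real (k * y))) (at y)"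
  proof -
    have "((\<lambda>z. exp (\<i> * (of_real k * z))) has_field_derivative \<i> * of_real k * exp (\<i> * (of_real k * of_real y))) (at (of_real y))"
      by (auto intro!: derivative_eq_intros)
    from has_vector_derivative_real_field[OF this] show ?thesis by simp
  qed
  show "((\<lambda>y. exp (\<i> * of_real (k * y)) * \<phi> m k y) has_vector_derivative
      exp (\<i> * of_real (k * y)) * (of_real (a y) * shifted_deriv k (\<phi> m k) y) / of_real (a y)) (at y)"
  proof (rule has_vector_derivative_eq_rhs[OF has_vector_derivative_mult[OF ex cper_deriv[OF \<phi>_cper[OF k]]]])
    have c: "E * (of_real (a y) * D) / of_real (a y) = E * D" for E D :: complex using a_ne[of y] by simp
    show "exp (\<i> * of_real (k * y)) * vector_derivative (\<phi> m k) (at y) + \<i> * of_real k * exp (\<i> * of_real (k * y)) * \<phi> m k y =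
        exp (\<i> * of_real (k * y)) * (of_real (a y) * shifted_deriv k (\<phi> m k) y) / of_real (a y)"
      unfolding c shifted_deriv_def by (simp add: algebra_simps)
  qed
  have pd: "(?p has_vector_derivative vector_derivative ?p (at y)) (at y)"
    using e by (simp flip: vector_derivative_works)
  have "- shifted_deriv k ?p y = of_real (ev m k) * \<phi> m k y" using e by blast
  then have "shifted_deriv k ?p y = - (of_real (ev m k) * \<phi> m k y)" by (metis minus_minus)
  then have pe: "vector_derivative ?p (at y) = - (of_real (ev m k) * \<phi> m k y) - \<i> * of_real k * ?p y"
    unfolding shifted_deriv_def[of k ?p] by (metis add_diff_cancel_right')
  show "((\<lambda>y. exp (\<i> * of_real (k * y)) * ?p y) has_vector_derivative
      - of_real (ev m k) * (exp (\<i> * of_real (k * y)) * \<phi> m k y)) (at y)"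
    by (rule has_vector_derivative_eq_rhs[OF has_vector_derivative_mult[OF ex pd]])
      (unfold pe, simp add: algebra_simps)
qed

text \<open>The solution whose initial data (fS(1/2), e - fC(1/2)) form an eigenvector of the
  monodromy matrix for the multiplier e. It determines the eigenvector as long as fS(1/2) is
  nonzero.\<close>

definition Fz :: "complex \<Rightarrow> complex \<Rightarrow> real \<Rightarrow> complex" where
  "Fz l e y = fS l (1/2) * fC l y + (e - fC l (1/2)) * fS l y"

definition Pz :: "complex \<Rightarrow> complex \<Rightarrow> real \<Rightarrow> complex" where
  "Pz l e y = fS l (1/2) * pC l y + (e - fC l (1/2)) * pS l y"

text \<open>\<open>exp (i k y) * \<psi>\<^sub>0\<close> solves the ordinary differential equation with multiplier \<open>exp (i k)\<close>
  across a period, so it is an eigenvector of the monodromy matrix, whose determinant is 1.\<close>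

lemma ground_state_form:
  assumes k: "k \<in> {-pi..pi}" and l: "of_real (ev 0 k) \<in> Lball" and S1: "fS (of_real (ev 0 k)) (1/2) \<noteq> 0"
  defines "l \<equiv> complex_of_real (ev 0 k)" and "e \<equiv> exp (\<i> * of_real k)"
  shows "l * Dt l = 2 - 2 * cos (of_real k)"
    and "\<exists>\<kappa>. \<forall>y\<in>{-1/2..1/2}. exp (\<i> * of_real (k * y)) * \<phi> 0 k y = \<kappa> * Fz l e y \<and>
        exp (\<i> * of_real (k * y)) * (of_real (a y) * shifted_deriv k (\<phi> 0 k) y) = \<kappa> * Pz l e y"
proof -
  define f where "f = (\<lambda>y. exp (\<i> * of_real (k * y)) * \<phi> 0 k y)"
  define p where "p = (\<lambda>y. exp (\<i> * of_real (k * y)) * (of_real (a y) * shifted_deriv k (\<phi> 0 k) y))"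
  have lL: "l \<in> Lball" using l by (simp add: l_def)
  have S1': "fS l (1/2) \<noteq> 0" using S1 by (simp add: l_def)
  have fd: "(f has_vector_derivative p y / of_real (a y)) (at y within T)"
    and pd: "(p has_vector_derivative - l * f y) (at y within T)" for y T
    unfolding f_def p_def l_def by (rule has_vector_derivative_at_within, rule \<phi>_exp_deriv[OF k])+
  let ?f = "f (-1/2)" and ?p = "p (-1/2)"
  have rep: "f y = ?f * fC l y + ?p * fS l y \<and> p y = ?f * pC l y + ?p * pS l y" if y: "y \<in> {-1/2..1/2}" for y
  proof -
    have "f y - (?f * fC l y + ?p * fS l y) = 0 \<and> p y - (?f * pC l y + ?p * pS l y) = 0"
    proof (rule ode_zero[OF lL _ _ _ _ y])
      fix x :: real assume x: "x \<in> {-1/2..1/2}"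
      show "((\<lambda>y. f y - (?f * fC l y + ?p * fS l y)) has_vector_derivative (p x - (?f * pC l x + ?p * pS l x)) / of_real (a x)) (at x within {-1/2..1/2})"
        by (rule has_vector_derivative_eq_rhs[OF has_vector_derivative_diff[OF fd has_vector_derivative_add[OF
              has_vector_derivative_mult_right[OF fC_deriv[OF lL x]] has_vector_derivative_mult_right[OF fS_deriv[OF lL x]]]]])
          (simp add: diff_divide_distrib add_divide_distrib)
      show "((\<lambda>y. p y - (?f * pC l y + ?p * pS l y)) has_vector_derivative - l * (f x - (?f * fC l x + ?p * fS l x))) (at x within {-1/2..1/2})"
        by (rule has_vector_derivative_eq_rhs[OF has_vector_derivative_diff[OF pd has_vector_derivative_add[OF
              has_vector_derivative_mult_right[OF pC_deriv[OF lL x]] has_vector_derivative_mult_right[OF pS_deriv[OF lL x]]]]])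
          (simp add: algebra_simps)
    qed (unfold initial_values[OF lL], simp_all)
    then show ?thesis by simp
  qed
  have e2: "exp (\<i> * of_real (k * (1/2))) = e * exp (\<i> * of_real (k * (-1/2)))"
  proof -
    have "\<i> * of_real (k * (1/2)) = \<i> * of_real k + \<i> * of_real (k * (-1/2))" by (simp add: field_simps)
    then show ?thesis unfolding e_def by (simp only: exp_add)
  qed
  have \<phi>p: "\<phi> 0 k (1/2) = \<phi> 0 k (-1/2)" "shifted_deriv k (\<phi> 0 k) (1/2) = shifted_deriv k (\<phi> 0 k) (-1/2)" "a (1/2) = a (-1/2)"
    using \<phi>_cper[OF k, of 0, unfolded cper_def, THEN conjunct1, rule_format, of "-1/2"]
      shifted_deriv_periodic[OF \<phi>_cper[OF k], of k 0 "-1/2"] a_per[of "-1/2"] by simp_all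
  have qf: "f (1/2) = e * ?f" and qp: "p (1/2) = e * ?p"
    unfolding f_def p_def e2 \<phi>p by simp_all
  have m1: "?f * fC l (1/2) + ?p * fS l (1/2) = e * ?f" and m2: "?f * pC l (1/2) + ?p * pS l (1/2) = e * ?p"
    using rep[of "1/2"] qf qp by simp_all
  \<comment> \<open>If the initial value vanished, so would the initial flux, since fS(1/2) is
    nonzero. The eigenfunction would then be 0 on a period, contrary to its norm 1.\<close>
  have f0: "?f \<noteq> 0"
  proof
    assume 0: "?f = 0"
    then have "?p = 0" using m1 S1' by simp
    then have "f y = 0" if "y \<in> {-1/2..1/2}" for y using rep[OF that] 0 by simp
    then have "\<phi> 0 k y = 0" if "y \<in> {-1/2..1/2}" for y using that by (simp add: f_def)
    then have "ip (\<phi> 0 k) (\<phi> 0 k) = 0" unfolding wip_def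
      using integral_cong[of "{-1/2..1/2}" "\<lambda>y. complex_of_real 1 * \<phi> 0 k y * cnj (\<phi> 0 k y)" "\<lambda>_. 0"] by simp
    then show False using \<phi>_orth[OF k, of 0 0] by simp
  qed
  have det: "fC l (1/2) * pS l (1/2) - fS l (1/2) * pC l (1/2) = 1" by (rule Wronskian[OF lL]) simp
  \<comment> \<open>The characteristic equation e^2 - trace * e + 1 = 0: the initial flux is
    eliminated from \<open>m1\<close> and \<open>m2\<close>, the nonzero initial value cancels, and
    the determinant is 1.\<close>
  have tr: "e * (fC l (1/2) + pS l (1/2)) = e * e + 1"
  proof -
    let ?C = "fC l (1/2)" and ?S = "fS l (1/2)" and ?PC = "pC l (1/2)" and ?PS = "pS l (1/2)"
    have "?f * (?PC * ?S) = (e - ?PS) * (?p * ?S)" using m2 by algebra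
    also have "?p * ?S = (e - ?C) * ?f" using m1 by algebra
    finally have "?f * (?PC * ?S - (e - ?PS) * (e - ?C)) = 0" by algebra
    then have "?PC * ?S = (e - ?PS) * (e - ?C)" using f0 by simp
    then show ?thesis using det by algebra
  qed
  have e0: "e \<noteq> 0" by (simp add: e_def)
  have "2 * cos (of_real k) = e + inverse e"
    unfolding e_def cos_exp_eq by (simp add: exp_minus)
  moreover have "fC l (1/2) + pS l (1/2) = e + inverse e"
    using tr e0 by (simp add: field_simps)
  ultimately show "l * Dt l = 2 - 2 * cos (of_real k)"
    using trace_eq[OF lL] by (simp add: diff_eq_eq eq_diff_eq add.commute)
  \<comment> \<open>The initial flux is fixed by the initial value, so the wave is known up to one
    scalar without any assumption that the lowest eigenvalue is simple.\<close>
  have pp: "?p = ?f / fS l (1/2) * (e - fC l (1/2))" using m1 S1' by (simp add: field_simps)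
  have "f y = ?f / fS l (1/2) * Fz l e y \<and> p y = ?f / fS l (1/2) * Pz l e y" if "y \<in> {-1/2..1/2}" for y
    using rep[OF that] S1' unfolding Fz_def Pz_def pp by (simp add: distrib_left)
  then show "\<exists>\<kappa>. \<forall>y\<in>{-1/2..1/2}. exp (\<i> * of_real (k * y)) * \<phi> 0 k y = \<kappa> * Fz l e y \<and>
        exp (\<i> * of_real (k * y)) * (of_real (a y) * shifted_deriv k (\<phi> 0 k) y) = \<kappa> * Pz l e y"
    unfolding f_def p_def by blast
qed

text \<open>Writing \<open>l = w\<^sup>2\<close>, the dispersion relation \<open>l * Dt l = 4 sin\<^sup>2(k/2)\<close> takes a square root
  \<open>w * csqrt (Dt (w\<^sup>2)) = 2 sin(k/2)\<close> that is invertible near \<open>0\<close>.\<close>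

lemma frequency_branch:
  obtains \<rho> wh where "0 < \<rho>" "wh holomorphic_on ball 0 \<rho>" "wh 0 = 0"
    "\<And>z. z \<in> ball 0 \<rho> \<Longrightarrow> (wh z)\<^sup>2 \<in> Lball"
    "\<And>z. z \<in> ball 0 \<rho> \<Longrightarrow> (wh z)\<^sup>2 * Dt ((wh z)\<^sup>2) = 2 - 2 * cos z"
    "\<And>k x. \<bar>k\<bar> < \<rho> \<Longrightarrow> of_real (x\<^sup>2) * Dt (of_real (x\<^sup>2)) = 2 - 2 * cos (of_real k) \<Longrightarrow> \<bar>x\<bar> \<le> \<bar>k\<bar> * sqrt amean
        \<Longrightarrow> complex_of_real x = wh (of_real k) \<or> complex_of_real x = - wh (of_real k)"
proof -
  obtain d where d: "0 < d" "Dt 0 = of_real d" using Dt_0 by blast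
  have "isCont Dt 0"
    using holomorphic_on_imp_continuous_on[OF Dt_hol] Lball_0 by (simp add: continuous_on_eq_continuous_at)
  then have "Dt \<midarrow>0\<rightarrow> Dt 0" by (simp add: isCont_def)
  from LIM_D[OF this d(1)] obtain r1 where r1': "0 < r1" "\<And>z. z \<noteq> 0 \<Longrightarrow> norm (z - 0) < r1 \<Longrightarrow> norm (Dt z - Dt 0) < d"
    by blast
  have r1: "0 < r1" "\<And>l. norm l < r1 \<Longrightarrow> dist (Dt l) (Dt 0) < d"
  proof -
    show "dist (Dt z) (Dt 0) < d" if "norm z < r1" for z
    proof (cases "z = 0")
      case True then show ?thesis using d(1) by simp
    next
      case False then show ?thesis using r1'(2)[OF False] that by (simp add: dist_norm)
    qed
  qed (rule r1'(1))
  have Rep: "0 < Re (Dt l)" if "norm l < r1" for l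
    using r1(2)[OF that] d abs_Re_le_cmod[of "Dt l - Dt 0"] by (auto simp: dist_norm)
  define r2 where "r2 = min r1 (amin / 2)"
  define r where "r = sqrt r2"
  have r2: "0 < r2" using r1 amin(1) by (simp add: r2_def)
  have r: "0 < r" "r\<^sup>2 = r2" using r2 by (auto simp: r_def)
  have wsq: "norm (w\<^sup>2) < r2" if "w \<in> ball 0 r" for w :: complex
    using that r power_strict_mono[of "norm w" r 2] by (simp add: norm_power)
  define Vm where "Vm = (\<lambda>w. w * csqrt (Dt (w\<^sup>2)))"
  have Dhol: "(\<lambda>w. Dt (w\<^sup>2)) holomorphic_on ball 0 r"
  proof -
    have "(Dt \<circ> (\<lambda>w. w\<^sup>2)) holomorphic_on ball 0 r"
    proof (rule holomorphic_on_compose_gen[OF _ Dt_hol])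
      show "(\<lambda>w. w\<^sup>2) ` ball 0 r \<subseteq> Lball"
      proof
        fix l assume "l \<in> (\<lambda>w::complex. w\<^sup>2) ` ball 0 r"
        then obtain w where "w \<in> ball 0 r" "l = w\<^sup>2" by blast
        then show "l \<in> Lball" using wsq[of w] by (simp add: r2_def)
      qed
    qed (intro holomorphic_intros)
    then show ?thesis by (simp only: o_def)
  qed
  have cs: "(\<lambda>w. csqrt (Dt (w\<^sup>2))) holomorphic_on ball 0 r"
  proof (rule holomorphic_on_csqrt'[OF Dhol])
    fix w :: complex assume "w \<in> ball 0 r"
    then have "0 < Re (Dt (w\<^sup>2))" using wsq[of w] by (intro Rep) (simp add: r2_def)
    then show "Dt (w\<^sup>2) \<notin> \<real>\<^sub>\<le>\<^sub>0" by (simp add: complex_nonpos_Reals_iff)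
  qed
  have Vhol: "Vm holomorphic_on ball 0 r"
    unfolding Vm_def by (intro holomorphic_intros cs)
  have V0: "Vm 0 = 0" by (simp add: Vm_def)
  \<comment> \<open>By the product rule the derivative is \<open>csqrt (Dt 0)\<close>. Passing to
    the root matters: l \<open>Dt l\<close> has a double zero as a function of w and could not be
    inverted there.\<close>
  have Vd: "deriv Vm 0 \<noteq> 0"
  proof -
    have "((\<lambda>w. w * csqrt (Dt (w\<^sup>2))) has_field_derivative (1 * csqrt (Dt (0\<^sup>2)) + deriv (\<lambda>w. csqrt (Dt (w\<^sup>2))) 0 * 0)) (at 0)"
      by (rule DERIV_mult[OF DERIV_ident holomorphic_derivI[OF cs open_ball]]) (use r in simp)
    then have "deriv Vm 0 = csqrt (Dt 0)" unfolding Vm_def by (simp add: DERIV_imp_deriv)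
    then show ?thesis using d by simp
  qed
  have Vsq: "(Vm w)\<^sup>2 = w\<^sup>2 * Dt (w\<^sup>2)" for w by (simp add: Vm_def power_mult_distrib)
  have Vodd: "Vm (- w) = - Vm w" for w by (simp add: Vm_def)
  obtain s where s: "0 < s" "ball (0::complex) s \<subseteq> ball 0 r" "open (Vm ` ball 0 s)" "inj_on Vm (ball 0 s)"
    using has_complex_derivative_locally_invertible[OF Vhol _ open_ball Vd] r by auto
  obtain g where g1: "g holomorphic_on (Vm ` ball 0 s)" and "\<And>w. w \<in> ball 0 s \<Longrightarrow> deriv Vm w * deriv g (Vm w) = 1"
      and g2: "\<And>w. w \<in> ball 0 s \<Longrightarrow> g (Vm w) = w"
    by (rule holomorphic_has_inverse[OF holomorphic_on_subset[OF Vhol s(2)] open_ball s(4)]) (rule that)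
  note g = g1 g2
  have V00: "0 \<in> Vm ` ball 0 s" using imageI[of 0 "ball 0 s" Vm] s(1) V0 by simp
  obtain t where t: "0 < t" "ball 0 t \<subseteq> Vm ` ball 0 s"
    by (rule openE[OF s(3) V00]) (rule that)
  define sn where "sn = (\<lambda>z::complex. 2 * sin (z / 2))"
  have "(sn \<longlongrightarrow> 2 * sin (0 / 2)) (at 0)" unfolding sn_def by (intro tendsto_intros) simp
  then have "sn \<midarrow>0\<rightarrow> 0" by simp
  from LIM_D[OF this t(1)] obtain \<rho>1 where \<rho>1': "0 < \<rho>1" "\<And>z. z \<noteq> 0 \<Longrightarrow> norm (z - 0) < \<rho>1 \<Longrightarrow> norm (sn z - 0) < t"
    by blast
  have \<rho>1: "0 < \<rho>1" "\<And>z. norm z < \<rho>1 \<Longrightarrow> norm (sn z) < t"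
  proof -
    show "norm (sn z) < t" if "norm z < \<rho>1" for z
    proof (cases "z = 0")
      case True then show ?thesis using t(1) by (simp add: sn_def)
    next
      case False then show ?thesis using \<rho>1'(2)[OF False] that by simp
    qed
  qed (rule \<rho>1'(1))
  \<comment> \<open>The second bound forces any x with |x| \<le> |k| \<open>sqrt amean\<close> into
    the ball of radius s where \<open>Vm\<close> is injective; the + 1 avoids division by 0.\<close>
  define \<rho> where "\<rho> = min \<rho>1 (s / (sqrt amean + 1))"
  have sa: "0 < sqrt amean + 1" using amean_nonneg by (simp add: add_nonneg_pos)
  have \<rho>: "0 < \<rho>" using \<rho>1 s(1) sa by (simp add: \<rho>_def)
  define wh where "wh = (\<lambda>z. g (sn z))"
  have snV: "sn z \<in> Vm ` ball 0 s" if "z \<in> ball 0 \<rho>" for z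
    using t(2) \<rho>1(2)[of z] that by (auto simp: \<rho>_def)
  have wh: "wh z \<in> ball 0 s" "Vm (wh z) = sn z" if z: "z \<in> ball 0 \<rho>" for z
    using snV[OF z] g(2) by (auto simp: wh_def)
  have whhol: "wh holomorphic_on ball 0 \<rho>"
  proof -
    have "(g \<circ> sn) holomorphic_on ball 0 \<rho>"
    proof (rule holomorphic_on_compose_gen[OF _ g(1)])
      show "sn ` ball 0 \<rho> \<subseteq> Vm ` ball 0 s" using snV by blast
      show "sn holomorphic_on ball 0 \<rho>" unfolding sn_def by (intro holomorphic_intros) auto
    qed
    then show ?thesis by (simp only: wh_def o_def)
  qed
  have sn2: "(sn z)\<^sup>2 = 2 - 2 * cos z" for z
  proof -
    have "cos (2 * (z / 2)) = 2 * (cos (z / 2))\<^sup>2 - 1" by (rule cos_double_cos)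
    then have "cos z = 1 - 2 * (sin (z / 2))\<^sup>2" by (simp add: cos_squared_eq)
    then show ?thesis unfolding sn_def by (simp add: power_mult_distrib)
  qed
  show ?thesis
  proof (rule that[OF \<rho> whhol])
    show "wh 0 = 0" using g(2)[of 0] s(1) V0 by (simp add: wh_def sn_def)
    show "(wh z)\<^sup>2 \<in> Lball" if z: "z \<in> ball 0 \<rho>" for z
      using wsq[of "wh z"] wh(1)[OF z] s(2) by (auto simp: r2_def)
    show "(wh z)\<^sup>2 * Dt ((wh z)\<^sup>2) = 2 - 2 * cos z" if z: "z \<in> ball 0 \<rho>" for z
      unfolding Vsq[symmetric] wh(2)[OF z] by (rule sn2)
    show "complex_of_real x = wh (of_real k) \<or> complex_of_real x = - wh (of_real k)"
      if k: "\<bar>k\<bar> < \<rho>" and eq: "of_real (x\<^sup>2) * Dt (of_real (x\<^sup>2)) = 2 - 2 * cos (of_real k)" and xb: "\<bar>x\<bar> \<le> \<bar>k\<bar> * sqrt amean"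
      for k x
    proof -
      have "\<bar>k\<bar> * sqrt amean \<le> \<bar>k\<bar> * (sqrt amean + 1)" by (intro mult_left_mono) auto
      also have "\<dots> < s / (sqrt amean + 1) * (sqrt amean + 1)"
        using k sa by (intro mult_strict_right_mono) (auto simp: \<rho>_def)
      also have "\<dots> = s" using sa by simp
      finally have xs: "of_real x \<in> ball (0::complex) s" "- of_real x \<in> ball (0::complex) s" using xb by auto
      have "(Vm (of_real x))\<^sup>2 = (sn (of_real k))\<^sup>2" using eq unfolding Vsq sn2 by simp
      \<comment> \<open>Only squares are known to agree, so both signs occur; oddness of
        \<open>Vm\<close> moves the sign onto \<open>wh\<close>.\<close>
      then consider "Vm (of_real x) = sn (of_real k)" | "Vm (of_real x) = - sn (of_real k)"
        unfolding power2_eq_iff by blast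
      then show ?thesis
      proof cases
        case 1
        then show ?thesis using g(2)[OF xs(1)] unfolding wh_def by simp
      next
        case 2
        then have "Vm (- of_real x) = sn (of_real k)" unfolding Vodd by simp
        then have "- of_real x = wh (of_real k)" using g(2)[OF xs(2)] unfolding wh_def by simp
        moreover have "complex_of_real x = - (- complex_of_real x)" by simp
        ultimately have "complex_of_real x = - wh (of_real k)" by (simp only:)
        then show ?thesis ..
      qed
    qed
  qed
qed

end

section \<open>The analytic ground state\<close>

lemma nonzero_ball:
  fixes f :: "complex \<Rightarrow> complex"
  assumes "continuous_on S f" "open S" "0 \<in> S" "f 0 \<noteq> 0"
  obtains r where "0 < r" "ball 0 r \<subseteq> S" "\<And>z. z \<in> ball 0 r \<Longrightarrow> f z \<noteq> 0"
proof -
  have "open (S \<inter> f -` (- {0}))"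
    by (rule continuous_open_preimage[OF assms(1,2)]) (rule open_Compl[OF closed_singleton])
  moreover have "0 \<in> S \<inter> f -` (- {0})" using assms by simp
  ultimately obtain r where "0 < r" "ball 0 r \<subseteq> S \<inter> f -` (- {0})" by (rule openE)
  then show ?thesis by (intro that[of r]) auto
qed

context bloch
begin

lemma compose_cont:
  assumes "continuous_on (Lball \<times> {-1/2..1/2}) (\<lambda>(l, y). F l y)" "continuous_on S L" "L ` S \<subseteq> Lball"
  shows "continuous_on (S \<times> {-1/2..1/2}) (\<lambda>p. F (L (fst p)) (snd p))"
proof -
  have "continuous_on (S \<times> {-1/2..1/2}) (\<lambda>p. case (L (fst p), snd p) of (l, y) \<Rightarrow> F l y)"
  proof (rule continuous_on_compose2[OF assms(1)])
    show "continuous_on (S \<times> {-1/2..1/2}) (\<lambda>p. (L (fst p), snd p))"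
      by (intro continuous_on_Pair continuous_on_compose2[OF assms(2)] continuous_on_fst continuous_on_snd continuous_on_id) auto
  qed (use assms(3) in auto)
  then show ?thesis by (simp only: prod.case)
qed

lemma compose_hol:
  assumes "f holomorphic_on Lball" "L holomorphic_on S" "L ` S \<subseteq> Lball"
  shows "(\<lambda>z. f (L z)) holomorphic_on S"
  using holomorphic_on_compose_gen[OF assms(2,1,3)] by (simp only: o_def)

text \<open>By \<open>ground_state_form\<close> the ground state is an unknown multiple \<kappa> of
  an explicit analytic function. In b_0 times the flux the scalar enters only as |\<kappa>|^2, which
  the normalisation determines; hence this product, unlike its factors, extends
  holomorphically.\<close>

lemma ground_state_analytic:
  obtains \<rho> wh H where "0 < \<rho>" "\<rho> \<le> 1/4" "wh holomorphic_on ball 0 \<rho>" "wh 0 = 0"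
    "\<And>k. \<bar>k\<bar> < \<rho> \<Longrightarrow> complex_of_real (\<omega> 0 k) = wh (of_real k) \<or> complex_of_real (\<omega> 0 k) = - wh (of_real k)"
    "continuous_on (ball 0 \<rho> \<times> UNIV) (\<lambda>(z, y). H z y)"
    "\<And>y. (\<lambda>z. H z y) holomorphic_on ball 0 \<rho>"
    "\<And>z y. H z (y + 1) = H z y" "\<And>y. H 0 y = 0"
    "\<And>k y. \<bar>k\<bar> < \<rho> \<Longrightarrow> b 0 k * (of_real (a y) * shifted_deriv k (\<phi> 0 k) y) = H (of_real k) y"
proof -
  obtain \<rho>0 wh where \<rho>0: "0 < \<rho>0" and whhol: "wh holomorphic_on ball 0 \<rho>0" and wh0: "wh 0 = 0"
    and whL: "\<And>z. z \<in> ball 0 \<rho>0 \<Longrightarrow> (wh z)\<^sup>2 \<in> Lball"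
    and whD: "\<And>z. z \<in> ball 0 \<rho>0 \<Longrightarrow> (wh z)\<^sup>2 * Dt ((wh z)\<^sup>2) = 2 - 2 * cos z"
    and whk: "\<And>k x. \<bar>k\<bar> < \<rho>0 \<Longrightarrow> of_real (x\<^sup>2) * Dt (of_real (x\<^sup>2)) = 2 - 2 * cos (of_real k) \<Longrightarrow> \<bar>x\<bar> \<le> \<bar>k\<bar> * sqrt amean
        \<Longrightarrow> complex_of_real x = wh (of_real k) \<or> complex_of_real x = - wh (of_real k)"
    by (rule frequency_branch) (rule that)
  define L where "L = (\<lambda>z. (wh z)\<^sup>2)"
  have Lhol: "L holomorphic_on ball 0 \<rho>0" unfolding L_def by (intro holomorphic_intros whhol)
  have Lsub: "L ` ball 0 \<rho>0 \<subseteq> Lball" using whL by (auto simp: L_def)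
  have Lc: "continuous_on (ball 0 \<rho>0) L" by (rule holomorphic_on_imp_continuous_on[OF Lhol])
  have L0: "L 0 = 0" by (simp add: L_def wh0)
  have half: "1/2 \<in> {-1/2..1/2::real}" by simp
  define C1z S1z where "C1z = (\<lambda>z. fC (L z) (1/2))" and "S1z = (\<lambda>z. fS (L z) (1/2))"
  have C1h: "C1z holomorphic_on ball 0 \<rho>0" and S1h: "S1z holomorphic_on ball 0 \<rho>0"
    unfolding C1z_def S1z_def by (rule compose_hol[OF fC_hol[OF half] Lhol Lsub], rule compose_hol[OF fS_hol[OF half] Lhol Lsub])
  define F where "F = (\<lambda>z y. S1z z * fC (L z) y + (exp (\<i> * z) - C1z z) * fS (L z) y)"
  \<comment> \<open>The conjugate of \<open>F\<close> for real z, where the fundamental system is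
    real and conjugation merely inverts exp(i z). Written this way it remains holomorphic for
    complex z.\<close>
  define Fm where "Fm = (\<lambda>z y. S1z z * fC (L z) y + (exp (- (\<i> * z)) - C1z z) * fS (L z) y)"
  define P where "P = (\<lambda>z y. S1z z * pC (L z) y + (exp (\<i> * z) - C1z z) * pS (L z) y)"
  note cc = compose_cont[OF fC_cont Lc Lsub] compose_cont[OF fS_cont Lc Lsub] compose_cont[OF pC_cont Lc Lsub] compose_cont[OF pS_cont Lc Lsub]
  have fstc: "continuous_on (ball 0 \<rho>0 \<times> {-1/2..1/2::real}) (\<lambda>p. f (fst p))" if "f holomorphic_on ball 0 \<rho>0" for f :: "complex \<Rightarrow> complex"
    by (rule continuous_on_compose2[OF holomorphic_on_imp_continuous_on[OF that] continuous_on_fst[OF continuous_on_id]]) auto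
  have eh: "(\<lambda>z. exp (\<i> * z)) holomorphic_on S" "(\<lambda>z. exp (- (\<i> * z))) holomorphic_on S" for S
    by (intro holomorphic_intros)+
  have Fc: "continuous_on (ball 0 \<rho>0 \<times> {-1/2..1/2}) (\<lambda>(z, y). F z y)"
    and Fmc: "continuous_on (ball 0 \<rho>0 \<times> {-1/2..1/2}) (\<lambda>(z, y). Fm z y)"
    and Pc: "continuous_on (ball 0 \<rho>0 \<times> {-1/2..1/2}) (\<lambda>(z, y). P z y)"
    unfolding F_def Fm_def P_def case_prod_unfold
    by (intro continuous_on_add continuous_on_mult continuous_on_diff cc fstc[OF C1h] fstc[OF S1h] fstc[OF eh(1)] fstc[OF eh(2)])+
  have Fh: "(\<lambda>z. F z y) holomorphic_on ball 0 \<rho>0" "(\<lambda>z. Fm z y) holomorphic_on ball 0 \<rho>0" "(\<lambda>z. P z y) holomorphic_on ball 0 \<rho>0"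
    if y: "y \<in> {-1/2..1/2}" for y
    unfolding F_def Fm_def P_def
    by (intro holomorphic_on_add holomorphic_on_mult holomorphic_on_diff C1h S1h eh
        compose_hol[OF fC_hol[OF y] Lhol Lsub] compose_hol[OF fS_hol[OF y] Lhol Lsub]
        compose_hol[OF pC_hol[OF y] Lhol Lsub] compose_hol[OF pS_hol[OF y] Lhol Lsub])+
  \<comment> \<open>For real k the norm identity becomes 1 = |\<kappa>|^2 \<open>Nz\<close>, and
    \<beta> plays the part of b_0 with the conjugate of \<kappa> removed.\<close>
  define Nz where "Nz = (\<lambda>z. integral {-1/2..1/2} (\<lambda>y. Fm z y * F z y))"
  define \<beta> where "\<beta> = (\<lambda>z. integral {-1/2..1/2} (\<lambda>y. Fm z y * exp (\<i> * z * of_real y)))"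
  have Nh: "Nz holomorphic_on ball 0 \<rho>0"
    unfolding Nz_def
  proof (rule integral_param_holomorphic)
    show "continuous_on (ball 0 \<rho>0 \<times> {-1/2..1/2}) (\<lambda>(z, t). Fm z t * F z t)"
      using continuous_on_mult[OF Fmc Fc] by (simp add: case_prod_unfold)
  qed (auto intro!: holomorphic_on_mult Fh)
  have ec: "continuous_on S (\<lambda>(z, t). exp (c * z * complex_of_real t))" for S c
    unfolding case_prod_unfold by (intro continuous_intros)
  have \<beta>h: "\<beta> holomorphic_on ball 0 \<rho>0"
    unfolding \<beta>_def
  proof (rule integral_param_holomorphic)
    show "continuous_on (ball 0 \<rho>0 \<times> {-1/2..1/2}) (\<lambda>(z, t). Fm z t * exp (\<i> * z * of_real t))"
      using continuous_on_mult[OF Fmc ec[of _ \<i>]] by (simp add: case_prod_unfold)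
    show "(\<lambda>z. Fm z t * exp (\<i> * z * of_real t)) holomorphic_on ball 0 \<rho>0" if "t \<in> {-1/2..1/2}" for t
      by (intro holomorphic_on_mult Fh that holomorphic_intros)
  qed simp
  have "Nz 0 = (A1 (1/2))\<^sup>2"
    unfolding Nz_def F_def Fm_def S1z_def C1z_def L0 at_0 by (simp add: power2_eq_square)
  then have N0: "Nz 0 \<noteq> 0" using A1_half by simp
  obtain \<rho>1 where \<rho>1: "0 < \<rho>1" "ball (0::complex) \<rho>1 \<subseteq> ball 0 \<rho>0" "\<And>z. z \<in> ball 0 \<rho>1 \<Longrightarrow> Nz z \<noteq> 0"
    by (rule nonzero_ball[OF holomorphic_on_imp_continuous_on[OF Nh] open_ball _ N0]) (use \<rho>0 in simp, rule that)
  obtain r3 where r3: "0 < r3" "ball 0 r3 \<subseteq> Lball" "\<And>l. l \<in> ball 0 r3 \<Longrightarrow> fS l (1/2) \<noteq> 0"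
    by (rule nonzero_ball[OF holomorphic_on_imp_continuous_on[OF fS_hol[OF half]] open_ball Lball_0])
      (use A1_half that at_0 in auto)
  \<comment> \<open>The last bound, with k^2 \<le> |k|, keeps the lowest eigenvalue inside the ball
    of radius \<open>r3\<close> on which fS(1/2) does not vanish; the others give \<open>Nz\<close>
    nonzero and \<rho> \<le> 1/4.\<close>
  define \<rho> where "\<rho> = min (min \<rho>1 (1/4)) (r3 / (amean + 1))"
  have am: "0 < amean + 1" using amean_nonneg by simp
  have "\<rho> \<le> min \<rho>1 (1/4)" unfolding \<rho>_def by (rule min.cobounded1)
  moreover have "0 < \<rho>" using \<rho>1(1) r3(1) am by (simp add: \<rho>_def)
  ultimately have \<rho>: "0 < \<rho>" "\<rho> \<le> 1/4" "\<rho> \<le> \<rho>1" by simp_all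
  have sub: "ball 0 \<rho> \<subseteq> ball (0::complex) \<rho>0" by (rule subset_trans[OF subset_ball[OF \<rho>(3)] \<rho>1(2)])
  have sub1: "ball 0 \<rho> \<subseteq> ball (0::complex) \<rho>1" using \<rho>(3) by (rule subset_ball)
  define h where "h = (\<lambda>z y. \<beta> z * exp ((- \<i>) * z * of_real y) * P z y / Nz z)"
  define H where "H = (\<lambda>z y. h z (y - of_int \<lfloor>y + 1/2\<rfloor>))"
  have Nnz: "Nz z \<noteq> 0" if "z \<in> ball 0 \<rho>" for z by (rule \<rho>1(3)[OF subsetD[OF sub1 that]])
  have hc: "continuous_on (ball 0 \<rho> \<times> {-1/2..1/2}) (\<lambda>(z, y). h z y)"
  proof -
    have s: "ball (0::complex) \<rho> \<times> {-1/2..1/2::real} \<subseteq> ball 0 \<rho>0 \<times> {-1/2..1/2}" using sub by blast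
    show ?thesis
      unfolding h_def case_prod_unfold
      by (intro continuous_on_divide continuous_on_mult continuous_on_subset[OF fstc[OF \<beta>h] s] continuous_on_subset[OF fstc[OF Nh] s]
          continuous_on_subset[OF Pc[unfolded case_prod_unfold] s] ec[of _ "- \<i>", unfolded case_prod_unfold]) (use Nnz in auto)
  qed
  have hh: "(\<lambda>z. h z y) holomorphic_on ball 0 \<rho>" if y: "y \<in> {-1/2..1/2}" for y
    unfolding h_def
    by (intro holomorphic_on_divide holomorphic_on_mult holomorphic_on_subset[OF \<beta>h sub] holomorphic_on_subset[OF Nh sub]
        holomorphic_on_subset[OF Fh(3)[OF y] sub] holomorphic_intros Nnz)
  \<comment> \<open>Across a period \<open>P\<close> gains the factor exp(i z), by the trace and
    determinant relations, and the exponential in \<open>h\<close> loses it.\<close>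
  have ends: "h z (1/2) = h z (-1/2)" if z: "z \<in> ball 0 \<rho>" for z
  proof -
    have z0: "z \<in> ball 0 \<rho>0" using z sub by blast
    have lL: "L z \<in> Lball" using whL[OF z0] by (simp add: L_def)
    let ?e = "exp (\<i> * z)" and ?C = "fC (L z) (1/2)" and ?S = "fS (L z) (1/2)" and ?PC = "pC (L z) (1/2)" and ?PS = "pS (L z) (1/2)"
    have e0: "?e \<noteq> 0" by simp
    have "?C + ?PS = 2 * cos z" using trace_eq[OF lL] whD[OF z0] by (simp add: L_def)
    also have "\<dots> = ?e + inverse ?e" unfolding cos_exp_eq by (simp add: exp_minus)
    finally have tr: "?e * (?C + ?PS) = ?e * ?e + 1" using e0 by (simp add: field_simps)
    have det: "?C * ?PS - ?S * ?PC = 1" by (rule Wronskian[OF lL half])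
    have Pm: "P z (-1/2) = ?e - ?C"
      unfolding P_def C1z_def S1z_def initial_values[OF lL] by simp
    have Pp: "P z (1/2) = ?e * (?e - ?C)"
      unfolding P_def C1z_def S1z_def using tr det by algebra
    have eq: "exp ((- \<i>) * z * of_real (1/2)) * ?e = exp ((- \<i>) * z * of_real (-1/2))"
    proof -
      have "(- \<i>) * z * of_real (1/2) + \<i> * z = (- \<i>) * z * of_real (-1/2)" by (simp add: field_simps)
      then show ?thesis by (simp only: exp_add[symmetric])
    qed
    show ?thesis unfolding h_def Pm Pp eq[symmetric] by (simp only: mult.assoc)
  qed
  show ?thesis
  proof (rule that[OF \<rho>(1,2) holomorphic_on_subset[OF whhol sub] wh0])
    show "continuous_on (ball 0 \<rho> \<times> UNIV) (\<lambda>(z, y). H z y)"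
      unfolding H_def by (rule periodic_extension_cont[OF hc ends open_ball])
    have red: "y - of_int \<lfloor>y + 1/2\<rfloor> \<in> {-1/2..1/2}" for y :: real by (simp; linarith)
    show "(\<lambda>z. H z y) holomorphic_on ball 0 \<rho>" for y
      unfolding H_def by (rule hh[OF red])
    show "H z (y + 1) = H z y" for z y
    proof -
      have "\<lfloor>y + 1 + 1/2\<rfloor> = \<lfloor>y + 1/2\<rfloor> + 1" by linarith
      then show ?thesis by (simp add: H_def)
    qed
    show "H 0 y = 0" for y
      unfolding H_def h_def P_def C1z_def S1z_def L0 at_0 by simp
    fix k :: real assume k: "\<bar>k\<bar> < \<rho>"
    have kp: "k \<in> {-pi..pi}" using k \<rho>(2) pi_gt3 by auto
    have evb: "ev 0 k < r3"
    proof -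
      have "ev 0 k \<le> k\<^sup>2 * amean" by (rule ev0_bound[OF kp])
      also have "\<dots> \<le> \<bar>k\<bar> * (amean + 1)"
      proof (intro mult_mono)
        have "\<bar>k\<bar> * \<bar>k\<bar> \<le> \<bar>k\<bar> * 1" using k \<rho>(2) by (intro mult_left_mono) auto
        then show "k\<^sup>2 \<le> \<bar>k\<bar>" by (simp add: power2_eq_square)
      qed (use amean_nonneg in auto)
      also have "\<dots> < r3 / (amean + 1) * (amean + 1)"
        using k am by (intro mult_strict_right_mono) (auto simp: \<rho>_def)
      finally show ?thesis using am by simp
    qed
    let ?l = "complex_of_real (ev 0 k)"
    have lr3: "?l \<in> ball 0 r3" using evb by (simp only: mem_ball dist_0_norm norm_of_real abs_power2)
    have lL: "?l \<in> Lball" using r3(2) lr3 by blast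
    note gs = ground_state_form[OF kp lL r3(3)[OF lr3]]
    have k0: "\<bar>k\<bar> < \<rho>0" "of_real k \<in> ball (0::complex) \<rho>" using k sub by (auto simp: subset_iff dest: spec[of _ "complex_of_real k"])
    show whk': "complex_of_real (\<omega> 0 k) = wh (of_real k) \<or> complex_of_real (\<omega> 0 k) = - wh (of_real k)"
    proof (rule whk[OF k0(1) gs(1)])
      have "\<omega> 0 k \<le> sqrt (k\<^sup>2 * amean)" using ev0_bound[OF kp] by (intro real_le_rsqrt)
      then show "\<bar>\<omega> 0 k\<bar> \<le> \<bar>k\<bar> * sqrt amean" using \<omega>_nonneg[OF kp, of 0] by (simp add: real_sqrt_mult)
    qed
    have Lk: "L (of_real k) = ?l"
    proof -
      have "(wh (of_real k))\<^sup>2 = (complex_of_real (\<omega> 0 k))\<^sup>2" using whk' by (elim disjE) (simp_all only: power2_minus)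
      then show ?thesis by (simp add: L_def)
    qed
    obtain \<kappa> where \<kappa>: "\<And>y. y \<in> {-1/2..1/2} \<Longrightarrow> exp (\<i> * of_real (k * y)) * \<phi> 0 k y = \<kappa> * F (of_real k) y"
       "\<And>y. y \<in> {-1/2..1/2} \<Longrightarrow> exp (\<i> * of_real (k * y)) * (of_real (a y) * shifted_deriv k (\<phi> 0 k) y) = \<kappa> * P (of_real k) y"
      using gs(2) unfolding Fz_def Pz_def F_def P_def C1z_def S1z_def Lk by blast
    define E where "E = (\<lambda>y. exp (\<i> * of_real (k * y)))"
    have Em: "exp ((- \<i>) * of_real k * of_real y) * E y = 1" for y
      unfolding E_def by (simp flip: exp_add)
    have cE: "cnj (E y) = exp ((- \<i>) * of_real k * of_real y)" for y
      unfolding E_def by (simp add: exp_cnj mult.assoc)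
    have lr: "cnj ?l = ?l" by simp
    have cF: "cnj (F (of_real k) y) = Fm (of_real k) y" if y: "y \<in> {-1/2..1/2}" for y
      unfolding F_def Fm_def C1z_def S1z_def Lk
      unfolding complex_cnj_add complex_cnj_mult complex_cnj_diff fC_real[OF lL lr y] fS_real[OF lL lr y] fC_real[OF lL lr half] fS_real[OF lL lr half]
      by (simp add: exp_cnj)
    have \<phi>F: "\<phi> 0 k y = \<kappa> * (exp ((- \<i>) * of_real k * of_real y) * F (of_real k) y)" if y: "y \<in> {-1/2..1/2}" for y
    proof -
      have "\<phi> 0 k y = (exp ((- \<i>) * of_real k * of_real y) * E y) * \<phi> 0 k y" unfolding Em by simp
      also have "\<dots> = exp ((- \<i>) * of_real k * of_real y) * (\<kappa> * F (of_real k) y)" using \<kappa>(1)[OF y] by (simp only: E_def mult.assoc)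
      finally show ?thesis by (simp only: mult.left_commute)
    qed
    have ggP: "of_real (a y) * shifted_deriv k (\<phi> 0 k) y = \<kappa> * (exp ((- \<i>) * of_real k * of_real y) * P (of_real k) y)" if y: "y \<in> {-1/2..1/2}" for y
    proof -
      have "of_real (a y) * shifted_deriv k (\<phi> 0 k) y = (exp ((- \<i>) * of_real k * of_real y) * E y) * (of_real (a y) * shifted_deriv k (\<phi> 0 k) y)" unfolding Em by simp
      also have "\<dots> = exp ((- \<i>) * of_real k * of_real y) * (\<kappa> * P (of_real k) y)" using \<kappa>(2)[OF y] by (simp only: E_def mult.assoc)
      finally show ?thesis by (simp only: mult.left_commute)
    qed
    have c\<phi>: "cnj (\<phi> 0 k y) = cnj \<kappa> * (Fm (of_real k) y * exp (\<i> * of_real k * of_real y))" if y: "y \<in> {-1/2..1/2}" for y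
      unfolding \<phi>F[OF y] by (simp add: cF[OF y] exp_cnj)
    have bb: "b 0 k = cnj \<kappa> * \<beta> (of_real k)"
    proof -
      have "b 0 k = integral {-1/2..1/2} (\<lambda>y. cnj (\<phi> 0 k y))" by (simp add: b_eq[OF kp] wip_def)
      also have "\<dots> = integral {-1/2..1/2} (\<lambda>y. cnj \<kappa> * (Fm (of_real k) y * exp (\<i> * of_real k * of_real y)))"
        by (rule integral_cong) (rule c\<phi>)
      finally show ?thesis by (simp only: integral_mult_right \<beta>_def)
    qed
    have nn: "1 = \<kappa> * cnj \<kappa> * Nz (of_real k)"
    proof -
      have "1 = ip (\<phi> 0 k) (\<phi> 0 k)" using \<phi>_orth[OF kp, of 0 0] by simp
      also have "\<dots> = integral {-1/2..1/2} (\<lambda>y. (\<kappa> * cnj \<kappa>) * (Fm (of_real k) y * F (of_real k) y))"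
        unfolding wip_def
      proof (rule integral_cong)
        fix y :: real assume y: "y \<in> {-1/2..1/2}"
        have "exp ((- \<i>) * of_real k * of_real y) * exp (\<i> * of_real k * of_real y) = (1::complex)"
          by (simp flip: exp_add)
        then show "of_real 1 * \<phi> 0 k y * cnj (\<phi> 0 k y) = (\<kappa> * cnj \<kappa>) * (Fm (of_real k) y * F (of_real k) y)"
          unfolding c\<phi>[OF y] unfolding \<phi>F[OF y] of_real_1 by algebra
      qed
      finally show ?thesis by (simp only: integral_mult_right Nz_def)
    qed
    have Hy: "b 0 k * (of_real (a y) * shifted_deriv k (\<phi> 0 k) y) = h (of_real k) y" if y: "y \<in> {-1/2..1/2}" for y
    proof -
      have "b 0 k * (of_real (a y) * shifted_deriv k (\<phi> 0 k) y) * Nz (of_real k) =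
          (\<kappa> * cnj \<kappa> * Nz (of_real k)) * (\<beta> (of_real k) * exp ((- \<i>) * of_real k * of_real y) * P (of_real k) y)"
        unfolding bb ggP[OF y] by algebra
      then show ?thesis unfolding nn[symmetric] h_def using Nnz[OF k0(2)] by (simp add: eq_divide_eq)
    qed
    show "b 0 k * (of_real (a y) * shifted_deriv k (\<phi> 0 k) y) = H (of_real k) y" for y
    proof -
      let ?G = "\<lambda>y. of_real (a y) * shifted_deriv k (\<phi> 0 k) y"
      have "?G (y + 1) = ?G y" for y by (simp add: a_per shifted_deriv_periodic[OF \<phi>_cper[OF kp]])
      from periodic_of_int[of ?G "y - of_int \<lfloor>y + 1/2\<rfloor>" "\<lfloor>y + 1/2\<rfloor>", OF this]
      have "?G y = ?G (y - of_int \<lfloor>y + 1/2\<rfloor>)" by simp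
      then show ?thesis unfolding H_def using Hy[OF red[of y]] by simp
    qed
  qed
qed

end

section \<open>Taylor coefficients of the ground-state term\<close>

text \<open>The Schwarz lemma after rescaling; C + 1 in place of C provides the strict inequality it
  requires.\<close>

lemma linear_bound_of_zero:
  fixes f :: "complex \<Rightarrow> complex"
  assumes hol: "f holomorphic_on ball 0 R" and R: "0 < R" and f0: "f 0 = 0"
    and bnd: "\<And>z. z \<in> ball 0 R \<Longrightarrow> norm (f z) \<le> C" and z: "z \<in> ball 0 R"
  shows "norm (f z) \<le> (C + 1) / R * norm z"
proof -
  have C: "0 < C + 1" using order_trans[OF norm_ge_zero bnd[of 0]] R by simp
  define g where "g = (\<lambda>w. f (of_real R * w) / of_real (C + 1))"
  have in_ball: "of_real R * w \<in> ball 0 R" if "norm w < 1" for w :: complex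
    using that R by (simp add: norm_mult)
  have "norm (g (z / of_real R)) \<le> norm (z / of_real R)"
  proof (rule Schwarz_Lemma(1))
    have "(f \<circ> (\<lambda>w. of_real R * w)) holomorphic_on ball 0 1"
      by (rule holomorphic_on_compose_gen[OF _ hol]) (intro holomorphic_intros, use in_ball in auto)
    then show "g holomorphic_on ball 0 1"
      unfolding g_def o_def using C by (intro holomorphic_intros) auto
    show "g 0 = 0" by (simp add: g_def f0)
    show "norm (g w) < 1" if "norm w < 1" for w
    proof -
      have "norm (g w) = norm (f (of_real R * w)) / (C + 1)" unfolding g_def norm_divide norm_of_real using C by simp
      also have "\<dots> < 1" using bnd[OF in_ball[OF that]] C by (simp add: divide_less_eq)
      finally show ?thesis .
    qed
    show "norm (z / of_real R) < 1" using z R by (simp add: norm_divide)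
  qed
  then have "norm (f z) / (C + 1) \<le> norm z / R"
    using R C unfolding g_def norm_divide norm_of_real by simp
  then show ?thesis using C R by (simp add: field_simps)
qed

context bloch_kernel
begin

text \<open>The Fourier transform of the kernel at w / \<alpha>, up to sign convention: an entire
  function of w that governs both s_0 and the averages of exponentials.\<close>

definition kap :: "real \<Rightarrow> complex \<Rightarrow> complex" where
  "kap \<alpha> w = integral {-1..1} (\<lambda>t. of_real (K t) * exp (\<i> * (w / of_real \<alpha>) * of_real t))"

lemma kap_cont: "continuous_on S (\<lambda>(z, t). of_real (K t) * exp (\<i> * (z / of_real \<alpha>) * of_real t) :: complex)"
  if "0 < \<alpha>"
  unfolding case_prod_unfold
  by (intro continuous_intros continuous_on_compose2[OF K_cont[of UNIV]]) (use that in auto)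

lemma kap_integrable: "0 < \<alpha> \<Longrightarrow> (\<lambda>t. of_real (K t) * exp (\<i> * (z / of_real \<alpha>) * of_real t)) integrable_on {-1..1}"
  by (intro integrable_continuous_interval continuous_intros K_cont)

lemma kap_hol: "0 < \<alpha> \<Longrightarrow> kap \<alpha> holomorphic_on UNIV"
  unfolding kap_def[abs_def]
  by (rule integral_param_holomorphic[OF kap_cont]) (auto intro!: holomorphic_intros)

lemma kap_bound:
  assumes "0 < \<alpha>" shows "norm (kap \<alpha> w) \<le> 2 * M * exp (norm w / \<alpha>)"
proof -
  have "norm (kap \<alpha> w) \<le> (M * exp (norm w / \<alpha>)) * (1 - (-1))"
    unfolding kap_def
  proof (rule integral_bound)
    fix t :: real assume "t \<in> {-1..1}"
    then have t: "\<bar>t\<bar> \<le> 1" by auto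
    have "norm (w / of_real \<alpha>) \<le> norm w / \<alpha>" using assms by (simp add: norm_divide)
    from norm_exp_bound[OF this t] show "norm (of_real (K t) * exp (\<i> * (w / of_real \<alpha>) * of_real t)) \<le> M * exp (norm w / \<alpha>)"
      unfolding norm_mult[of "of_real (K t)"] norm_of_real by (rule mult_mono[OF K_bound _ M_nonneg norm_ge_zero])
  qed (use assms in \<open>auto intro!: continuous_intros K_cont\<close>)
  then show ?thesis by simp
qed

lemma kernel_moments:
  assumes "K \<in> kernels r q'" "j \<le> r"
  shows "integral {-1..1} (\<lambda>t. K t * t ^ j) = (if j = 0 then 1 else 0)"
proof -
  have "(LINT x|lebesgue. scaled_kernel K 1 x *\<^sub>R (\<lambda>y. y ^ j) (x / 1)) = integral {-1..1} (\<lambda>t. K t *\<^sub>R (\<lambda>y. y ^ j) (t / (1 / 1)))"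
    by (intro scaled_kernel_integral K_cont K_zero continuous_intros) auto
  then have "integral {-1..1} (\<lambda>t. K t * t ^ j) = (LINT x|lebesgue. K x * x ^ j)" by (simp add: scaled_kernel_def)
  then show ?thesis using assms by (cases "j = 0") (auto simp: kernels_def)
qed

text \<open>The moments of the kernel annihilate the Taylor terms of orders 1 to r and turn the
  constant term into 1, so only the Taylor remainder of the exponential is left.\<close>

lemma kap_minus_one:
  assumes K: "K \<in> kernels r q'" and \<alpha>: "0 < \<alpha>"
  shows "norm (kap \<alpha> w - 1) \<le> 2 * M * exp (norm w / \<alpha>) * (norm w / \<alpha>) ^ (r + 1)"
proof -
  let ?c = "\<i> * (w / of_real \<alpha>)"
  let ?T = "\<lambda>t. of_real (K t) * (\<Sum>j\<le>r. (?c * of_real t) ^ j / fact j)"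
  have nc: "norm ?c = norm w / \<alpha>" using \<alpha> by (simp add: norm_mult norm_divide)
  have Tc: "?T integrable_on {-1..1}"
    by (intro integrable_continuous_interval continuous_intros K_cont) auto
  have "integral {-1..1} ?T = integral {-1..1} (\<lambda>t. \<Sum>j\<le>r. (?c ^ j / fact j) * of_real (K t * t ^ j))"
  proof (rule integral_cong)
    have "of_real (K t) * (\<Sum>j\<le>r. (c * of_real t) ^ j / fact j) = (\<Sum>j\<le>r. (c ^ j / fact j) * of_real (K t * t ^ j))"
      for c :: complex and t by (simp add: sum_distrib_left power_mult_distrib mult_ac)
    then show "?T t = (\<Sum>j\<le>r. (?c ^ j / fact j) * of_real (K t * t ^ j))" for t .
  qed
  also have "\<dots> = (\<Sum>j\<le>r. (?c ^ j / fact j) * of_real (integral {-1..1} (\<lambda>t. K t * t ^ j)))"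
  proof (rule integral_unique, intro has_integral_sum has_integral_mult_right has_integral_of_real integrable_integral)
    show "(\<lambda>t. K t * t ^ j) integrable_on {-1..1}" for j
      by (intro integrable_continuous_interval continuous_intros K_cont)
  qed simp
  also have "\<dots> = (\<Sum>j\<le>r. if j = 0 then 1 else 0)"
    by (intro sum.cong refl) (use kernel_moments[OF K] in auto)
  also have "\<dots> = 1" by simp
  finally have T1: "integral {-1..1} ?T = 1" .
  have "kap \<alpha> w - 1 = integral {-1..1} (\<lambda>t. of_real (K t) * exp (?c * of_real t) - ?T t)"
    unfolding T1[symmetric] kap_def by (rule integral_diff[symmetric, OF kap_integrable[OF \<alpha>] Tc])
  also have "norm \<dots> \<le> (M * (exp (norm w / \<alpha>) * (norm w / \<alpha>) ^ (r + 1))) * (1 - (-1))"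
  proof (rule integral_bound)
    fix t :: real assume "t \<in> {-1..1}"
    then have t: "\<bar>t\<bar> \<le> 1" by auto
    have nz: "norm (?c * of_real t) \<le> norm w / \<alpha>"
      unfolding norm_mult[of ?c] nc norm_of_real using t \<alpha> by (intro mult_left_le) auto
    have "norm (exp (?c * of_real t) - (\<Sum>j\<le>r. (?c * of_real t) ^ j / fact j))
        \<le> exp \<bar>Re (?c * of_real t)\<bar> * norm (?c * of_real t) ^ Suc r / fact r"
      by (rule Taylor_exp)
    also have "\<dots> \<le> exp \<bar>Re (?c * of_real t)\<bar> * norm (?c * of_real t) ^ Suc r / 1"
      by (intro divide_left_mono) (auto simp: fact_ge_1)
    also have "\<dots> \<le> exp (norm w / \<alpha>) * (norm w / \<alpha>) ^ (r + 1)"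
    proof -
      have "exp \<bar>Re (?c * of_real t)\<bar> \<le> exp (norm w / \<alpha>)"
        using order_trans[OF abs_Re_le_cmod nz] by (simp only: exp_le_cancel_iff)
      from mult_mono[OF this power_mono[OF nz norm_ge_zero, of "Suc r"]] show ?thesis by (simp del: power_Suc)
    qed
    finally have e: "norm (exp (?c * of_real t) - (\<Sum>j\<le>r. (?c * of_real t) ^ j / fact j)) \<le> exp (norm w / \<alpha>) * (norm w / \<alpha>) ^ (r + 1)" .
    have "norm (of_real (K t) * exp (?c * of_real t) - ?T t) = \<bar>K t\<bar> * norm (exp (?c * of_real t) - (\<Sum>j\<le>r. (?c * of_real t) ^ j / fact j))"
      by (simp only: right_diff_distrib[symmetric] norm_mult norm_of_real)
    also have "\<dots> \<le> M * (exp (norm w / \<alpha>) * (norm w / \<alpha>) ^ (r + 1))"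
      by (intro mult_mono K_bound e M_nonneg) auto
    finally show "norm (of_real (K t) * exp (?c * of_real t) - ?T t) \<le> M * (exp (norm w / \<alpha>) * (norm w / \<alpha>) ^ (r + 1))" .
  qed (use \<alpha> in \<open>auto intro!: continuous_intros K_cont\<close>)
  finally show ?thesis by (simp add: mult_ac)
qed

text \<open>The symmetric form shows that the sign ambiguity between \<omega>_0 and its analytic
  branch is invisible to s_0.\<close>

lemma sK_eq_kap:
  assumes \<alpha>: "0 < \<alpha>"
  shows "complex_of_real (sK \<alpha> x) = (kap \<alpha> (of_real x) + kap \<alpha> (- of_real x)) / 2"
proof -
  have "((\<lambda>t. K t * cos (x * t / \<alpha>)) has_integral sK \<alpha> x) {-1..1}"
    unfolding sK_def by (intro integrable_integral integrable_continuous_interval continuous_intros K_cont) (use \<alpha> in auto)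
  then have 1: "((\<lambda>t. of_real (K t * cos (x * t / \<alpha>))) has_integral complex_of_real (sK \<alpha> x)) {-1..1}"
    by (rule has_integral_of_real)
  have "((\<lambda>t. (of_real (K t) * exp (\<i> * (of_real x / of_real \<alpha>) * of_real t) + of_real (K t) * exp (\<i> * (- of_real x / of_real \<alpha>) * of_real t)) / 2)
      has_integral (kap \<alpha> (of_real x) + kap \<alpha> (- of_real x)) / 2) {-1..1}"
    unfolding kap_def by (intro has_integral_divide has_integral_add integrable_integral kap_integrable \<alpha>)
  moreover have "(of_real (K t) * exp (\<i> * (of_real x / of_real \<alpha>) * of_real t) + of_real (K t) * exp (\<i> * (- of_real x / of_real \<alpha>) * of_real t)) / 2
      = complex_of_real (K t * cos (x * t / \<alpha>))" for t
    by (simp add: cos_exp_eq distrib_left mult.assoc flip: cos_of_real)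
  ultimately show ?thesis using has_integral_unique[OF 1] by simp
qed

text \<open>The weak form tested with 1, whose shifted derivative is i k, relates the mean flux to
  \<omega>_0^2 times the conjugate of b_0.\<close>

lemma Omega_B_mean:
  assumes k: "k \<in> {-pi..pi}"
  shows "complex_of_real (Omega \<omega> k * B \<psi> k) =
    - (\<i> * (of_real k * integral {-1/2..1/2} (\<lambda>y. b 0 k * (of_real (a y) * shifted_deriv k (\<phi> 0 k) y))))"
proof -
  have "wip a (shifted_deriv k (\<phi> 0 k)) (shifted_deriv k (\<lambda>_. 1)) = of_real (ev 0 k) * cnj (b 0 k)"
    using \<phi>_weak[OF k cper_const] by (simp add: ip_\<phi>_one[OF k])
  moreover have "wip a (shifted_deriv k (\<phi> 0 k)) (shifted_deriv k (\<lambda>_. 1)) =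
      - (\<i> * of_real k) * integral {-1/2..1/2} (\<lambda>y. of_real (a y) * shifted_deriv k (\<phi> 0 k) y)"
    unfolding wip_def shifted_deriv_const integral_mult_right[symmetric] by (simp add: mult_ac)
  ultimately have "of_real (ev 0 k) * cnj (b 0 k) = - (\<i> * of_real k) * integral {-1/2..1/2} (\<lambda>y. of_real (a y) * shifted_deriv k (\<phi> 0 k) y)"
    by simp
  moreover have "complex_of_real (Omega \<omega> k * B \<psi> k) = b 0 k * (of_real (ev 0 k) * cnj (b 0 k))"
    unfolding Omega_def B_def of_real_mult complex_norm_square by (simp add: mult_ac)
  ultimately have "complex_of_real (Omega \<omega> k * B \<psi> k) =
      b 0 k * (- (\<i> * of_real k) * integral {-1/2..1/2} (\<lambda>y. of_real (a y) * shifted_deriv k (\<phi> 0 k) y))"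
    by (simp only:)
  then show ?thesis unfolding integral_mult_right by (simp only: mult_minus_left mult_minus_right mult_ac)
qed

text \<open>Near 0 the term is \<open>hb + E + D\<close>. The mean flux \<open>hb\<close> carries
  the main term. \<open>D\<close> compares the kernel multipliers with 1 and vanishes to order r +
  1; its constants grow exponentially in 1/\<alpha>, which is harmless as only the vanishing of its
  r-th derivative is used. \<open>E\<close> is the oscillating part and gives the error.\<close>

lemma ground_term_derivative:
  obtains \<rho> C where "0 < \<rho>" "\<rho> \<le> 1/4" "\<And>n. times_differentiable_at n (\<lambda>k. Omega \<omega> k * B \<psi> k) 0"
    "\<And>\<alpha> r q' f. \<lbrakk>0 < \<alpha>; \<alpha> \<le> 1; 1 \<le> r; K \<in> kernels r q';
       \<forall>k. \<bar>k\<bar> < \<rho> \<longrightarrow> f k = b 0 k * of_real (sK \<alpha> (\<omega> 0 k)) * wm \<alpha> 0 k\<rbrakk> \<Longrightarrow>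
       times_differentiable_at r f 0 \<and> f differentiable (at 0) \<and>
       norm (nderiv r f 0 - \<i> / of_nat (r + 1) * of_real (nderiv (r + 1) (\<lambda>k. Omega \<omega> k * B \<psi> k) 0)) \<le> C r * (\<alpha> ^ q / \<alpha> ^ (r - 1))"
proof -
  obtain \<rho> wh H where \<rho>: "0 < \<rho>" "\<rho> \<le> 1/4" and whh: "wh holomorphic_on ball 0 \<rho>" and wh0: "wh 0 = 0"
    and whk: "\<And>k. \<bar>k\<bar> < \<rho> \<Longrightarrow> complex_of_real (\<omega> 0 k) = wh (of_real k) \<or> complex_of_real (\<omega> 0 k) = - wh (of_real k)"
    and Hc: "continuous_on (ball 0 \<rho> \<times> UNIV) (\<lambda>(z, y). H z y)"
    and Hh: "\<And>y. (\<lambda>z. H z y) holomorphic_on ball 0 \<rho>"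
    and Hp: "\<And>z y. H z (y + 1) = H z y" and H0: "\<And>y. H 0 y = 0"
    and Hk: "\<And>k y. \<bar>k\<bar> < \<rho> \<Longrightarrow> b 0 k * (of_real (a y) * shifted_deriv k (\<phi> 0 k) y) = H (of_real k) y"
    by (rule ground_state_analytic) (rule that)
  define R where "R = \<rho> / 2"
  have R: "0 < R" "R < \<rho>" "R < 1" using \<rho> by (auto simp: R_def)
  have sub: "ball 0 R \<subseteq> ball (0::complex) \<rho>" "cball 0 R \<subseteq> ball (0::complex) \<rho>" using R by auto
  have Hcz: "continuous_on UNIV (H z)" if "z \<in> ball 0 \<rho>" for z
  proof -
    have "continuous_on UNIV (\<lambda>y. case (z, y) of (z, y) \<Rightarrow> H z y)"
      by (rule continuous_on_compose2[OF Hc]) (use that in \<open>auto intro!: continuous_intros\<close>)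
    then show ?thesis by simp
  qed
  define hb where "hb = (\<lambda>z. integral {-1/2..1/2} (H z))"
  have hbh: "hb holomorphic_on ball 0 \<rho>"
    unfolding hb_def
    by (rule integral_param_holomorphic[OF continuous_on_subset[OF Hc] Hh]) auto
  have "\<exists>C. \<forall>p\<in>cball 0 R \<times> {-1/2..1/2::real}. norm (case p of (z, y) \<Rightarrow> H z y) \<le> C"
  proof -
    have "continuous_on (cball 0 R \<times> {-1/2..1/2::real}) (\<lambda>(z, y). H z y)"
      by (rule continuous_on_subset[OF Hc]) (use sub in auto)
    then have "bounded ((\<lambda>(z, y). H z y) ` (cball 0 R \<times> {-1/2..1/2::real}))"
      by (intro compact_imp_bounded compact_continuous_image compact_Times) auto
    then show ?thesis unfolding bounded_iff by blast
  qed
  then obtain MH where MH: "\<And>z y. z \<in> cball 0 R \<Longrightarrow> y \<in> {-1/2..1/2::real} \<Longrightarrow> norm (H z y) \<le> MH" by fastforce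
  \<comment> \<open>The Schwarz-lemma constant for \<open>H\<close>, which vanishes at z = 0. This
    linear bound is what later saves one power of \<alpha>.\<close>
  define C1' where "C1' = (MH + 1) / R"
  have Hlin0: "norm (H z y) \<le> C1' * norm z" if z: "z \<in> ball 0 R" and y: "y \<in> {-1/2..1/2}" for z y
    unfolding C1'_def
    by (rule linear_bound_of_zero[OF holomorphic_on_subset[OF Hh sub(1)] R(1) H0 MH[OF _ y] z]) simp
  have Hlin: "norm (H z y) \<le> C1' * norm z" if z: "z \<in> ball 0 R" for z y
  proof -
    obtain x where "x \<in> {-1/2..1/2}" "H z y = H z x" using periodic_reduce[of "H z" y] Hp by metis
    then show ?thesis using Hlin0[OF z] by simp
  qed
  have C1p: "0 \<le> C1'" unfolding C1'_def using order_trans[OF norm_ge_zero MH[of 0 0]] R by simp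
  have hblin: "norm (hb z) \<le> C1' * norm z" if z: "z \<in> ball 0 R" for z
  proof -
    have "norm (hb z) \<le> C1' * norm z * (1/2 - (-1/2))"
      unfolding hb_def
      by (rule integral_bound[OF _ continuous_on_subset[OF Hcz]]) (use z sub Hlin in auto)
    then show ?thesis by simp
  qed
  have "\<exists>C. \<forall>z\<in>cball 0 R. norm (wh z) \<le> C"
  proof -
    have "bounded (wh ` cball 0 R)"
      by (intro compact_imp_bounded compact_continuous_image holomorphic_on_imp_continuous_on holomorphic_on_subset[OF whh sub(2)]) auto
    then show ?thesis unfolding bounded_iff by blast
  qed
  then obtain Mw where Mw: "\<And>z. z \<in> cball 0 R \<Longrightarrow> norm (wh z) \<le> Mw" by blast
  define Cw where "Cw = (Mw + 1) / R"
  have whlin: "norm (wh z) \<le> Cw * norm z" if z: "z \<in> ball 0 R" for z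
    unfolding Cw_def
    by (rule linear_bound_of_zero[OF holomorphic_on_subset[OF whh sub(1)] R(1) wh0 Mw z]) simp
  have Cwp: "0 \<le> Cw" unfolding Cw_def using order_trans[OF norm_ge_zero Mw[of 0]] R by simp
  define OB where "OB = (\<lambda>z. - (\<i> * (z * hb z)))"
  have OBh: "OB holomorphic_on ball 0 \<rho>" unfolding OB_def by (intro holomorphic_intros hbh)
  have OBk: "complex_of_real (Omega \<omega> k * B \<psi> k) = OB (of_real k)" if k: "\<bar>k\<bar> < \<rho>" for k
  proof -
    have kp: "k \<in> {-pi..pi}" using k \<rho> pi_gt3 by auto
    show ?thesis unfolding Omega_B_mean[OF kp] OB_def hb_def Hk[OF k] ..
  qed
  note OBd = real_nderiv_of_holomorphic[OF OBh OBk]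
  have zeroin: "\<bar>0::real\<bar> < \<rho>" using \<rho> by simp
  define \<rho>1 where "\<rho>1 = R / 2"
  have \<rho>1: "0 < \<rho>1" "\<rho>1 < R" "\<rho>1 \<le> 1" using R by (auto simp: \<rho>1_def)
  \<comment> \<open>The quotient fact r * S0 * G0 / \<sigma>^r of the Cauchy estimate below, with
    the powers of \<alpha> taken out; one \<sigma> in \<open>G0\<close> reduces the exponent to r -
    1.\<close>
  define CC where "CC = (\<lambda>r::nat. fact r * ((2 * M * exp (Cw * \<rho>1)) * (2 * M * exp 1 * (2 * C1') * 2 ^ q)) / \<rho>1 ^ (r - 1))"
  show ?thesis
  proof (rule that[OF \<rho>, of CC])
    show "times_differentiable_at n (\<lambda>k. Omega \<omega> k * B \<psi> k) 0" for n
      using OBd[OF _ zeroin] by blast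
    fix \<alpha> :: real and r q' :: nat and f :: "real \<Rightarrow> complex"
    assume \<alpha>: "0 < \<alpha>" "\<alpha> \<le> 1" and r: "1 \<le> r" and Kr: "K \<in> kernels r q'"
      and "\<forall>k. \<bar>k\<bar> < \<rho> \<longrightarrow> f k = b 0 k * of_real (sK \<alpha> (\<omega> 0 k)) * wm \<alpha> 0 k"
    then have f: "\<And>k. \<bar>k\<bar> < \<rho> \<Longrightarrow> f k = b 0 k * of_real (sK \<alpha> (\<omega> 0 k)) * wm \<alpha> 0 k" by blast
    define s where "s = (\<lambda>z. (kap \<alpha> (wh z) + kap \<alpha> (- wh z)) / 2)"
    define X where "X = (\<lambda>z. integral {-1..1} (\<lambda>t. of_real (K t) * exp (\<i> * (z / of_real \<alpha>) * of_real t) * H z (t / \<alpha>)))"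
    define Y where "Y = (\<lambda>z. X z - kap \<alpha> z * hb z)"
    have kh: "kap \<alpha> holomorphic_on S" for S by (rule holomorphic_on_subset[OF kap_hol[OF \<alpha>(1)]]) simp
    have sh: "s holomorphic_on ball 0 \<rho>"
    proof -
      have "(kap \<alpha> \<circ> wh) holomorphic_on ball 0 \<rho>" by (rule holomorphic_on_compose[OF whh kh])
      moreover have "(kap \<alpha> \<circ> (\<lambda>z. - wh z)) holomorphic_on ball 0 \<rho>"
        by (rule holomorphic_on_compose[OF holomorphic_on_minus[OF whh] kh])
      ultimately show ?thesis unfolding s_def o_def by (intro holomorphic_intros) auto
    qed
    have Xh: "X holomorphic_on ball 0 \<rho>"
      unfolding X_def
    proof (rule integral_param_holomorphic)
      have "continuous_on (ball 0 \<rho> \<times> {-1..1}) (\<lambda>p. case (fst p, snd p / \<alpha>) of (z, y) \<Rightarrow> H z y)"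
        by (rule continuous_on_compose2[OF Hc]) (use \<alpha> in \<open>auto intro!: continuous_intros\<close>)
      then have "continuous_on (ball 0 \<rho> \<times> {-1..1}) (\<lambda>p. H (fst p) (snd p / \<alpha>))" by (simp only: prod.case)
      from continuous_on_mult[OF kap_cont[OF \<alpha>(1), unfolded case_prod_unfold] this]
      show "continuous_on (ball 0 \<rho> \<times> {-1..1}) (\<lambda>(z, t). of_real (K t) * exp (\<i> * (z / of_real \<alpha>) * of_real t) * H z (t / \<alpha>))"
        unfolding case_prod_unfold .
      show "(\<lambda>z. of_real (K t) * exp (\<i> * (z / of_real \<alpha>) * of_real t) * H z (t / \<alpha>)) holomorphic_on ball 0 \<rho>" for t
        using \<alpha> by (intro holomorphic_on_mult[OF _ Hh] holomorphic_intros) auto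
    qed simp
    have Yh: "Y holomorphic_on ball 0 \<rho>" unfolding Y_def by (intro holomorphic_intros Xh kh hbh)
    define E where "E = (\<lambda>z. s z * Y z)"
    define D where "D = (\<lambda>z. (s z * kap \<alpha> z - 1) * hb z)"
    have Eh: "E holomorphic_on ball 0 \<rho>" unfolding E_def by (intro holomorphic_intros sh Yh)
    have Dh: "D holomorphic_on ball 0 \<rho>" unfolding D_def by (intro holomorphic_intros sh kh hbh)
    have Vh: "(\<lambda>z. s z * X z) holomorphic_on ball 0 \<rho>" by (intro holomorphic_intros sh Xh)
    have V: "f k = s (of_real k) * X (of_real k)" if k: "\<bar>k\<bar> < \<rho>" for k
    proof -
      have sk: "of_real (sK \<alpha> (\<omega> 0 k)) = s (of_real k)"
        using whk[OF k] unfolding sK_eq_kap[OF \<alpha>(1)] s_def by (elim disjE) (simp_all add: add.commute)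
      have "b 0 k * wm \<alpha> 0 k = X (of_real k)"
        unfolding LK_def X_def integral_mult_right[symmetric] Hk[OF k, symmetric] flux_def
        by (simp add: mult_ac)
      then show ?thesis unfolding f[OF k] sk by (simp add: mult_ac)
    qed
    note Vd = nderiv_of_holomorphic[OF Vh V zeroin]
    have z0: "0 \<in> ball (0::complex) \<rho>" using \<rho> by simp
    have split: "s z * X z = hb z + (E z + D z)" for z unfolding E_def D_def Y_def by (simp add: algebra_simps)
    have dsum: "(deriv ^^ r) (\<lambda>z. s z * X z) 0 = (deriv ^^ r) hb 0 + ((deriv ^^ r) E 0 + (deriv ^^ r) D 0)"
      unfolding split
      by (simp only: higher_deriv_add[OF hbh holomorphic_on_add[OF Eh Dh] open_ball z0] higher_deriv_add[OF Eh Dh open_ball z0])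
    have D0: "(deriv ^^ r) D 0 = 0"
    proof (rule higher_deriv_zero_of_bound[OF Dh \<rho>(1) R(1)])
      let ?K1 = "2 * M * exp (1 / \<alpha>) * (1 / \<alpha>) ^ (r + 1)"
      let ?S1 = "2 * M * exp (Cw / \<alpha>) * (Cw / \<alpha>) ^ (r + 1)"
      let ?K0 = "2 * M * exp (1 / \<alpha>)"
      fix z :: complex assume "norm z < R"
      then have z: "z \<in> ball 0 R" and n1: "norm z \<le> 1" using R by auto
      have gen: "norm (kap \<alpha> w - 1) \<le> 2 * M * exp (c / \<alpha>) * (c / \<alpha>) ^ (r + 1) * norm z ^ (r + 1)"
        if w: "norm w \<le> c * norm z" and c: "0 \<le> c" for w c
      proof -
        have wc: "norm w \<le> c" using w mult_left_mono[OF n1 c] by simp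
        have "norm (kap \<alpha> w - 1) \<le> 2 * M * exp (norm w / \<alpha>) * (norm w / \<alpha>) ^ (r + 1)" by (rule kap_minus_one[OF Kr \<alpha>(1)])
        also have "\<dots> \<le> 2 * M * exp (c / \<alpha>) * (c * norm z / \<alpha>) ^ (r + 1)"
          using w wc \<alpha> M_nonneg by (intro mult_mono power_mono divide_right_mono) (auto simp: divide_right_mono)
        also have "(c * norm z / \<alpha>) ^ (r + 1) = (c / \<alpha>) ^ (r + 1) * norm z ^ (r + 1)"
          by (simp only: power_mult_distrib[symmetric] times_divide_eq_left)
        finally show ?thesis by (simp only: mult.assoc)
      qed
      have k1: "norm (kap \<alpha> z - 1) \<le> ?K1 * norm z ^ (r + 1)" using gen[of z 1] by simp
      have half: "norm ((u + v) / 2) \<le> T" if "norm u \<le> T" "norm v \<le> T" for u v :: complex and T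
        using norm_triangle_ineq[of u v] that by (simp add: norm_divide)
      have "s z - 1 = ((kap \<alpha> (wh z) - 1) + (kap \<alpha> (- wh z) - 1)) / 2" unfolding s_def by (simp add: field_simps)
      then have s1: "norm (s z - 1) \<le> ?S1 * norm z ^ (r + 1)"
        using half[OF gen[OF whlin[OF z] Cwp] gen[OF _ Cwp, of "- wh z"]] whlin[OF z] by (simp only: norm_minus_cancel)
      have k0: "norm (kap \<alpha> z) \<le> ?K0"
        using kap_bound[OF \<alpha>(1), of z] n1 \<alpha> M_nonneg
        by (elim order_trans) (auto intro!: mult_left_mono simp: divide_right_mono)
      have hb1: "norm (hb z) \<le> C1'" using hblin[OF z] mult_left_mono[OF n1 C1p] by simp
      have S1p: "0 \<le> ?S1 * norm z ^ (r + 1)" using order_trans[OF norm_ge_zero s1] .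
      have "s z * kap \<alpha> z - 1 = (s z - 1) * kap \<alpha> z + (kap \<alpha> z - 1)" by (simp add: algebra_simps)
      also have "norm \<dots> \<le> ?S1 * norm z ^ (r + 1) * ?K0 + ?K1 * norm z ^ (r + 1)"
        by (rule order_trans[OF norm_triangle_ineq]) (unfold norm_mult, intro add_mono mult_mono s1 k0 k1 S1p norm_ge_zero)
      finally have sk1: "norm (s z * kap \<alpha> z - 1) \<le> ?S1 * norm z ^ (r + 1) * ?K0 + ?K1 * norm z ^ (r + 1)" .
      have "norm (D z) \<le> (?S1 * norm z ^ (r + 1) * ?K0 + ?K1 * norm z ^ (r + 1)) * C1'"
        unfolding D_def norm_mult
        by (rule mult_mono[OF sk1 hb1 order_trans[OF norm_ge_zero sk1] norm_ge_zero])
      also have "\<dots> = ((?S1 * ?K0 + ?K1) * C1') * norm z ^ (r + 1)" proof -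
        have "(x * n * y + u * n) * c = ((x * y + u) * c) * n" for x y u n c :: real by (simp add: algebra_simps)
        then show ?thesis .
      qed
      finally show "norm (D z) \<le> ((?S1 * ?K0 + ?K1) * C1') * norm z ^ (r + 1)" .
    qed
    have E0: "norm ((deriv ^^ r) E 0) \<le> CC r * (\<alpha> ^ q / \<alpha> ^ (r - 1))"
    proof -
      \<comment> \<open>On this circle |z| / \<alpha> equals \<rho>1 \<le> 1 and |wh z| / \<alpha>
        is at most Cw \<rho>1, so all exponentials are bounded independently of \<alpha>.\<close>
      define \<sigma> where "\<sigma> = \<rho>1 * \<alpha>"
      have "\<rho>1 * \<alpha> \<le> \<rho>1 * 1" using \<rho>1 \<alpha> by (intro mult_left_mono) auto
      then have "\<rho>1 * \<alpha> < R" using \<rho>1 by linarith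
      then have \<sigma>: "0 < \<sigma>" "\<sigma> < R" using \<rho>1 \<alpha> by (simp_all add: \<sigma>_def)
      define S0 G0 where "S0 = 2 * M * exp (Cw * \<rho>1)" and "G0 = 2 * M * exp 1 * (2 * C1' * \<sigma>) * ((1 + 1) * \<alpha>) ^ q"
      have "norm ((deriv ^^ r) E 0) \<le> fact r * (S0 * G0) / \<sigma> ^ r"
      proof (rule Cauchy_inequality)
        have ss: "cball 0 \<sigma> \<subseteq> ball (0::complex) \<rho>" using \<sigma> R by auto
        show "E holomorphic_on ball 0 \<sigma>" by (rule holomorphic_on_subset[OF Eh]) (use \<sigma> R in auto)
        show "continuous_on (cball 0 \<sigma>) E" by (rule holomorphic_on_imp_continuous_on[OF holomorphic_on_subset[OF Eh ss]])
        fix z :: complex assume "norm (0 - z) = \<sigma>"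
        then have nz: "norm z = \<sigma>" by simp
        have z: "z \<in> ball 0 R" using nz \<sigma> by simp
        have zr: "z \<in> ball 0 \<rho>" using z sub by blast
        have wb: "norm (wh z) / \<alpha> \<le> Cw * \<rho>1"
        proof -
          have "norm (wh z) \<le> Cw * \<rho>1 * \<alpha>" using whlin[OF z] nz by (simp add: \<sigma>_def mult.assoc)
          then show ?thesis using \<alpha> by (simp add: divide_le_eq)
        qed
        have kb: "norm (kap \<alpha> w) \<le> S0" if "norm w = norm (wh z)" for w
        proof -
          have "norm (kap \<alpha> w) \<le> 2 * M * exp (norm (wh z) / \<alpha>)" using kap_bound[OF \<alpha>(1), of w] that by simp
          also have "\<dots> \<le> S0" unfolding S0_def using wb M_nonneg by (intro mult_left_mono) auto
          finally show ?thesis .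
        qed
        have "norm (s z) \<le> (S0 + S0) / 2"
          unfolding s_def norm_divide using kb[of "wh z"] kb[of "- wh z"]
          by (auto intro!: divide_right_mono order_trans[OF norm_triangle_ineq] add_mono)
        then have sb: "norm (s z) \<le> S0" by simp
        \<comment> \<open>Subtracting the mean makes the function eligible for the oscillatory bound
          while keeping a bound linear in |z|.\<close>
        define g where "g = (\<lambda>y. H z y - hb z)"
        have gc: "continuous_on UNIV g" unfolding g_def by (intro continuous_intros Hcz zr)
        have Hcs: "continuous_on S (H z)" for S by (rule continuous_on_subset[OF Hcz[OF zr]]) simp
        have gm: "integral {-1/2..1/2} g = 0"
          unfolding g_def by (subst integral_diff) (auto intro!: integrable_continuous_interval Hcs simp: hb_def)
        have gb: "norm (g y) \<le> 2 * C1' * \<sigma>" for y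
          unfolding g_def using norm_triangle_ineq4[of "H z y" "hb z"] Hlin[OF z, of y] hblin[OF z] nz by simp
        have nza: "norm (z / of_real \<alpha>) \<le> 1" using nz \<alpha> \<rho>1 by (simp add: norm_divide \<sigma>_def)
        have "Y z = integral {-1..1} (\<lambda>t. of_real (nderiv 0 K t) * exp (\<i> * (z / of_real \<alpha>) * of_real t) * g (t / \<alpha>))"
        proof -
          have ca: "continuous_on {-1..1} (\<lambda>t. H z (t / \<alpha>))"
            by (rule continuous_on_compose2[OF Hcz[OF zr]]) (use \<alpha> in \<open>auto intro!: continuous_intros\<close>)
          have i1: "(\<lambda>t. of_real (K t) * exp (\<i> * (z / of_real \<alpha>) * of_real t) * H z (t / \<alpha>)) integrable_on {-1..1}"
            by (intro integrable_continuous_interval continuous_on_mult[OF _ ca] continuous_intros K_cont)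
          have i2: "(\<lambda>t. of_real (K t) * exp (\<i> * (z / of_real \<alpha>) * of_real t) * hb z) integrable_on {-1..1}"
            by (intro integrable_on_mult_left kap_integrable \<alpha>)
          show ?thesis
            unfolding Y_def X_def kap_def integral_mult_left[symmetric] integral_diff[OF i1 i2, symmetric] g_def nderiv_0
            by (simp only: right_diff_distrib)
        qed
        also have "norm \<dots> \<le> G0"
          unfolding G0_def
          by (rule oscillatory_bound[OF kd gc _ gm gb \<alpha>(1) nza]) (simp add: g_def Hp)
        finally have Yb: "norm (Y z) \<le> G0" .
        show "norm (E z) \<le> S0 * G0"
          unfolding E_def norm_mult by (rule mult_mono[OF sb Yb order_trans[OF norm_ge_zero sb] norm_ge_zero])
      qed (rule \<sigma>(1))
      also have "fact r * (S0 * G0) / \<sigma> ^ r = CC r * (\<alpha> ^ q / \<alpha> ^ (r - 1))"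
      proof -
        obtain r' where r': "r = Suc r'" using r by (cases r) auto
        have "\<rho>1 \<noteq> 0" "\<alpha> \<noteq> 0" using \<rho>1 \<alpha> by auto
        then show ?thesis unfolding CC_def S0_def G0_def \<sigma>_def r'
          by (simp add: power_mult_distrib field_simps)
      qed
      finally show ?thesis .
    qed
    \<comment> \<open>As \<Omega> B extends to - i z \<open>hb z\<close>, its derivative of order r
      + 1 at 0 is - i (r + 1) times the r-th derivative of \<open>hb\<close>; the prefactor i/(r+1)
      inverts this exactly.\<close>
    have OBr: "\<i> / of_nat (r + 1) * of_real (nderiv (r + 1) (\<lambda>k. Omega \<omega> k * B \<psi> k) 0) = (deriv ^^ r) hb 0"
    proof -
      have "of_real (nderiv (Suc r) (\<lambda>k. Omega \<omega> k * B \<psi> k) 0) = (deriv ^^ (Suc r)) OB 0"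
        using OBd[OF _ zeroin, of "Suc r"] by simp
      also have "OB = (\<lambda>z. (- \<i>) * (z * hb z))" by (simp add: OB_def)
      also have "(deriv ^^ (Suc r)) (\<lambda>z. (- \<i>) * (z * hb z)) 0 = (- \<i>) * (deriv ^^ (Suc r)) (\<lambda>z. z * hb z) 0"
        by (rule higher_deriv_cmult[OF _ z0 open_ball]) (intro holomorphic_intros hbh)
      also have "\<dots> = (- \<i>) * (of_nat (Suc r) * (deriv ^^ r) hb 0)"
        unfolding higher_deriv_ident_mult_0[OF hbh \<rho>(1)] ..
      finally have e: "complex_of_real (nderiv (Suc r) (\<lambda>k. Omega \<omega> k * B \<psi> k) 0) = (- \<i>) * (of_nat (Suc r) * (deriv ^^ r) hb 0)" .
      have "(of_nat (Suc r) :: complex) \<noteq> 0" by (rule of_nat_neq_0)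
      then show ?thesis unfolding Suc_eq_plus1[symmetric] e by (simp del: of_nat_Suc)
    qed
    have "nderiv r f 0 - (deriv ^^ r) hb 0 = (deriv ^^ r) E 0"
      using conjunct1[OF Vd, of r] dsum D0 by simp
    then show "times_differentiable_at r f 0 \<and> f differentiable (at 0) \<and>
       norm (nderiv r f 0 - \<i> / of_nat (r + 1) * of_real (nderiv (r + 1) (\<lambda>k. Omega \<omega> k * B \<psi> k) 0)) \<le> CC r * (\<alpha> ^ q / \<alpha> ^ (r - 1))"
      unfolding OBr using E0 Vd[of r] Vd[of 0] by (simp add: nderiv_0)
  qed
qed

end

section \<open>The theorem\<close>

text \<open>The bound forces G to vanish at 0, and then the difference quotients themselves are
  bounded by c. This carries the linear bound on W - W_0 over to its first derivative.\<close>

lemma vector_derivative_le_of_linear_bound: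
  fixes G :: "real \<Rightarrow> complex"
  assumes d: "(G has_vector_derivative d) (at 0)" and r: "0 < r" and G: "\<And>k. \<bar>k\<bar> < r \<Longrightarrow> norm (G k) \<le> c * \<bar>k\<bar>"
  shows "norm d \<le> c"
proof -
  have G0: "G 0 = 0" using G[of 0] r by simp
  have "(\<lambda>h. norm (G (0 + h) - G 0 - h *\<^sub>R d) / norm h) \<midarrow>0\<rightarrow> 0"
    using d unfolding has_vector_derivative_def has_derivative_at by blast
  then have "((\<lambda>h. norm (G h - h *\<^sub>R d) / norm h + c) \<longlongrightarrow> 0 + c) (at 0)"
    unfolding G0 by (intro tendsto_add tendsto_const) simp
  moreover have "\<forall>\<^sub>F h in at 0. norm d \<le> norm (G h - h *\<^sub>R d) / norm h + c"
    unfolding eventually_at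
  proof (intro exI[of _ r] conjI ballI impI r)
    fix h :: real assume h: "h \<noteq> 0 \<and> dist h 0 < r"
    have "norm (h *\<^sub>R d) \<le> norm (G h - h *\<^sub>R d) + norm (G h)"
      using norm_triangle_ineq4[of "G h" "G h - h *\<^sub>R d"] by simp
    also have "\<dots> \<le> norm (G h - h *\<^sub>R d) + c * \<bar>h\<bar>" using G[of h] h by simp
    finally show "norm d \<le> norm (G h - h *\<^sub>R d) / norm h + c" using h by (simp add: field_simps)
  qed
  ultimately have "norm d \<le> 0 + c" by (intro tendsto_lowerbound[where F = "at (0::real)"]) auto
  then show ?thesis by simp
qed

context bloch_kernel
begin

lemma W_eq:
  assumes "0 < \<epsilon>" "\<epsilon> \<le> \<eta>" "k \<in> {-pi..pi}"
  shows "W a K \<omega> \<psi> \<epsilon> \<eta> k = Wsum (\<epsilon> / \<eta>) k"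
  unfolding W_def Wsum_def using assms by (simp add: W_term_eq)

lemma W_L2_Linf_bounds:
  assumes e: "0 < \<epsilon>" "\<epsilon> \<le> \<eta>"
  defines "f \<equiv> W a K \<omega> \<psi> \<epsilon> \<eta>" and "C \<equiv> 2 * M * (pi * CW)"
  shows "in_L2 {-pi<..<pi} f" "in_Linf {-pi<..<pi} f"
    "L2_norm_on {-pi<..<pi} f \<le> C * sqrt (2 * pi)" "Linf_norm_on {-pi<..<pi} f \<le> ereal C"
proof -
  have \<alpha>: "0 < \<epsilon> / \<eta>" "\<epsilon> / \<eta> \<le> 1" using e by auto
  let ?S = "{-pi<..<pi}"
  have S: "?S \<in> sets lebesgue" by simp
  have C: "0 \<le> C" unfolding C_def using M_nonneg CW_nonneg by simp
  have b: "norm (f k) \<le> C" if "k \<in> ?S" for k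
  proof -
    have k: "k \<in> {-pi..pi}" using that by auto
    have "norm (f k) \<le> 2 * M * (\<bar>k\<bar> * CW)" unfolding f_def W_eq[OF e k] by (rule Wsum_bound(2)[OF k \<alpha>])
    also have "\<dots> \<le> C" unfolding C_def using k M_nonneg CW_nonneg by (intro mult_left_mono mult_right_mono) auto
    finally show ?thesis .
  qed
  have "continuous_on ?S f"
  proof (rule continuous_on_eq[OF continuous_on_subset[OF Wsum_cont[OF \<alpha>]]])
    show "Wsum (\<epsilon> / \<eta>) k = f k" if "k \<in> ?S" for k
      unfolding f_def by (rule W_eq[OF e, symmetric]) (use that in auto)
  qed auto
  then have m: "f \<in> borel_measurable (lebesgue_on ?S)"
    by (rule continuous_imp_measurable_on_sets_lebesgue[OF _ S])
  have sp: "space (lebesgue_on ?S) = ?S" by simp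
  have fm: "finite_measure (lebesgue_on ?S)"
    by (rule finite_measure_lebesgue_on) (use lmeasurable_box[of "-pi" pi] in simp)
  have b2: "(norm (f k))\<^sup>2 \<le> C\<^sup>2" if "k \<in> ?S" for k using b[OF that] by (intro power_mono) auto
  have m2: "(\<lambda>x. (norm (f x))\<^sup>2) \<in> borel_measurable (lebesgue_on ?S)" using m by measurable
  have i: "integrable (lebesgue_on ?S) (\<lambda>x. (norm (f x))\<^sup>2)"
    by (rule finite_measure.integrable_const_bound[OF fm _ m2, of "C\<^sup>2"]) (use b2 in \<open>auto intro!: AE_I2\<close>)
  show "in_L2 ?S f" using m i by (simp add: in_L2_def)
  have me: "(\<lambda>x. ereal (norm (f x))) \<in> borel_measurable (lebesgue_on ?S)" using m by measurable
  show li: "Linf_norm_on ?S f \<le> ereal C"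
    unfolding Linf_norm_on_def by (rule esssup_I[OF me]) (use b in \<open>auto intro!: AE_I2\<close>)
  show "in_Linf ?S f" using m le_less_trans[OF li, of \<infinity>] by (simp add: in_Linf_def)
  have "(LINT x|lebesgue_on ?S. (norm (f x))\<^sup>2) \<le> (LINT x|lebesgue_on ?S. C\<^sup>2)"
    by (rule integral_mono[OF i finite_measure.integrable_const[OF fm]]) (use b2 in auto)
  also have "\<dots> = C\<^sup>2 * (2 * pi)"
    by (simp add: measure_restrict_space)
  finally have "L2_norm_on ?S f \<le> sqrt (C\<^sup>2 * (2 * pi))"
    unfolding L2_norm_on_def by (rule real_sqrt_le_mono)
  then show "L2_norm_on ?S f \<le> C * sqrt (2 * pi)" using C by (simp add: real_sqrt_mult)
qed

end

theorem theorem4: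
  fixes a K :: "real \<Rightarrow> real"
    and \<omega> :: "nat \<Rightarrow> real \<Rightarrow> real"
    and \<psi> :: "nat \<Rightarrow> real \<Rightarrow> real \<Rightarrow> complex"
    and q :: nat
  assumes a_C1: "a C1_differentiable_on UNIV"
    and a_periodic: "\<forall>y. a (y + 1) = a y"
    and a_positive: "\<exists>c>0. \<forall>y. c \<le> a y"
    and bloch: "bloch_waves a \<omega> \<psi>"
    and q: "q \<ge> 1"
    and K: "\<exists>p. K \<in> kernels p q"
  shows "(\<forall>\<alpha>\<^sub>0. 0 < \<alpha>\<^sub>0 \<and> \<alpha>\<^sub>0 \<le> 1 \<longrightarrow>
           (\<exists>C::real. \<forall>\<epsilon> \<eta>. 0 < \<epsilon> \<and> \<epsilon> \<le> \<eta> \<and> \<eta> \<le> 1 \<and> \<epsilon> / \<eta> \<le> \<alpha>\<^sub>0 \<longrightarrow>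
              (\<forall>k\<in>{-pi<..<pi}. summable (\<lambda>m. W_term a K \<omega> \<psi> \<epsilon> \<eta> m k)) \<and>
              in_L2 {-pi<..<pi} (W a K \<omega> \<psi> \<epsilon> \<eta>) \<and>
              in_Linf {-pi<..<pi} (W a K \<omega> \<psi> \<epsilon> \<eta>) \<and>
              L2_norm_on {-pi<..<pi} (W a K \<omega> \<psi> \<epsilon> \<eta>) \<le> C \<and>
              Linf_norm_on {-pi<..<pi} (W a K \<omega> \<psi> \<epsilon> \<eta>) \<le> ereal C))
       \<and> (K \<in> kernels 0 q \<longrightarrow>
           (\<forall>\<epsilon> \<eta>. 0 < \<epsilon> \<and> \<epsilon> \<le> \<eta> \<and> \<eta> \<le> 1 \<and>
              Cn_on 0 (W a K \<omega> \<psi> \<epsilon> \<eta>) {-pi<..<pi} \<longrightarrow>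
              W a K \<omega> \<psi> \<epsilon> \<eta> 0 = 0))
       \<and> (K \<in> kernels 1 q \<longrightarrow>
           times_differentiable_at 2 (\<lambda>k. Omega \<omega> k * B \<psi> k) 0 \<and>
           (\<exists>C::real. \<forall>\<epsilon> \<eta>. 0 < \<epsilon> \<and> \<epsilon> \<le> \<eta> \<and> \<eta> \<le> 1 \<and>
              Cn_on 1 (W a K \<omega> \<psi> \<epsilon> \<eta>) {-pi<..<pi} \<longrightarrow>
              norm (nderiv 1 (W a K \<omega> \<psi> \<epsilon> \<eta>) 0
                    - \<i> / 2 * of_real (nderiv 2 (\<lambda>k. Omega \<omega> k * B \<psi> k) 0))
                \<le> C * (\<epsilon> / \<eta>) ^ q))
       \<and> (\<forall>r::nat. r \<ge> 2 \<and> K \<in> kernels r q \<longrightarrow>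
           times_differentiable_at (r + 1) (\<lambda>k. Omega \<omega> k * B \<psi> k) 0 \<and>
           (\<exists>C::real. \<forall>\<epsilon> \<eta>. 0 < \<epsilon> \<and> \<epsilon> \<le> \<eta> \<and> \<eta> \<le> 1 \<and>
              Cn_on r (W a K \<omega> \<psi> \<epsilon> \<eta>) {-pi<..<pi} \<longrightarrow>
              times_differentiable_at r (W0 a K \<omega> \<psi> \<epsilon> \<eta>) 0 \<and>
              norm (nderiv r (W0 a K \<omega> \<psi> \<epsilon> \<eta>) 0
                    - \<i> / of_nat (r + 1) * of_real (nderiv (r + 1) (\<lambda>k. Omega \<omega> k * B \<psi> k) 0))
                \<le> C * (\<epsilon> powi (1 - int r) * (\<epsilon> / \<eta>) ^ q)))"
proof -
  interpret bloch a \<omega> \<psi> by unfold_locales (rule a_C1 a_periodic a_positive bloch)+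
  obtain p where Kp: "K \<in> kernels p q" using K by blast
  obtain M where M: "0 < M" "kernel_derivs q (\<lambda>j. nderiv j K) M" by (rule kernels_imp_kernel_derivs[OF Kp])
  interpret bloch_kernel a \<omega> \<psi> K q M by unfold_locales (rule M(2) q)+
  obtain \<rho> C where \<rho>: "0 < \<rho>" "\<rho> \<le> 1/4"
    and OB: "\<And>n. times_differentiable_at n (\<lambda>k. Omega \<omega> k * B \<psi> k) 0"
    and gt: "\<And>\<alpha> r q' f. \<lbrakk>0 < \<alpha>; \<alpha> \<le> 1; 1 \<le> r; K \<in> kernels r q';
       \<forall>k. \<bar>k\<bar> < \<rho> \<longrightarrow> f k = b_coef \<psi> 0 k * of_real (sK \<alpha> (\<omega> 0 k)) * LK \<alpha> k (flux 0 k)\<rbrakk> \<Longrightarrow>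
       times_differentiable_at r f 0 \<and> f differentiable (at 0) \<and>
       norm (nderiv r f 0 - \<i> / of_nat (r + 1) * of_real (nderiv (r + 1) (\<lambda>k. Omega \<omega> k * B \<psi> k) 0)) \<le> C r * (\<alpha> ^ q / \<alpha> ^ (r - 1))"
    by (rule ground_term_derivative) (rule that)
  have W0e: "W0 a K \<omega> \<psi> \<epsilon> \<eta> k = b_coef \<psi> 0 k * of_real (sK (\<epsilon> / \<eta>) (\<omega> 0 k)) * LK (\<epsilon> / \<eta>) k (flux 0 k)"
    if "0 < \<epsilon>" "\<epsilon> \<le> \<eta>" "\<bar>k\<bar> \<le> 1/4" for \<epsilon> \<eta> k
    unfolding W0_def by (rule W_term_eq) (use that pi_gt3 in auto)
  \<comment> \<open>The series bound carries the factor |k|, which is 0 here.\<close>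
  have W00: "W a K \<omega> \<psi> \<epsilon> \<eta> 0 = 0" if "0 < \<epsilon>" "\<epsilon> \<le> \<eta>" for \<epsilon> \<eta>
    using W_eq[OF that, of 0] Wsum_bound(2)[of 0 "\<epsilon> / \<eta>"] that by simp
  define C2 where "C2 = 2 * M * (2 * pi) ^ q * (1 / sqrt (amin / 4)) ^ q * CW"
  have first: "norm (nderiv 1 (W a K \<omega> \<psi> \<epsilon> \<eta>) 0 - \<i> / 2 * of_real (nderiv 2 (\<lambda>k. Omega \<omega> k * B \<psi> k) 0)) \<le> (C 1 + C2) * (\<epsilon> / \<eta>) ^ q"
    if K1: "K \<in> kernels 1 q" and e: "0 < \<epsilon>" "\<epsilon> \<le> \<eta>" "\<eta> \<le> 1" and Cn: "Cn_on 1 (W a K \<omega> \<psi> \<epsilon> \<eta>) {-pi<..<pi}" for \<epsilon> \<eta>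
  proof -
    let ?W = "W a K \<omega> \<psi> \<epsilon> \<eta>" and ?V = "W0 a K \<omega> \<psi> \<epsilon> \<eta>"
    have \<alpha>: "0 < \<epsilon> / \<eta>" "\<epsilon> / \<eta> \<le> 1" using e by auto
    have g: "?V differentiable (at 0) \<and>
       norm (nderiv 1 ?V 0 - \<i> / 2 * of_real (nderiv 2 (\<lambda>k. Omega \<omega> k * B \<psi> k) 0)) \<le> C 1 * (\<epsilon> / \<eta>) ^ q"
    proof -
      have "\<forall>k. \<bar>k\<bar> < \<rho> \<longrightarrow> ?V k = b_coef \<psi> 0 k * of_real (sK (\<epsilon> / \<eta>) (\<omega> 0 k)) * LK (\<epsilon> / \<eta>) k (flux 0 k)"
        using W0e[OF e(1,2)] \<rho>(2) by simp
      from gt[OF \<alpha> _ K1 this] show ?thesis by (simp add: numeral_2_eq_2)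
    qed
    have "?W differentiable (at 0)" using Cn by (auto simp: Cn_on_def nderiv_0)
    then have Wd: "(?W has_vector_derivative nderiv 1 ?W 0) (at 0)"
      unfolding One_nat_def nderiv_Suc nderiv_0 by (simp add: vector_derivative_works)
    have W0d: "(?V has_vector_derivative nderiv 1 ?V 0) (at 0)"
      using g unfolding One_nat_def nderiv_Suc nderiv_0 by (simp add: vector_derivative_works)
    have "norm (nderiv 1 ?W 0 - nderiv 1 ?V 0) \<le> C2 * (\<epsilon> / \<eta>) ^ q"
    proof (rule vector_derivative_le_of_linear_bound[OF has_vector_derivative_diff[OF Wd W0d], of "1/4"])
      fix k :: real assume k: "\<bar>k\<bar> < 1/4"
      have "k \<in> {-pi..pi}" using k pi_gt3 by auto
      then show "norm (?W k - ?V k) \<le> C2 * (\<epsilon> / \<eta>) ^ q * \<bar>k\<bar>"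
        using Wsum_minus_ground[of k "\<epsilon> / \<eta>"] k \<alpha> W0e[OF e(1,2), of k] W_eq[OF e(1,2), of k] by (simp add: C2_def)
    qed simp
    then have "norm (nderiv 1 ?W 0 - nderiv 1 ?V 0 + (nderiv 1 ?V 0 - \<i> / 2 * of_real (nderiv 2 (\<lambda>k. Omega \<omega> k * B \<psi> k) 0)))
        \<le> C2 * (\<epsilon> / \<eta>) ^ q + C 1 * (\<epsilon> / \<eta>) ^ q"
      using g by (intro order_trans[OF norm_triangle_ineq] add_mono) auto
    then show ?thesis by (simp add: distrib_right add.commute)
  qed
  have higher: "times_differentiable_at r (W0 a K \<omega> \<psi> \<epsilon> \<eta>) 0 \<and>
      norm (nderiv r (W0 a K \<omega> \<psi> \<epsilon> \<eta>) 0 - \<i> / of_nat (r + 1) * of_real (nderiv (r + 1) (\<lambda>k. Omega \<omega> k * B \<psi> k) 0))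
      \<le> \<bar>C r\<bar> * (\<epsilon> powi (1 - int r) * (\<epsilon> / \<eta>) ^ q)"
    if r: "2 \<le> r" and Kr: "K \<in> kernels r q" and e: "0 < \<epsilon>" "\<epsilon> \<le> \<eta>" "\<eta> \<le> 1" for r \<epsilon> \<eta>
  proof -
    let ?\<alpha> = "\<epsilon> / \<eta>"
    have \<alpha>: "0 < ?\<alpha>" "?\<alpha> \<le> 1" using e by auto
    have r1: "1 \<le> r" using r by simp
    have W0e': "\<forall>k. \<bar>k\<bar> < \<rho> \<longrightarrow> W0 a K \<omega> \<psi> \<epsilon> \<eta> k = b_coef \<psi> 0 k * of_real (sK ?\<alpha> (\<omega> 0 k)) * LK ?\<alpha> k (flux 0 k)"
      using W0e[OF e(1,2)] \<rho>(2) by simp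
    note g = gt[OF \<alpha> r1 Kr W0e']
    have "\<epsilon> powi (1 - int r) = 1 / \<epsilon> ^ (r - 1)"
    proof -
      have "1 - int r = - int (r - 1)" using r by simp
      then show ?thesis by (simp only: power_int_minus power_int_of_nat inverse_eq_divide)
    qed
    moreover have "C r * (?\<alpha> ^ q / ?\<alpha> ^ (r - 1)) \<le> \<bar>C r\<bar> * (1 / \<epsilon> ^ (r - 1) * ?\<alpha> ^ q)"
    proof -
      \<comment> \<open>From \<eta> \<le> 1. It allows the \<alpha>^(1-r) obtained so far to be
        replaced by the larger \<epsilon>^(1-r) of the claim.\<close>
      have "\<epsilon> \<le> ?\<alpha>" using e by (simp add: field_simps mult_left_le)
      then have "?\<alpha> ^ q / ?\<alpha> ^ (r - 1) \<le> ?\<alpha> ^ q / \<epsilon> ^ (r - 1)"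
        using e \<alpha> by (intro divide_left_mono power_mono mult_pos_pos zero_less_power zero_le_power) auto
      then show ?thesis using \<alpha> by (intro mult_mono) auto
    qed
    ultimately show ?thesis using g by auto
  qed
  show ?thesis
  proof (intro conjI allI impI)
    fix \<alpha>\<^sub>0 :: real
    show "\<exists>C::real. \<forall>\<epsilon> \<eta>. 0 < \<epsilon> \<and> \<epsilon> \<le> \<eta> \<and> \<eta> \<le> 1 \<and> \<epsilon> / \<eta> \<le> \<alpha>\<^sub>0 \<longrightarrow>
              (\<forall>k\<in>{-pi<..<pi}. summable (\<lambda>m. W_term a K \<omega> \<psi> \<epsilon> \<eta> m k)) \<and>
              in_L2 {-pi<..<pi} (W a K \<omega> \<psi> \<epsilon> \<eta>) \<and>
              in_Linf {-pi<..<pi} (W a K \<omega> \<psi> \<epsilon> \<eta>) \<and>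
              L2_norm_on {-pi<..<pi} (W a K \<omega> \<psi> \<epsilon> \<eta>) \<le> C \<and>
              Linf_norm_on {-pi<..<pi} (W a K \<omega> \<psi> \<epsilon> \<eta>) \<le> ereal C"
    \<comment> \<open>One constant for both norms: the factor \<open>sqrt (2 * pi) + 1\<close>
      dominates the square root of the interval length in the L2 bound and the 1 in the supremum
      bound.\<close>
    proof (rule exI[of _ "2 * M * (pi * CW) * (sqrt (2 * pi) + 1)"], intro allI impI, elim conjE)
      fix \<epsilon> \<eta> :: real assume e: "0 < \<epsilon>" "\<epsilon> \<le> \<eta>"
      have \<alpha>: "0 < \<epsilon> / \<eta>" "\<epsilon> / \<eta> \<le> 1" using e by auto
      have C0: "0 \<le> 2 * M * (pi * CW)" using M_nonneg CW_nonneg by simp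
      note w = W_L2_Linf_bounds[OF e]
      have s: "summable (\<lambda>m. W_term a K \<omega> \<psi> \<epsilon> \<eta> m k)" if "k \<in> {-pi<..<pi}" for k
        using Wsum_bound(1)[OF _ \<alpha>, of k] that e by (simp add: W_term_eq)
      have "2 * M * (pi * CW) * sqrt (2 * pi) \<le> 2 * M * (pi * CW) * (sqrt (2 * pi) + 1)"
        "2 * M * (pi * CW) * 1 \<le> 2 * M * (pi * CW) * (sqrt (2 * pi) + 1)"
        using C0 by (intro mult_left_mono; simp)+
      then show "(\<forall>k\<in>{-pi<..<pi}. summable (\<lambda>m. W_term a K \<omega> \<psi> \<epsilon> \<eta> m k)) \<and>
              in_L2 {-pi<..<pi} (W a K \<omega> \<psi> \<epsilon> \<eta>) \<and>
              in_Linf {-pi<..<pi} (W a K \<omega> \<psi> \<epsilon> \<eta>) \<and>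
              L2_norm_on {-pi<..<pi} (W a K \<omega> \<psi> \<epsilon> \<eta>) \<le> 2 * M * (pi * CW) * (sqrt (2 * pi) + 1) \<and>
              Linf_norm_on {-pi<..<pi} (W a K \<omega> \<psi> \<epsilon> \<eta>) \<le> ereal (2 * M * (pi * CW) * (sqrt (2 * pi) + 1))"
        using s w(1,2) order_trans[OF w(3)] order_trans[OF w(4)] by simp
    qed
  next
    show "W a K \<omega> \<psi> \<epsilon> \<eta> 0 = 0"
      if "0 < \<epsilon> \<and> \<epsilon> \<le> \<eta> \<and> \<eta> \<le> 1 \<and> Cn_on 0 (W a K \<omega> \<psi> \<epsilon> \<eta>) {-pi<..<pi}" for \<epsilon> \<eta>
      using that W00 by blast
  next
    show "times_differentiable_at 2 (\<lambda>k. Omega \<omega> k * B \<psi> k) 0" by (rule OB)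
  next
    assume "K \<in> kernels 1 q"
    then show "\<exists>C::real. \<forall>\<epsilon> \<eta>. 0 < \<epsilon> \<and> \<epsilon> \<le> \<eta> \<and> \<eta> \<le> 1 \<and> Cn_on 1 (W a K \<omega> \<psi> \<epsilon> \<eta>) {-pi<..<pi} \<longrightarrow>
              norm (nderiv 1 (W a K \<omega> \<psi> \<epsilon> \<eta>) 0 - \<i> / 2 * of_real (nderiv 2 (\<lambda>k. Omega \<omega> k * B \<psi> k) 0))
                \<le> C * (\<epsilon> / \<eta>) ^ q"
      using first by blast
  next
    show "times_differentiable_at (r + 1) (\<lambda>k. Omega \<omega> k * B \<psi> k) 0" for r by (rule OB)
  next
    fix r :: nat assume "2 \<le> r \<and> K \<in> kernels r q"
    then show "\<exists>C::real. \<forall>\<epsilon> \<eta>. 0 < \<epsilon> \<and> \<epsilon> \<le> \<eta> \<and> \<eta> \<le> 1 \<and> Cn_on r (W a K \<omega> \<psi> \<epsilon> \<eta>) {-pi<..<pi} \<longrightarrow>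
              times_differentiable_at r (W0 a K \<omega> \<psi> \<epsilon> \<eta>) 0 \<and>
              norm (nderiv r (W0 a K \<omega> \<psi> \<epsilon> \<eta>) 0 - \<i> / of_nat (r + 1) * of_real (nderiv (r + 1) (\<lambda>k. Omega \<omega> k * B \<psi> k) 0))
                \<le> C * (\<epsilon> powi (1 - int r) * (\<epsilon> / \<eta>) ^ q)"
      using higher by blast
  qed
qed

end
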